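(* Let $(\mathcal{K}_i)_{i\in\mathbb{N}}$ be a sequence of meshes of $\mathbb{R}^n$ and set $\delta_i=\sup_{K\in\mathcal{K}_i}\mathrm{diam}(K)$ for all $i\in\mathbb{N}$. Let $V=v(M,\theta)$ be a rectifiable $d$-varifold in $\mathbb{R}^n$ with $\|V\|(\mathbb{R}^n)<+\infty$. Then there exists a sequence of discrete (volumetric or point cloud) varifolds $(V_i)_i$ with the following properties: (i) $\Delta^{1,1}(V_i,V)\to0$ as $i\to\infty$; (ii) if $V$ is piecewise $C^{1,\beta}$, then there exist constants $C,R>0$ such that for all balls $B$ with radius $r_B\in(0,R)$ centered on the support of $\|V\|$ one has \[ \Delta^{1,1}_B(V_i,V)\le C\left(\delta_i^\beta+\frac{\delta_i}{r_B+\delta_i}\right)\|V\|(B^{C\delta_i}) \] and \[ \Delta^{1,1}(V_i,V)\le C\left(\delta_i^\beta+\frac{\delta_i}{R}\right)\|V\|(\mathbb{R}^n). \]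
   Context: Fix integers $1\le d<n$. $G_{d,n}$ is the Grassmannian of $d$-dimensional linear subspaces of $\mathbb{R}^n$; a subspace $S$ is identified with the orthogonal projection onto it, with metric $\|S-P\|$ (operator norm). A $d$-varifold in $\mathbb{R}^n$ is a non-negative Radon measure $V$ on $\mathbb{R}^n\times G_{d,n}$; its mass is the measure $\|V\|(B)=V(B\times G_{d,n})$. The rectifiable $d$-varifold $V=v(M,\theta)$, with $M$ countably $d$-rectifiable and $\theta\ge0$ with $\theta>0$ $\mathcal{H}^d$-a.e. on $M$, is given by $\int\varphi\,dV=\int_M\varphi(x,T_xM)\,\theta(x)\,d\mathcal{H}^d(x)$ for $\varphi\in C^0_c(\mathbb{R}^n\times G_{d,n})$, $T_xM$ being the approximate tangent space, which exists $\mathcal{H}^d$-a.e. on $M$. A mesh of $\mathbb{R}^n$ is a countable partition $\mathcal{K}$ of $\mathbb{R}^n$ into cells such that only finitely many cells meet any given bounded set. A discrete volumetric varifold associated with a mesh $\mathcal{K}$ is $\sum_{K\in\mathcal{K}}\frac{m_K}{|K|}\mathcal{L}^n_{|K}\otimes\delta_{P_K}$, where $|K|=\mathcal{L}^n(K)$, $m_K\ge0$, $P_K\in G_{d,n}$. A point cloud varifold is $\sum_j m_j\,\delta_{x_j}\otimes\delta_{P_j}$ with points $x_j\in\mathbb{R}^n$, masses $m_j\ge0$ and $P_j\in G_{d,n}$, where the family of points is finite or, more generally, indexed by the cells of a mesh with one point in each cell. For $U\subset\mathbb{R}^n$ open and $d$-varifolds $V,W$ in $\mathbb{R}^n$, $\Delta^{1,1}_U(V,W)$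 is the supremum of $\left|\int\varphi\,dV-\int\varphi\,dW\right|$ over all $1$-Lipschitz $\varphi:\mathbb{R}^n\times G_{d,n}\to\mathbb{R}$ with $\|\varphi\|_\infty\le1$ and $\mathrm{spt}\,\varphi\subset U\times G_{d,n}$ (with respect to the metric $|x-y|+\|S-T\|$); $\Delta^{1,1}=\Delta^{1,1}_{\mathbb{R}^n}$. For a set $A$ and $\eta>0$, $A^\eta=\bigcup_{x\in A}B_\eta(x)$. Piecewise $C^{1,\beta}$ varifold: let $S$ be a $d$-rectifiable set, $\theta$ a positive Borel function on $S$, and $\beta\in(0,1]$. The rectifiable $d$-varifold $v(S,\theta)$ is piecewise $C^{1,\beta}$ if there exist $R>0$, $C\ge1$ and a closed set $\Sigma\subset S$ such that: (a) $C^{-1}r^d\le\mathcal{H}^d(S\cap B(x,r))\le Cr^d$ for all $x\in S$, $0<r<R$; (b) $C^{-1}r^{d-1}\le\mathcal{H}^{d-1}(\Sigma\cap B(z,r))\le Cr^{d-1}$ for all $z\in\Sigma$, $0<r<R$; (c) the function $\tau(r)=\sup\{\|T_yS-T_zS\|:\ y,z\in S\cap B(x,r),\ x\in S\text{ with }\mathrm{dist}(x,\Sigma)>Cr\}$ satisfies $\tau(r)\le Cr^\beta$ for all $0<r<R$; (d) for all $0<r<\epsilon<R$ and all $z\in\Sigma$, $C^{-1}r\,\mathcal{H}^{d-1}(\Sigma\cap B(z,\epsilon))\le\mathcal{H}^d(S\cap\Sigma^r\cap B(z,\epsilon))\le C\,r\,\mathcal{H}^{d-1}(\Sigma\cap B(z,\epsilon))$,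 with $\Sigma^r$ the $r$-neighbourhood of $\Sigma$; (e) $C^{-1}\le\theta(x)\le C$ for $\mathcal{H}^d$-almost all $x\in S$. *)

theory Defs
  imports "HOL-Analysis.Analysis"
begin

section \<open>Hausdorff measure\<close>

text \<open>Diameter and distance to a set with values in [0,\<infinity>]. The library's real-valued versions
  return 0 for an unbounded set and for the distance to the empty set, which is not what is meant here.\<close>

definition ediam :: "'a::metric_space set \<Rightarrow> ennreal" where
  "ediam A = (SUP x\<in>A. SUP y\<in>A. ennreal (dist x y))"

definition einfdist :: "'a::metric_space \<Rightarrow> 'a set \<Rightarrow> ennreal" where
  "einfdist x A = (INF y\<in>A. ennreal (dist x y))"

text \<open>The empty set gets weight 0 also for d = 0, where the formula would give 0^0 = 1.\<close>

definition hausdorff_weight :: "nat \<Rightarrow> 'a::metric_space set \<Rightarrow> ennreal" where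
  "hausdorff_weight d A =
     (if A = {} then 0 else ennreal (unit_ball_vol (real d)) * (ediam A / 2) ^ d)"

definition hausdorff_pre :: "nat \<Rightarrow> ennreal \<Rightarrow> 'a::metric_space set \<Rightarrow> ennreal" where
  "hausdorff_pre d \<epsilon> A =
     (INF c\<in>{c :: nat \<Rightarrow> 'a set. A \<subseteq> (\<Union>j. c j) \<and> (\<forall>j. ediam (c j) \<le> \<epsilon>)}. \<Sum>j. hausdorff_weight d (c j))"

definition hausdorff_outer :: "nat \<Rightarrow> 'a::metric_space set \<Rightarrow> ennreal" where
  "hausdorff_outer d A = (SUP \<epsilon>\<in>{0<..}. hausdorff_pre d \<epsilon> A)"

text \<open>The (complete) measure on the Caratheodory-measurable sets.\<close>

definition hausdorff_measure :: "nat \<Rightarrow> 'a::metric_space measure" where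
  "hausdorff_measure d =
     measure_of UNIV (lambda_system UNIV UNIV (hausdorff_outer d)) (hausdorff_outer d)"

lemma hausdorff_pre_empty: "hausdorff_pre d \<epsilon> ({} :: 'a::metric_space set) = 0"
proof -
  have "hausdorff_pre d \<epsilon> ({} :: 'a set) \<le> (\<Sum>j::nat. hausdorff_weight d ({} :: 'a set))"
    unfolding hausdorff_pre_def
    by (rule INF_lower[of "\<lambda>_. {}"]) (simp add: ediam_def bot_ennreal)
  then show ?thesis by (simp add: hausdorff_weight_def)
qed

lemma hausdorff_pre_mono: "A \<subseteq> B \<Longrightarrow> hausdorff_pre d \<epsilon> A \<le> hausdorff_pre d \<epsilon> B"
  unfolding hausdorff_pre_def by (rule INF_superset_mono) auto

lemma hausdorff_pre_countably_subadditive: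
  fixes A :: "nat \<Rightarrow> 'a::metric_space set"
  shows "hausdorff_pre d \<epsilon> (\<Union>n. A n) \<le> (\<Sum>n. hausdorff_pre d \<epsilon> (A n))"
proof (rule ennreal_le_epsilon)
  fix e :: real
  assume fin: "(\<Sum>n. hausdorff_pre d \<epsilon> (A n)) < top" and e: "0 < e"
  have "\<exists>c. A n \<subseteq> (\<Union>j. c j) \<and> (\<forall>j. ediam (c j) \<le> \<epsilon>) \<and>
      (\<Sum>j::nat. hausdorff_weight d (c j)) < hausdorff_pre d \<epsilon> (A n) + e * (1/2) ^ Suc n" for n
  proof -
    have "hausdorff_pre d \<epsilon> (A n) < top"
      using fin by (auto simp add: less_top dest!: ennreal_suminf_lessD)
    then have "hausdorff_pre d \<epsilon> (A n) < hausdorff_pre d \<epsilon> (A n) + e * (1/2) ^ Suc n"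
      using e by (auto simp: less_top)
    then show ?thesis
      unfolding hausdorff_pre_def INF_less_iff by auto
  qed
  then obtain c where c: "\<And>n. A n \<subseteq> (\<Union>j. c n j)" "\<And>n j. ediam (c n j) \<le> \<epsilon>"
    and le: "\<And>n. (\<Sum>j::nat. hausdorff_weight d (c n j)) < hausdorff_pre d \<epsilon> (A n) + e * (1/2) ^ Suc n"
    by metis
  define C where "C = case_prod c \<circ> prod_decode"
  have "(\<Union>n. A n) \<subseteq> (\<Union>i. C i)"
    using c(1) by (auto simp add: C_def subset_eq) (metis prod.case prod_encode_inverse)
  moreover have "ediam (C i) \<le> \<epsilon>" for i
    by (simp add: C_def split_def c(2))
  ultimately have "hausdorff_pre d \<epsilon> (\<Union>n. A n) \<le> (\<Sum>i. hausdorff_weight d (C i))"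
    unfolding hausdorff_pre_def by (intro INF_lower) auto
  also have "\<dots> = (\<Sum>n. \<Sum>j. hausdorff_weight d (c n j))"
    unfolding C_def comp_def
    using suminf_ennreal_2dimen[of "\<lambda>n. \<Sum>j. hausdorff_weight d (c n j)"
        "\<lambda>p. hausdorff_weight d (case_prod c p)"] by simp
  also have "\<dots> \<le> (\<Sum>n. hausdorff_pre d \<epsilon> (A n) + e * (1/2) ^ Suc n)"
    by (intro suminf_le less_imp_le[OF le] summableI)
  also have "\<dots> = (\<Sum>n. hausdorff_pre d \<epsilon> (A n)) + (\<Sum>n. ennreal e * ennreal ((1/2) ^ Suc n))"
    using e by (subst suminf_add[symmetric])
      (auto simp del: ennreal_suminf_cmult simp add: ennreal_mult[symmetric])
  also have "\<dots> = (\<Sum>n. hausdorff_pre d \<epsilon> (A n)) + e"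
    unfolding ennreal_suminf_cmult
    by (subst suminf_ennreal_eq[OF zero_le_power power_half_series]) auto
  finally show "hausdorff_pre d \<epsilon> (\<Union>n. A n) \<le> (\<Sum>n. hausdorff_pre d \<epsilon> (A n)) + ennreal e" .
qed

lemma outer_measure_space_hausdorff:
  "outer_measure_space UNIV (hausdorff_outer d :: 'a::metric_space set \<Rightarrow> ennreal)"
  unfolding outer_measure_space_def
proof (intro conjI)
  show "positive UNIV (hausdorff_outer d)"
    by (simp add: positive_def hausdorff_outer_def hausdorff_pre_empty flip: bot_ennreal)
  show "increasing UNIV (hausdorff_outer d)"
    by (auto simp: increasing_def hausdorff_outer_def intro!: SUP_mono hausdorff_pre_mono)
  show "countably_subadditive UNIV (hausdorff_outer d :: 'a set \<Rightarrow> ennreal)"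
    unfolding countably_subadditive_def
  proof (intro allI impI)
    fix A :: "nat \<Rightarrow> 'a set"
    have "hausdorff_pre d \<epsilon> (\<Union>n. A n) \<le> (\<Sum>n. hausdorff_outer d (A n))" if "0 < \<epsilon>" for \<epsilon>
    proof -
      have "hausdorff_pre d \<epsilon> (A n) \<le> hausdorff_outer d (A n)" for n
        unfolding hausdorff_outer_def using that by (intro SUP_upper) simp
      then have "(\<Sum>n. hausdorff_pre d \<epsilon> (A n)) \<le> (\<Sum>n. hausdorff_outer d (A n))"
        by (intro suminf_le summableI)
      with hausdorff_pre_countably_subadditive show ?thesis
        by (rule order_trans)
    qed
    then show "hausdorff_outer d (\<Union>n. A n) \<le> (\<Sum>n. hausdorff_outer d (A n))"
      unfolding hausdorff_outer_def[of d "\<Union>n. A n"] by (intro SUP_least) simp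
  qed
qed

lemma measure_space_hausdorff:
  "measure_space UNIV (lambda_system UNIV UNIV (hausdorff_outer d)) (hausdorff_outer d)"
proof -
  interpret sigma_algebra UNIV UNIV
    using sigma_algebra_Pow[of UNIV] by simp
  show ?thesis by (rule caratheodory_lemma[OF outer_measure_space_hausdorff])
qed

lemma space_hausdorff_measure [simp]: "space (hausdorff_measure d) = UNIV"
  by (simp add: hausdorff_measure_def space_measure_of_conv)

lemma sets_hausdorff_measure:
  "sets (hausdorff_measure d) = lambda_system UNIV UNIV (hausdorff_outer d)"
  unfolding hausdorff_measure_def
  by (rule sigma_algebra.sets_measure_of_eq)
    (rule measure_space_hausdorff[unfolded measure_space_def, THEN conjunct1])

lemma emeasure_hausdorff_measure:
  "A \<in> sets (hausdorff_measure d) \<Longrightarrow> emeasure (hausdorff_measure d) A = hausdorff_outer d A"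
  unfolding sets_hausdorff_measure unfolding hausdorff_measure_def
  by (rule emeasure_measure_of_sigma)
    (simp_all add: measure_space_hausdorff[unfolded measure_space_def])


section \<open>Grassmannian and varifolds\<close>

text \<open>A subspace is identified with its orthogonal projection; the norm of
  \<^typ>\<open>'a \<Rightarrow>\<^sub>L 'a\<close> is the operator norm.\<close>

definition grassmannian :: "nat \<Rightarrow> ('a::euclidean_space \<Rightarrow>\<^sub>L 'a) set" where
  "grassmannian d =
     {P :: 'a \<Rightarrow>\<^sub>L 'a. \<exists>S. subspace S \<and> dim S = d \<and> (\<forall>x. P x \<in> S \<and> (\<forall>y\<in>S. (x - P x) \<bullet> y = 0))}"

definition grassmann_borel :: "nat \<Rightarrow> ('a::euclidean_space \<times> ('a \<Rightarrow>\<^sub>L 'a)) measure" where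
  "grassmann_borel d = restrict_space borel (UNIV \<times> grassmannian d)"

text \<open>The underlying space is locally compact and separable, so a Borel measure that is finite on
  compact sets is automatically regular, i.e. Radon.\<close>

definition varifold :: "nat \<Rightarrow> ('a::euclidean_space \<times> ('a \<Rightarrow>\<^sub>L 'a)) measure \<Rightarrow> bool" where
  "varifold d V \<longleftrightarrow> sets V = sets (grassmann_borel d) \<and>
     (\<forall>K. compact K \<and> K \<subseteq> UNIV \<times> grassmannian d \<longrightarrow> emeasure V K < \<infinity>)"

text \<open>The mass measure of V, i.e. B maps to V(B \<times> G).\<close>

definition mass_measure :: "('a::euclidean_space \<times> ('a \<Rightarrow>\<^sub>L 'a)) measure \<Rightarrow> 'a measure" where
  "mass_measure V = distr V borel fst"

lemma emeasure_mass_measure: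
  assumes "varifold d V" "B \<in> sets borel"
  shows "emeasure (mass_measure V) B = emeasure V (B \<times> grassmannian d)"
proof -
  have s: "sets V = sets (grassmann_borel d)" using assms(1) by (simp add: varifold_def)
  have "fst \<in> borel_measurable (borel :: ('a \<times> ('a \<Rightarrow>\<^sub>L 'a)) measure)"
    by (intro borel_measurable_continuous_onI continuous_intros)
  then have "fst \<in> borel_measurable V"
    unfolding measurable_cong_sets[OF s refl] grassmann_borel_def by (rule measurable_restrict_space1)
  moreover have "fst -` B \<inter> space V = B \<times> grassmannian d"
    using sets_eq_imp_space_eq[OF s] by (auto simp: grassmann_borel_def space_restrict_space)
  ultimately show ?thesis
    using assms(2) by (simp add: mass_measure_def emeasure_distr)
qed

definition measure_support :: "'a::metric_space measure \<Rightarrow> 'a set" where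
  "measure_support \<mu> = {x. \<forall>r>0. emeasure \<mu> (ball x r) > 0}"


section \<open>Rectifiable varifolds\<close>

text \<open>The d-dimensional Euclidean space parametrizing the Lipschitz pieces is realized as a
  d-dimensional subspace E of the ambient space.\<close>

definition countably_rectifiable :: "nat \<Rightarrow> 'a::euclidean_space set \<Rightarrow> bool" where
  "countably_rectifiable d M \<longleftrightarrow> M \<in> sets (hausdorff_measure d) \<and>
     (\<exists>E (f :: nat \<Rightarrow> 'a \<Rightarrow> 'a). subspace E \<and> dim E = d \<and> (\<forall>j. \<exists>L. L-lipschitz_on E (f j)) \<and>
        hausdorff_outer d (M - (\<Union>j. f j ` E)) = 0)"

text \<open>Approximate tangent space of M at x with respect to the density \<theta>: the blow-ups at x of
  \<theta> times the Hausdorff measure on M converge weakly to \<theta>(x) times the Hausdorff measure on the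
  plane. The density is there because M itself need not have locally finite Hausdorff measure; up to
  null sets the tangent space does not depend on it.\<close>

definition approx_tangent_space ::
  "nat \<Rightarrow> 'a::euclidean_space set \<Rightarrow> ('a \<Rightarrow> real) \<Rightarrow> 'a \<Rightarrow> ('a \<Rightarrow>\<^sub>L 'a) \<Rightarrow> bool" where
  "approx_tangent_space d M \<theta> x P \<longleftrightarrow> P \<in> grassmannian d \<and>
     (\<forall>f :: 'a \<Rightarrow> real. continuous_on UNIV f \<and> compact (closure {y. f y \<noteq> 0}) \<longrightarrow>
        ((\<lambda>r. (\<integral>y. f ((1 / r) *\<^sub>R (y - x)) * \<theta> y \<partial>restrict_space (hausdorff_measure d) M) / r ^ d)
          \<longlongrightarrow> \<theta> x * (\<integral>y. f y \<partial>restrict_space (hausdorff_measure d) (range (blinfun_apply P))))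
        (at_right 0))"

definition test_functions_Cc :: "nat \<Rightarrow> ('a::euclidean_space \<times> ('a \<Rightarrow>\<^sub>L 'a) \<Rightarrow> real) set" where
  "test_functions_Cc d = {\<phi>. continuous_on (UNIV \<times> grassmannian d) \<phi> \<and>
     compact (closure {p \<in> UNIV \<times> grassmannian d. \<phi> p \<noteq> 0})}"

text \<open>V = v(M, \<theta>). The field T is any selection of the approximate tangent spaces, which are unique
  wherever \<theta> > 0. Integrability of the right-hand side is part of the defining identity since the
  library's integral is 0 for non-integrable functions.\<close>

definition rectifiable_varifold ::
  "nat \<Rightarrow> 'a::euclidean_space set \<Rightarrow> ('a \<Rightarrow> real) \<Rightarrow> ('a \<times> ('a \<Rightarrow>\<^sub>L 'a)) measure \<Rightarrow> bool" where
  "rectifiable_varifold d M \<theta> V \<longleftrightarrow>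
     varifold d V \<and> countably_rectifiable d M \<and>
     \<theta> \<in> borel_measurable (restrict_space (hausdorff_measure d) M) \<and>
     (\<forall>x\<in>M. 0 \<le> \<theta> x) \<and> (AE x in restrict_space (hausdorff_measure d) M. 0 < \<theta> x) \<and>
     (\<exists>T. (AE x in restrict_space (hausdorff_measure d) M. approx_tangent_space d M \<theta> x (T x)) \<and>
        (\<forall>\<phi>\<in>test_functions_Cc d.
           integrable (restrict_space (hausdorff_measure d) M) (\<lambda>x. \<phi> (x, T x) * \<theta> x) \<and>
           (\<integral>p. \<phi> p \<partial>V) = (\<integral>x. \<phi> (x, T x) * \<theta> x \<partial>restrict_space (hausdorff_measure d) M)))"


section \<open>Meshes and discrete varifolds\<close>

definition mesh :: "'a::euclidean_space set set \<Rightarrow> bool" where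
  "mesh \<K> \<longleftrightarrow> countable \<K> \<and> partition_on UNIV \<K> \<and> \<K> \<subseteq> sets borel \<and>
     (\<forall>B. bounded B \<longrightarrow> finite {K\<in>\<K>. K \<inter> B \<noteq> {}})"

definition mesh_size :: "'a::metric_space set set \<Rightarrow> ennreal" where
  "mesh_size \<K> = (SUP K\<in>\<K>. ediam K)"

text \<open>The set of x in K with (x, P K) in A is the slice giving the product of Lebesgue measure on K
  with the Dirac mass at P K. A cell of measure 0 contributes 0, since 0 is absorbing for
  multiplication in \<^typ>\<open>ennreal\<close>.\<close>

definition volumetric_varifold ::
  "nat \<Rightarrow> 'a::euclidean_space set set \<Rightarrow> ('a \<times> ('a \<Rightarrow>\<^sub>L 'a)) measure \<Rightarrow> bool" where
  "volumetric_varifold d \<K> W \<longleftrightarrow> sets W = sets (grassmann_borel d) \<and>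
     (\<exists>(m :: 'a set \<Rightarrow> real) P. (\<forall>K\<in>\<K>. 0 \<le> m K \<and> P K \<in> grassmannian d) \<and>
        (\<forall>A\<in>sets W. emeasure W A =
           (\<Sum>\<^sub>\<infinity>K\<in>\<K>. ennreal (m K) / emeasure lborel K * emeasure lborel {x\<in>K. (x, P K) \<in> A})))"

definition point_cloud_varifold ::
  "nat \<Rightarrow> 'a::euclidean_space set set \<Rightarrow> ('a \<times> ('a \<Rightarrow>\<^sub>L 'a)) measure \<Rightarrow> bool" where
  "point_cloud_varifold d \<K> W \<longleftrightarrow> sets W = sets (grassmann_borel d) \<and>
     (\<exists>(m :: 'a set \<Rightarrow> real) x P. (\<forall>K\<in>\<K>. 0 \<le> m K \<and> x K \<in> K \<and> P K \<in> grassmannian d) \<and>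
        (\<forall>A\<in>sets W. emeasure W A = (\<Sum>\<^sub>\<infinity>K\<in>\<K>. ennreal (m K) * indicator A (x K, P K))))"


section \<open>Localized bounded Lipschitz distance\<close>

definition test_functions_Lip ::
  "nat \<Rightarrow> 'a::euclidean_space set \<Rightarrow> ('a \<times> ('a \<Rightarrow>\<^sub>L 'a) \<Rightarrow> real) set" where
  "test_functions_Lip d U = {\<phi>.
     (\<forall>x y. \<forall>S\<in>grassmannian d. \<forall>T\<in>grassmannian d.
        \<bar>\<phi> (x, S) - \<phi> (y, T)\<bar> \<le> dist x y + norm (S - T)) \<and>
     (\<forall>x. \<forall>S\<in>grassmannian d. \<bar>\<phi> (x, S)\<bar> \<le> 1) \<and>
     closure {p \<in> UNIV \<times> grassmannian d. \<phi> p \<noteq> 0} \<subseteq> U \<times> grassmannian d}"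

text \<open>A test function whose integral is not defined (possible only if a varifold has infinite mass
  on U) makes the distance infinite instead of being integrated to the library's default 0.\<close>

definition bounded_lipschitz_dist ::
  "nat \<Rightarrow> 'a::euclidean_space set \<Rightarrow> ('a \<times> ('a \<Rightarrow>\<^sub>L 'a)) measure \<Rightarrow> ('a \<times> ('a \<Rightarrow>\<^sub>L 'a)) measure \<Rightarrow> ennreal"
  where
  "bounded_lipschitz_dist d U V W = (SUP \<phi>\<in>test_functions_Lip d U.
     if integrable V \<phi> \<and> integrable W \<phi> then ennreal \<bar>(\<integral>p. \<phi> p \<partial>V) - (\<integral>p. \<phi> p \<partial>W)\<bar> else \<infinity>)"


section \<open>Piecewise Hoelder-regular varifolds\<close>

definition nbhd :: "'a::metric_space set \<Rightarrow> ennreal \<Rightarrow> 'a set" where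
  "nbhd A \<eta> = (\<Union>x\<in>A. {y. ennreal (dist x y) < \<eta>})"

text \<open>The oscillation \<tau>(r). The supremum is over the points where the tangent space exists.\<close>

definition tangent_oscillation ::
  "nat \<Rightarrow> 'a::euclidean_space set \<Rightarrow> ('a \<Rightarrow> real) \<Rightarrow> 'a set \<Rightarrow> real \<Rightarrow> real \<Rightarrow> ennreal" where
  "tangent_oscillation d S \<theta> \<Sigma> C r =
     Sup {ennreal (norm (P - Q)) | P Q x y z.
        x \<in> S \<and> einfdist x \<Sigma> > ennreal (C * r) \<and> y \<in> S \<inter> ball x r \<and> z \<in> S \<inter> ball x r \<and>
        approx_tangent_space d S \<theta> y P \<and> approx_tangent_space d S \<theta> z Q}"

definition piecewise_C1 ::
  "nat \<Rightarrow> real \<Rightarrow> ('a::euclidean_space \<times> ('a \<Rightarrow>\<^sub>L 'a)) measure \<Rightarrow> bool" where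
  "piecewise_C1 d \<beta> V \<longleftrightarrow>
     (\<exists>S \<theta> R C \<Sigma>. rectifiable_varifold d S \<theta> V \<and>
        \<theta> \<in> borel_measurable (restrict_space borel S) \<and> (\<forall>x\<in>S. 0 < \<theta> x) \<and>
        R > 0 \<and> C \<ge> 1 \<and> closed \<Sigma> \<and> \<Sigma> \<subseteq> S \<and>
        (\<forall>x\<in>S. \<forall>r. 0 < r \<and> r < R \<longrightarrow>
           ennreal (r ^ d / C) \<le> hausdorff_outer d (S \<inter> ball x r) \<and>
           hausdorff_outer d (S \<inter> ball x r) \<le> ennreal (C * r ^ d)) \<and>
        (\<forall>z\<in>\<Sigma>. \<forall>r. 0 < r \<and> r < R \<longrightarrow>
           ennreal (r ^ (d - 1) / C) \<le> hausdorff_outer (d - 1) (\<Sigma> \<inter> ball z r) \<and>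
           hausdorff_outer (d - 1) (\<Sigma> \<inter> ball z r) \<le> ennreal (C * r ^ (d - 1))) \<and>
        (\<forall>r. 0 < r \<and> r < R \<longrightarrow> tangent_oscillation d S \<theta> \<Sigma> C r \<le> ennreal (C * r powr \<beta>)) \<and>
        (\<forall>r \<epsilon>. 0 < r \<and> r < \<epsilon> \<and> \<epsilon> < R \<longrightarrow> (\<forall>z\<in>\<Sigma>.
           ennreal (r / C) * hausdorff_outer (d - 1) (\<Sigma> \<inter> ball z \<epsilon>)
             \<le> hausdorff_outer d (S \<inter> nbhd \<Sigma> (ennreal r) \<inter> ball z \<epsilon>) \<and>
           hausdorff_outer d (S \<inter> nbhd \<Sigma> (ennreal r) \<inter> ball z \<epsilon>)
             \<le> ennreal (C * r) * hausdorff_outer (d - 1) (\<Sigma> \<inter> ball z \<epsilon>))) \<and>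
        (AE x in restrict_space (hausdorff_measure d) S. 1 / C \<le> \<theta> x \<and> \<theta> x \<le> C))"

text \<open>Extended power; a mesh may have infinite size.\<close>

definition ennreal_powr :: "ennreal \<Rightarrow> real \<Rightarrow> ennreal" where
  "ennreal_powr t \<beta> = (if t = \<infinity> then \<infinity> else ennreal (enn2real t powr \<beta>))"

end

theory Submission
  imports Defs "HOL-Probability.Probability"
begin

text \<open>
  Each point x is assigned a nearby cell K = s(x), the mass of V over the points assigned to K is
  spread over K, and the plane P(K) is chosen to minimise, up to a small error, the integral of the
  truncated distance to the tangent planes over these points. A 1-Lipschitz test function bounded
  by 1 changes under this transport by at most a multiple of the mesh size plus the distance of the
  plane at x to P(K), and by at most 2, so every error bound reduces to exhibiting one good
  competitor plane per cell.

  For the convergence, Borel regularity of the Hausdorff measure makes the tangent field almost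
  everywhere equal to a Borel one; V is then carried, up to small mass, by a compact graph, on which
  the tangent field is uniformly continuous, and any value on the graph is a competitor. In the
  piecewise regular case the competitor away from the singular set is the tangent plane at a point of
  the cell, and near the singular set the trivial bound is multiplied by the mass of a thin tube,
  which the dimensional bounds compare with the mass of the ball.

  Volumetric varifolds cannot put mass on Lebesgue-null cells, which may well carry all of V; such
  cells are assigned to a neighbouring cell of positive volume.
\<close>

section \<open>Borel regularity of the Hausdorff measure\<close>

text \<open>The given mesh sizes are not assumed to tend to 0, and with coarse cells no discrete
  varifold on them can approach V in general. The varifolds may therefore live on auxiliary grids of
  no larger size; every bound is increasing in the mesh size and so transfers to \<delta>_i. The
  planes are chosen by near-minimisation without reference to \<beta>, to the regularity constants
  or even to rectifiability, so one sequence satisfies the convergence and the bounds for every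
  admissible \<beta>. Competitors appear only in the analysis. Constants in units of \<delta>:
  spreading moves mass by at most 3 (to a chosen point of the own cell, on to a cell of positive
  volume, across that cell), so points assigned to the same cell are within 6 of each other; a test
  function supported in U is affected only in the open neighbourhood of radius 4, which contains
  distance 3; and the points assigned to a cell lie within 11 of U once one of them is within
  4.\<close>

lemma ediam_le_iff: "ediam A \<le> e \<longleftrightarrow> (\<forall>x\<in>A. \<forall>y\<in>A. ennreal (dist x y) \<le> e)"
  by (auto simp: ediam_def SUP_le_iff)

text \<open>Covering sets can be closed without changing their weight, so near-optimal covers may be
  taken Borel. The bound passes to the closure because the pairs at distance at most t form a closed
  set.\<close>

lemma ediam_closure: "ediam (closure A) = ediam A"
proof (rule antisym)
  show "ediam (closure A) \<le> ediam A"
  proof (cases "ediam A = \<infinity>")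
    case False
    then obtain t where t: "0 \<le> t" "ediam A = ennreal t"
      by (cases "ediam A") auto
    have "dist x y \<le> t" if "x \<in> closure A" "y \<in> closure A" for x y
    proof -
      have "(x, y) \<in> closure (A \<times> A)" using that by (simp add: closure_Times)
      moreover have "A \<times> A \<subseteq> {p. dist (fst p) (snd p) \<le> t}"
      proof clarify
        fix a b assume "a \<in> A" "b \<in> A"
        then have "ennreal (dist a b) \<le> ennreal t"
          using t(2) ediam_le_iff[of A "ennreal t"] order_refl[of "ennreal t"] by metis
        then show "dist (fst (a, b)) (snd (a, b)) \<le> t" using t(1) by simp
      qed
      moreover have "closed {p :: 'a \<times> 'a. dist (fst p) (snd p) \<le> t}"
        by (intro closed_Collect_le continuous_intros)
      ultimately have "(x, y) \<in> {p. dist (fst p) (snd p) \<le> t}"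
        using closure_minimal by blast
      then show ?thesis by simp
    qed
    then show ?thesis
      using t by (auto simp: ediam_le_iff intro!: ennreal_leI)
  qed auto
  show "ediam A \<le> ediam (closure A)"
    unfolding ediam_def using closure_subset by (intro SUP_subset_mono) auto
qed

lemma hausdorff_outer_mono: "A \<subseteq> B \<Longrightarrow> hausdorff_outer d A \<le> hausdorff_outer d B"
  unfolding hausdorff_outer_def by (intro SUP_mono') (rule hausdorff_pre_mono)

lemma hausdorff_outer_empty [simp]: "hausdorff_outer d {} = 0"
  by (simp add: hausdorff_outer_def hausdorff_pre_empty flip: bot_ennreal)

lemma hausdorff_outer_Un: "hausdorff_outer d (A \<union> B) \<le> hausdorff_outer d A + hausdorff_outer d B"
proof -
  have "countably_subadditive UNIV (hausdorff_outer d :: 'a set \<Rightarrow> ennreal)"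
    using outer_measure_space_hausdorff unfolding outer_measure_space_def by blast
  \<comment> \<open>Countable subadditivity is formulated for disjoint families, hence B - A instead
    of B.\<close>
  then have "hausdorff_outer d (\<Union>n::nat. if n = 0 then A else if n = 1 then B - A else {})
     \<le> (\<Sum>n::nat. hausdorff_outer d (if n = 0 then A else if n = 1 then B - A else {}))"
    unfolding countably_subadditive_def
    by (elim allE[of _ "\<lambda>n. if n = 0 then A else if n = 1 then B - A else {}"] mp)
      (auto simp: disjoint_family_on_def split: if_splits)
  also have "\<dots> = hausdorff_outer d A + hausdorff_outer d (B - A)"
    by (subst suminf_finite[of "{0,1}"]) auto
  also have "\<dots> \<le> hausdorff_outer d A + hausdorff_outer d B"
    by (intro add_left_mono hausdorff_outer_mono) auto
  also have "(\<Union>n::nat. if n = 0 then A else if n = 1 then B - A else {}) = A \<union> B"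
    by (auto split: if_splits)
  finally show ?thesis .
qed

text \<open>At each scale \<open>e k\<close> the sets of a cover with weight below the outer measure
  plus \<open>e k\<close> are closed up; the intersection over k of these unions is Borel and is
  still covered at every scale. When the outer measure of A is infinite, \<open>UNIV\<close>
  serves.\<close>

lemma hausdorff_outer_Borel_hull:
  fixes A :: "'a::metric_space set"
  obtains B where "B \<in> sets borel" "A \<subseteq> B" "hausdorff_outer d B = hausdorff_outer d A"
proof (cases "hausdorff_outer d A = \<infinity>")
  case True
  have "hausdorff_outer d A \<le> hausdorff_outer d (UNIV :: 'a set)"
    by (rule hausdorff_outer_mono) simp
  with True that[of UNIV] show ?thesis by (simp add: top.extremum_unique)
next
  case False
  define e where "e k = ennreal (inverse (real (Suc k)))" for k
  have e0: "e k > 0" for k by (simp add: e_def)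
  have le: "hausdorff_pre d (e k) A \<le> hausdorff_outer d A" for k
    unfolding hausdorff_outer_def using e0 by (intro SUP_upper) simp
  have "hausdorff_pre d (e k) A < hausdorff_outer d A + e k" for k
  proof -
    have "hausdorff_outer d A < hausdorff_outer d A + e k"
      using False e0[of k] by (auto simp: less_top)
    with le show ?thesis by (rule le_less_trans)
  qed
  then have "\<exists>c. A \<subseteq> (\<Union>j. c j) \<and> (\<forall>j. ediam (c j) \<le> e k) \<and>
      (\<Sum>j::nat. hausdorff_weight d (c j)) < hausdorff_outer d A + e k" for k
    unfolding hausdorff_pre_def INF_less_iff by auto
  then obtain c where c: "\<And>k. A \<subseteq> (\<Union>j. c k j)" "\<And>k j. ediam (c k j) \<le> e k"
    "\<And>k. (\<Sum>j::nat. hausdorff_weight d (c k j)) < hausdorff_outer d A + e k"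
    by metis
  define B where "B = (\<Inter>k. \<Union>j. closure (c k j))"
  have AB: "A \<subseteq> B" unfolding B_def using c(1) closure_subset by blast
  have "B \<in> sets borel" unfolding B_def by measurable
  have pre: "hausdorff_pre d (e k) B \<le> hausdorff_outer d A + e k" for k
  proof -
    have "hausdorff_pre d (e k) B \<le> (\<Sum>j. hausdorff_weight d (closure (c k j)))"
      unfolding hausdorff_pre_def
      by (rule INF_lower) (auto simp: B_def ediam_closure c(2))
    also have "\<dots> = (\<Sum>j. hausdorff_weight d (c k j))"
      by (simp add: hausdorff_weight_def ediam_closure cong: if_cong)
    finally show ?thesis using c(3)[of k] by (simp add: order_trans less_imp_le)
  qed
  have lim: "e \<longlonglongrightarrow> 0"
    unfolding e_def using LIMSEQ_inverse_real_of_nat by (simp add: tendsto_ennrealI flip: ennreal_0)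
  \<comment> \<open>Allowing larger pieces lowers \<open>hausdorff_pre\<close>, so an arbitrary
    scale t is controlled by any finer \<open>e k\<close>, and the excess \<open>e k\<close>
    disappears in the limit.\<close>
  have "hausdorff_pre d t B \<le> hausdorff_outer d A" if t: "0 < t" for t
  proof (rule LIMSEQ_le_const)
    show "(\<lambda>k. hausdorff_outer d A + e k) \<longlonglongrightarrow> hausdorff_outer d A"
      using tendsto_add[OF tendsto_const lim] by simp
    have "\<forall>\<^sub>F k in sequentially. e k < t"
      using lim t by (rule order_tendstoD)
    then show "\<exists>N. \<forall>k\<ge>N. hausdorff_pre d t B \<le> hausdorff_outer d A + e k"
      unfolding eventually_sequentially
    proof (elim exE, intro exI allI impI)
      fix N k assume "\<forall>k\<ge>N. e k < t" "N \<le> k"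
      then have "e k \<le> t" by (simp add: less_imp_le)
      then have "hausdorff_pre d t B \<le> hausdorff_pre d (e k) B"
        unfolding hausdorff_pre_def by (intro INF_superset_mono) (auto intro: order_trans)
      then show "hausdorff_pre d t B \<le> hausdorff_outer d A + e k"
        using pre order_trans by blast
    qed
  qed
  then have "hausdorff_outer d B \<le> hausdorff_outer d A"
    unfolding hausdorff_outer_def[of d B] by (intro SUP_least) simp
  with hausdorff_outer_mono[OF AB] \<open>B \<in> sets borel\<close> AB that show ?thesis
    by (meson antisym)
qed

text \<open>Caratheodory's condition tests E against arbitrary sets, so B may be a Borel hull about
  whose own measurability nothing has been shown.\<close>

lemma hausdorff_outer_lambda:
  assumes "E \<in> sets (hausdorff_measure d)"
  shows "hausdorff_outer d (B \<inter> E) + hausdorff_outer d (B - E) = hausdorff_outer d B"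
  using assms unfolding sets_hausdorff_measure lambda_system_def by (auto simp: Int_commute Diff_eq)

text \<open>Splitting the hull along E leaves H(E) + H(B - E) = H(E); finiteness of H(E) is what
  allows the cancellation in \<open>ennreal\<close>.\<close>

lemma hausdorff_Borel_hull_diff:
  fixes E :: "'a::metric_space set"
  assumes "E \<in> sets (hausdorff_measure d)" "hausdorff_outer d E < \<infinity>"
  obtains B where "B \<in> sets borel" "E \<subseteq> B" "hausdorff_outer d (B - E) = 0"
proof -
  obtain B where B: "B \<in> sets borel" "E \<subseteq> B" "hausdorff_outer d B = hausdorff_outer d E"
    by (rule hausdorff_outer_Borel_hull)
  have "hausdorff_outer d E + hausdorff_outer d (B - E) = hausdorff_outer d E + 0"
    using hausdorff_outer_lambda[OF assms(1), of B] B by (simp add: Int_absorb1)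
  then have "hausdorff_outer d (B - E) = 0"
    using assms(2) by (metis ennreal_add_left_cancel infinity_ennreal_def less_irrefl)
  with B that show ?thesis by blast
qed

section \<open>Finite-dimensional spaces of operators\<close>

text \<open>Closed balls of integer radius are totally bounded; the finite nets for all radii and
  all tolerances 1/(m+1) are dense together.\<close>

lemma heine_borel_countable_dense:
  "\<exists>D :: 'a::{heine_borel, real_normed_vector} set. countable D \<and> (\<forall>x. \<forall>e>0. \<exists>y\<in>D. dist x y < e)"
proof -
  have "\<exists>k. finite k \<and> cball (0::'a) (real n) \<subseteq> (\<Union>x\<in>k. ball x (inverse (real (Suc m))))" for n m
    using seq_compact_imp_totally_bounded[of "cball (0::'a) (real n)"]
      compact_cball compact_eq_seq_compact_metric
    by (metis inverse_positive_iff_positive of_nat_0_less_iff zero_less_Suc)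
  then obtain k where k: "\<And>n m. finite (k n m)"
    "\<And>n m. cball (0::'a) (real n) \<subseteq> (\<Union>x\<in>k n m. ball x (inverse (real (Suc m))))"
    by metis
  have "\<exists>y\<in>(\<Union>n m. k n m). dist x y < e" if e: "e > 0" for x e
  proof -
    obtain m where m: "inverse (real (Suc m)) < e" using reals_Archimedean[OF e] by auto
    obtain n where "norm x \<le> real n" using real_arch_simple by blast
    then have "x \<in> cball 0 (real n)" by simp
    with k(2) obtain y where y: "y \<in> k n m" "x \<in> ball y (inverse (real (Suc m)))" by blast
    with m have "dist x y < e" by (simp add: dist_commute)
    with y show ?thesis by blast
  qed
  moreover have "countable (\<Union>n m. k n m)"
    using countable_finite[OF k(1)] by auto
  ultimately show ?thesis by blast
qed

text \<open>Balls of radius 1/(n+1) around a countable dense set form a basis. Second countability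
  makes the product of the ambient space with the operators a separable complete metric space, as
  inner regularity of finite Borel measures requires, and identifies its Borel sigma-algebra with
  the product one.\<close>

instance blinfun :: (euclidean_space, euclidean_space) second_countable_topology
proof
  obtain D :: "('a \<Rightarrow>\<^sub>L 'b) set" where D: "countable D" "\<And>x e. e > 0 \<Longrightarrow> \<exists>y\<in>D. dist x y < e"
    using heine_borel_countable_dense by metis
  define B where "B = (\<lambda>(y, n). ball y (inverse (real (Suc n)))) ` (D \<times> (UNIV :: nat set))"
  have "topological_basis B"
  proof (rule topological_basisI)
    show "open A" if "A \<in> B" for A using that by (auto simp: B_def)
    fix U and x :: "'a \<Rightarrow>\<^sub>L 'b" assume "open U" "x \<in> U"
    then obtain e where e: "e > 0" "ball x e \<subseteq> U" by (auto simp: open_contains_ball)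
    obtain n where n: "inverse (real (Suc n)) < e / 2" using reals_Archimedean[of "e/2"] e by auto
    obtain y where y: "y \<in> D" "dist x y < inverse (real (Suc n))" using D(2) by (metis inverse_positive_iff_positive of_nat_0_less_iff zero_less_Suc)
    have "ball y (inverse (real (Suc n))) \<subseteq> ball x e"
    proof
      fix z assume "z \<in> ball y (inverse (real (Suc n)))"
      then show "z \<in> ball x e" using n y dist_triangle[of x z y] by simp
    qed
    with e y show "\<exists>A\<in>B. x \<in> A \<and> A \<subseteq> U"
      by (intro bexI[of _ "ball y (inverse (real (Suc n)))"]) (auto simp: B_def dist_commute)
  qed
  moreover have "countable B" unfolding B_def using D(1) by auto
  ultimately show "\<exists>B::('a \<Rightarrow>\<^sub>L 'b) set set. countable B \<and> open = generate_topology B"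
    using topological_basis_imp_subbasis by blast
qed

section \<open>The Grassmannian\<close>

text \<open>Orthogonality gives |P x|^2 = x . P x, and Cauchy-Schwarz finishes. Boundedness of the
  Grassmannian is why a cut-off in the space variable alone has compact support.\<close>

lemma grassmannian_norm_le:
  assumes "P \<in> grassmannian d" shows "norm P \<le> 1"
proof (rule norm_blinfun_bound)
  fix x
  from assms obtain S where S: "subspace S" "\<And>x. P x \<in> S" "\<And>x y. y \<in> S \<Longrightarrow> (x - P x) \<bullet> y = 0"
    unfolding grassmannian_def by blast
  have "(x - P x) \<bullet> P x = 0" using S by blast
  then have "(norm (P x))\<^sup>2 = x \<bullet> P x" by (simp add: inner_diff_left power2_norm_eq_inner)
  also have "\<dots> \<le> norm x * norm (P x)" by (rule norm_cauchy_schwarz)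
  finally show "norm (P x) \<le> 1 * norm x"
    by (cases "norm (P x) = 0") (auto simp: power2_eq_square)
qed simp

text \<open>The witness is the orthogonal projection built from an orthonormal basis of a
  d-dimensional subspace. A plane is needed even in cells about which nothing is known.\<close>

lemma grassmannian_nonempty:
  assumes "d \<le> DIM('a)" shows "(grassmannian d :: ('a::euclidean_space \<Rightarrow>\<^sub>L 'a) set) \<noteq> {}"
proof -
  obtain S :: "'a set" where S: "subspace S" "dim S = d"
    using choose_subspace_of_subspace[of d "UNIV :: 'a set"] assms by auto
  obtain B where B: "B \<subseteq> S" "pairwise orthogonal B" "\<And>x. x \<in> B \<Longrightarrow> norm x = 1" "independent B" "card B = dim S" "span B = S"
    using orthonormal_basis_subspace[OF S(1)] by metis
  have finB: "finite B" using B(4) independent_imp_finite by blast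
  define f where "f x = (\<Sum>b\<in>B. (x \<bullet> b) *\<^sub>R b)" for x
  have bl: "bounded_linear f" unfolding f_def
    by (intro bounded_linear_sum bounded_linear_compose[OF bounded_linear_scaleR_left bounded_linear_inner_left])
  have fS: "f x \<in> S" for x unfolding f_def
    using B by (auto intro!: subspace_sum subspace_scale S(1))
  have orth: "(x - f x) \<bullet> c = 0" if c: "c \<in> B" for x c
  proof -
    have "f x \<bullet> c = (\<Sum>b\<in>B. (x \<bullet> b) * (b \<bullet> c))" by (simp add: f_def inner_sum_left)
    also have "\<dots> = (\<Sum>b\<in>B. if b = c then x \<bullet> c else 0)"
    proof (rule sum.cong)
      fix b assume "b \<in> B"
      then show "(x \<bullet> b) * (b \<bullet> c) = (if b = c then x \<bullet> c else 0)"
        using c B(2,3) by (auto simp: pairwise_def orthogonal_def dot_square_norm)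
    qed simp
    also have "\<dots> = x \<bullet> c" using c finB by simp
    finally show ?thesis by (simp add: inner_diff_left)
  qed
  have "(x - f x) \<bullet> y = 0" if "y \<in> S" for x y
  proof -
    have "y \<in> span B" using that B by simp
    then have "orthogonal (x - f x) y"
      by (rule orthogonal_to_span) (simp add: orth orthogonal_def)
    then show ?thesis by (simp add: orthogonal_def)
  qed
  then have "Blinfun f \<in> grassmannian d"
    unfolding grassmannian_def using S fS by (auto simp: bounded_linear_Blinfun_apply[OF bl])
  then show ?thesis by blast
qed

section \<open>Varifolds carried by a graph\<close>

lemma space_grassmann_borel: "space (grassmann_borel d) = UNIV \<times> grassmannian d"
  by (simp add: grassmann_borel_def space_restrict_space)

lemma varifold_space: "varifold d V \<Longrightarrow> space V = UNIV \<times> grassmannian d"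
  unfolding varifold_def using sets_eq_imp_space_eq space_grassmann_borel by metis

lemma varifold_sets: "varifold d V \<Longrightarrow> sets V = sets (grassmann_borel d)"
  by (simp add: varifold_def)

lemma varifold_measurable: "varifold d V \<Longrightarrow> f \<in> measurable borel N \<Longrightarrow> f \<in> measurable V N"
  using measurable_cong_sets[OF varifold_sets refl] measurable_restrict_space1
  unfolding grassmann_borel_def by blast

lemma varifold_mass_finite:
  assumes "varifold d V" "emeasure (mass_measure V) UNIV < \<infinity>"
  shows "finite_measure V"
proof
  show "emeasure V (space V) \<noteq> \<infinity>"
    using assms emeasure_mass_measure[OF assms(1), of UNIV] by (simp add: varifold_space)
qed

text \<open>Distance to the complement of U. The whole space is treated apart because
  \<open>infdist\<close> to the empty set is 0.\<close>

lemma open_positivity_set: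
  fixes U :: "'a::metric_space set"
  assumes "open U"
  shows "\<exists>h :: 'a \<Rightarrow> real. continuous_on UNIV h \<and> (\<forall>p. 0 \<le> h p) \<and> (\<forall>p. 0 < h p \<longleftrightarrow> p \<in> U)"
proof (cases "U = UNIV")
  case True
  then show ?thesis by (intro exI[of _ "\<lambda>_. 1"]) simp
next
  case False
  show ?thesis
  proof (intro exI[of _ "\<lambda>p. infdist p (- U)"] conjI allI)
    show "continuous_on UNIV (\<lambda>p. infdist p (- U))" by (intro continuous_intros)
    show "0 < infdist p (- U) \<longleftrightarrow> p \<in> U" for p
      using in_closed_iff_infdist_zero[of "- U" p] False assms infdist_nonneg[of p "- U"]
      by (auto simp: closed_open less_le)
  qed (rule infdist_nonneg)
qed

text \<open>The first factor rises to 1 wherever h is positive, the second confines the support to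
  norm at most k. For nonnegative continuous h the functions increase with k to the indicator of the
  open set where h is positive, so an identity on compactly supported functions reaches open sets by
  monotone convergence.\<close>

definition cutoff :: "('a \<times> 'b \<Rightarrow> real) \<Rightarrow> nat \<Rightarrow> 'a::real_normed_vector \<times> 'b \<Rightarrow> real" where
  "cutoff h k p = min 1 (real k * h p) * max 0 (min 1 (real k - norm (fst p)))"

lemma cutoff_bounds: "(\<And>p. 0 \<le> h p) \<Longrightarrow> 0 \<le> cutoff h k p \<and> cutoff h k p \<le> 1"
  unfolding cutoff_def by (auto intro!: mult_nonneg_nonneg mult_le_one)

lemma cutoff_mono:
  assumes "\<And>p. 0 \<le> h p" "k \<le> l" shows "cutoff h k p \<le> cutoff h l p"
proof -
  have "real k * h p \<le> real l * h p" using assms by (intro mult_right_mono) auto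
  then show ?thesis unfolding cutoff_def using assms by (intro mult_mono) auto
qed

lemma cutoff_Cc:
  fixes h :: "'a::euclidean_space \<times> ('a \<Rightarrow>\<^sub>L 'a) \<Rightarrow> real"
  assumes "continuous_on UNIV h"
  shows "cutoff h k \<in> test_functions_Cc d"
proof -
  have "continuous_on UNIV (cutoff h k)"
    unfolding cutoff_def by (intro continuous_intros assms)
  moreover have "{p \<in> UNIV \<times> grassmannian d. cutoff h k p \<noteq> 0} \<subseteq> cball 0 (real k) \<times> cball 0 1"
  proof clarify
    fix a P assume "P \<in> grassmannian d" "cutoff h k (a, P) \<noteq> 0"
    moreover have "norm a \<le> real k"
      using \<open>cutoff h k (a, P) \<noteq> 0\<close> by (rule contrapos_np) (simp add: cutoff_def)
    ultimately show "a \<in> cball 0 (real k) \<and> P \<in> cball 0 1"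
      using grassmannian_norm_le by auto
  qed
  then have "bounded {p \<in> UNIV \<times> grassmannian d. cutoff h k p \<noteq> 0}"
    using bounded_Times[OF bounded_cball bounded_cball] bounded_subset by blast
  ultimately show ?thesis
    unfolding test_functions_Cc_def
    by (auto simp: compact_eq_bounded_closed intro: continuous_on_subset)
qed

lemma cutoff_SUP:
  assumes h: "\<And>p. 0 \<le> h p" "\<And>p. 0 < h p \<longleftrightarrow> p \<in> U"
  shows "(SUP k. ennreal (cutoff h k p)) = indicator U p"
proof (cases "p \<in> U")
  case True
  then have "0 < h p" using h by blast
  obtain m where m: "1 / h p \<le> real m" using real_arch_simple by blast
  obtain l where l: "norm (fst p) + 1 \<le> real l" using real_arch_simple by blast
  define k where "k = max m l"
  have "1 \<le> real m * h p" using m \<open>0 < h p\<close> by (simp add: field_simps)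
  also have "\<dots> \<le> real k * h p" unfolding k_def using h(1)[of p] by (intro mult_right_mono) auto
  finally have "1 \<le> real k * h p" .
  moreover have "norm (fst p) + 1 \<le> real k" using l by (simp add: k_def)
  ultimately have "cutoff h k p = 1" by (simp add: cutoff_def)
  then have "1 \<le> (SUP k. ennreal (cutoff h k p))"
    by (intro SUP_upper2[of k]) auto
  moreover have "(SUP k. ennreal (cutoff h k p)) \<le> 1"
    by (intro SUP_least) (simp add: cutoff_bounds[OF h(1)])
  ultimately show ?thesis using True by simp
next
  case False
  then have "h p = 0" using h by (metis less_eq_real_def)
  then show ?thesis using False by (simp add: cutoff_def)
qed

lemma cutoff_pos_ex:
  assumes h: "\<And>p. 0 \<le> h p" "\<And>p. 0 < h p \<longleftrightarrow> p \<in> U"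
  shows "(\<exists>k. 0 < cutoff h k p) \<longleftrightarrow> p \<in> U"
proof -
  have "(\<exists>k. 0 < cutoff h k p) \<longleftrightarrow> 0 < (SUP k. ennreal (cutoff h k p))"
    by (simp add: less_SUP_iff)
  then show ?thesis by (simp add: cutoff_SUP[OF h] indicator_def)
qed

lemma Borel_measures_eqI:
  assumes "finite_measure A" "sets A = sets borel" "sets B = sets borel"
    and "\<And>U. open U \<Longrightarrow> emeasure A U = emeasure B U"
  shows "A = B"
proof (rule measure_eqI_generator_eq[of "{U. open U}" UNIV _ _ "\<lambda>_. UNIV"])
  show "Int_stable {U. open U}" by (auto simp: Int_stable_def)
  show "emeasure A UNIV \<noteq> \<infinity>"
    using finite_measure.emeasure_finite[OF assms(1)] by auto
qed (use assms in \<open>auto simp: borel_def\<close>)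

text \<open>The defining identity of v(M, \<theta>), tested only on compactly supported continuous
  functions, becomes an identity of measures: V is the image of the weighted Hausdorff measure N
  under the graph map of T. The carrier is cut down to \<open>M'\<close>, where \<theta> is positive
  and T x is a tangent plane at every point; tangency itself still refers to M.\<close>

definition tangent_graph ::
  "nat \<Rightarrow> 'a::euclidean_space set \<Rightarrow> ('a \<Rightarrow> real) \<Rightarrow> ('a \<times> ('a \<Rightarrow>\<^sub>L 'a)) measure \<Rightarrow>
    'a set \<Rightarrow> ('a \<Rightarrow> 'a \<Rightarrow>\<^sub>L 'a) \<Rightarrow> 'a measure \<Rightarrow> bool" where
  "tangent_graph d M \<theta> V M' T N \<longleftrightarrow>
     M' \<in> sets (hausdorff_measure d) \<and> M' \<subseteq> M \<and> hausdorff_outer d (M - M') = 0 \<and>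
     (\<forall>x\<in>M'. 0 < \<theta> x \<and> approx_tangent_space d M \<theta> x (T x)) \<and>
     \<theta> \<in> borel_measurable (restrict_space (hausdorff_measure d) M') \<and>
     N = density (restrict_space (hausdorff_measure d) M') (\<lambda>x. ennreal (\<theta> x)) \<and>
     (\<lambda>x. (x, T x)) \<in> measurable N (grassmann_borel d) \<and>
     V = distr N (grassmann_borel d) (\<lambda>x. (x, T x))"

text \<open>Removing a null set from the carrier makes the tangent field measurable and defined
  everywhere, although the selection in the definition of a rectifiable varifold is arbitrary
  on a null set.\<close>

lemma rectifiable_varifold_graph:
  fixes M :: "'a::euclidean_space set" and V :: "('a \<times> ('a \<Rightarrow>\<^sub>L 'a)) measure"
  assumes rect: "rectifiable_varifold d M \<theta> V" and fin: "emeasure (mass_measure V) UNIV < \<infinity>"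
  shows "\<exists>M' T N. tangent_graph d M \<theta> V M' T N"
proof -
  let ?H = "hausdorff_measure d :: 'a measure"
  have vf: "varifold d V" and Ms: "M \<in> sets ?H"
    and th: "\<theta> \<in> borel_measurable (restrict_space ?H M)"
    and pos: "AE x in restrict_space ?H M. 0 < \<theta> x"
    using rect by (auto simp: rectifiable_varifold_def countably_rectifiable_def)
  obtain T where T: "AE x in restrict_space ?H M. approx_tangent_space d M \<theta> x (T x)"
    and int: "\<And>\<phi>. \<phi> \<in> test_functions_Cc d \<Longrightarrow>
        integrable (restrict_space ?H M) (\<lambda>x. \<phi> (x, T x) * \<theta> x)"
    and eq: "\<And>\<phi>. \<phi> \<in> test_functions_Cc d \<Longrightarrow>
        (\<integral>p. \<phi> p \<partial>V) = (\<integral>x. \<phi> (x, T x) * \<theta> x \<partial>restrict_space ?H M)"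
    using rect by (auto simp: rectifiable_varifold_def)
  have "AE x in restrict_space ?H M. 0 < \<theta> x \<and> approx_tangent_space d M \<theta> x (T x)"
    using pos T by eventually_elim simp
  then have ae: "AE x in ?H. x \<in> M \<longrightarrow> 0 < \<theta> x \<and> approx_tangent_space d M \<theta> x (T x)"
    by (subst (asm) AE_restrict_space_iff) (use Ms in auto)
  then obtain N0 where N0: "N0 \<in> sets ?H" "emeasure ?H N0 = 0"
    "{x. \<not> (x \<in> M \<longrightarrow> 0 < \<theta> x \<and> approx_tangent_space d M \<theta> x (T x))} \<subseteq> N0"
    by (elim AE_E) auto
  define M' where "M' = M - N0"
  have M's: "M' \<in> sets ?H" using Ms N0 by (simp add: M'_def)
  have M'M: "M' \<subseteq> M" by (auto simp: M'_def)
  have good: "0 < \<theta> x \<and> approx_tangent_space d M \<theta> x (T x)" if "x \<in> M'" for x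
    using that N0(3) by (auto simp: M'_def)
  have TG: "T x \<in> grassmannian d" if "x \<in> M'" for x
    using good[OF that] by (simp add: approx_tangent_space_def)
  have null: "hausdorff_outer d (M - M') = 0"
  proof -
    have "hausdorff_outer d (M - M') \<le> hausdorff_outer d N0"
      by (rule hausdorff_outer_mono) (auto simp: M'_def)
    also have "\<dots> = 0" using N0 emeasure_hausdorff_measure by metis
    finally show ?thesis by simp
  qed
  have aeM: "AE x in ?H. x \<notin> N0" using N0 by (intro AE_I[of _ _ N0]) auto
  let ?R = "restrict_space ?H M'"
  have meas': "f \<in> borel_measurable ?R" if "f \<in> borel_measurable (restrict_space ?H M)"
    for f :: "'a \<Rightarrow> real"
  proof -
    have "?R = restrict_space (restrict_space ?H M) M'"
      using M'M by (simp add: restrict_restrict_space Ms M's Int_absorb1)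
    then show ?thesis using measurable_restrict_space1[OF that] by simp
  qed
  have th': "\<theta> \<in> borel_measurable ?R" by (rule meas'[OF th])
  have spR: "space ?R = M'" by (simp add: space_restrict_space)
  have int': "integrable ?R f \<and> (\<integral>x. f x \<partial>?R) = (\<integral>x. f x \<partial>restrict_space ?H M)"
    if f: "integrable (restrict_space ?H M) f" for f :: "'a \<Rightarrow> real"
  proof -
    have 1: "integrable ?H (\<lambda>x. indicator M x *\<^sub>R f x)"
      using f Ms by (simp add: integrable_restrict_space)
    have 3: "(\<lambda>x. indicator M' x *\<^sub>R f x) \<in> borel_measurable ?H"
      using borel_measurable_restrict_space_iff[of M' ?H f] meas'[OF borel_measurable_integrable[OF f]] M's
      by (simp add: mult.commute)
    have 2: "AE x in ?H. indicator M x *\<^sub>R f x = indicator M' x *\<^sub>R f x"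
      using aeM by eventually_elim (auto simp: M'_def indicator_def)
    have "integrable ?H (\<lambda>x. indicator M' x *\<^sub>R f x)"
      using integrable_cong_AE[OF borel_measurable_integrable[OF 1] 3 2] 1 by blast
    moreover have "(\<integral>x. indicator M x *\<^sub>R f x \<partial>?H) = (\<integral>x. indicator M' x *\<^sub>R f x \<partial>?H)"
      by (rule integral_cong_AE[OF borel_measurable_integrable[OF 1] 3 2])
    ultimately show ?thesis
      using Ms M's by (simp add: integrable_restrict_space integral_restrict_space)
  qed
  \<comment> \<open>Nothing is assumed about measurability of the selection T. The integrability
    demanded in the definition is the only source, and it delivers measurability of these
    products.\<close>
  have cut: "(\<lambda>x. cutoff h k (x, T x) * \<theta> x) \<in> borel_measurable ?R" if "continuous_on UNIV h" for h k
    using meas'[OF borel_measurable_integrable[OF int[OF cutoff_Cc[OF that]]]] .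
  have open_meas: "{x \<in> M'. (x, T x) \<in> U} \<in> sets ?R" if U: "open U" for U
  proof -
    obtain h :: "'a \<times> ('a \<Rightarrow>\<^sub>L 'a) \<Rightarrow> real" where h: "continuous_on UNIV h" "\<And>p. 0 \<le> h p" "\<And>p. 0 < h p \<longleftrightarrow> p \<in> U"
      using open_positivity_set[OF U] by blast
    \<comment> \<open>Since \<theta> is positive on \<open>M'\<close>, the product is positive
      exactly where the cut-off is, and these sets exhaust the preimage of U.\<close>
    have "{x \<in> M'. (x, T x) \<in> U} = (\<Union>k. {x \<in> space ?R. 0 < cutoff h k (x, T x) * \<theta> x})"
      using good by (auto simp: spR cutoff_pos_ex[OF h(2,3), symmetric] zero_less_mult_iff less_not_sym)
    also have "\<dots> \<in> sets ?R"
      using borel_measurable_less[OF borel_measurable_const cut[OF h(1)]] by (intro sets.countable_UN') auto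
    finally show ?thesis .
  qed
  have g: "(\<lambda>x. (x, T x)) \<in> measurable ?R (grassmann_borel d)"
    unfolding grassmann_borel_def
  proof (rule measurable_restrict_space2)
    show "(\<lambda>x. (x, T x)) \<in> space ?R \<rightarrow> UNIV \<times> grassmannian d" using TG by (auto simp: spR)
    show "(\<lambda>x. (x, T x)) \<in> borel_measurable ?R"
      by (rule borel_measurableI) (use open_meas in \<open>auto simp: spR vimage_def Int_def conj_commute\<close>)
  qed
  define N where "N = density ?R (\<lambda>x. ennreal (\<theta> x))"
  have gN: "(\<lambda>x. (x, T x)) \<in> measurable N (grassmann_borel d)"
    using g by (simp add: N_def)
  have bor: "id \<in> measurable (grassmann_borel d) (borel :: ('a \<times> ('a \<Rightarrow>\<^sub>L 'a)) measure)"
    unfolding grassmann_borel_def by (rule measurable_restrict_space1) simp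
  then have idV: "(\<lambda>p. p) \<in> borel_measurable V"
    using measurable_cong_sets[OF varifold_sets[OF vf] refl] by (auto simp: id_def)
  have gNb: "(\<lambda>x. (x, T x)) \<in> borel_measurable N"
    using measurable_comp[OF gN bor] by (simp add: comp_def)
  interpret fV: finite_measure V by (rule varifold_mass_finite[OF vf fin])
  \<comment> \<open>The measures are compared on the whole product space, where open sets generate
    the Borel sets; the restriction to planes in the Grassmannian is undone afterwards.\<close>
  have "distr V borel (\<lambda>p. p) = distr N borel (\<lambda>x. (x, T x))"
  proof (rule Borel_measures_eqI)
    show "finite_measure (distr V borel (\<lambda>p. p))"
      by (rule fV.finite_measure_distr[OF idV])
    fix U :: "('a \<times> ('a \<Rightarrow>\<^sub>L 'a)) set" assume U: "open U"
    obtain h :: "'a \<times> ('a \<Rightarrow>\<^sub>L 'a) \<Rightarrow> real" where h: "continuous_on UNIV h" "\<And>p. 0 \<le> h p" "\<And>p. 0 < h p \<longleftrightarrow> p \<in> U"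
      using open_positivity_set[OF U] by blast
    have cm: "cutoff h k \<in> borel_measurable borel" for k
      unfolding cutoff_def by (intro borel_measurable_continuous_onI continuous_intros h(1))
    have cV: "cutoff h k \<in> borel_measurable V" for k
      by (rule varifold_measurable[OF vf cm])
    have cb: "0 \<le> cutoff h k p" "cutoff h k p \<le> 1" for k p
      using cutoff_bounds[of h] h(2) by auto
    have inc: "incseq (\<lambda>k p. ennreal (cutoff h k p))"
      by (auto simp: incseq_def le_fun_def intro!: ennreal_leI cutoff_mono h(2))
    have "emeasure (distr V borel (\<lambda>p. p)) U = (\<integral>\<^sup>+p. indicator U p \<partial>distr V borel (\<lambda>p. p))"
      using U by simp
    also have "\<dots> = (\<integral>\<^sup>+p. indicator U p \<partial>V)"
      using U idV by (subst nn_integral_distr) auto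
    also have "\<dots> = (\<integral>\<^sup>+p. (SUP k. ennreal (cutoff h k p)) \<partial>V)"
      by (simp add: cutoff_SUP[OF h(2,3)])
    also have "\<dots> = (SUP k. \<integral>\<^sup>+p. ennreal (cutoff h k p) \<partial>V)"
      by (rule nn_integral_monotone_convergence_SUP[OF inc]) (use cV in measurable)
    \<comment> \<open>Here the defining identity of the varifold enters; \<theta> is then absorbed
      into the density of N.\<close>
    also have "\<dots> = (SUP k. \<integral>\<^sup>+x. ennreal (cutoff h k (x, T x) * \<theta> x) \<partial>?R)"
    proof (rule SUP_cong[OF refl])
      fix k
      have "integrable V (cutoff h k)"
        using cb by (intro fV.integrable_const_bound[of _ 1] AE_I2 cV) auto
      then have "(\<integral>\<^sup>+p. ennreal (cutoff h k p) \<partial>V) = ennreal (\<integral>p. cutoff h k p \<partial>V)"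
        using cb by (intro nn_integral_eq_integral) auto
      also have "\<dots> = ennreal (\<integral>x. cutoff h k (x, T x) * \<theta> x \<partial>?R)"
        using int'[OF int[OF cutoff_Cc[OF h(1)]]] eq[OF cutoff_Cc[OF h(1)]] by simp
      also have "\<dots> = (\<integral>\<^sup>+x. ennreal (cutoff h k (x, T x) * \<theta> x) \<partial>?R)"
        using int'[OF int[OF cutoff_Cc[OF h(1)]]] cb good
        by (intro nn_integral_eq_integral[symmetric] AE_I2) (auto simp: spR less_imp_le)
      finally show "(\<integral>\<^sup>+p. ennreal (cutoff h k p) \<partial>V) = (\<integral>\<^sup>+x. ennreal (cutoff h k (x, T x) * \<theta> x) \<partial>?R)" .
    qed
    also have "\<dots> = (SUP k. \<integral>\<^sup>+x. ennreal (cutoff h k (x, T x)) \<partial>N)"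
    proof (rule SUP_cong[OF refl])
      fix k
      have "(\<lambda>x. ennreal (cutoff h k (x, T x))) \<in> borel_measurable ?R"
        using measurable_compose[OF gNb cm[of k]] unfolding N_def by simp
      then have "(\<integral>\<^sup>+x. ennreal (cutoff h k (x, T x)) \<partial>N) = (\<integral>\<^sup>+x. ennreal (\<theta> x) * ennreal (cutoff h k (x, T x)) \<partial>?R)"
        unfolding N_def using th' by (subst nn_integral_density) auto
      also have "\<dots> = (\<integral>\<^sup>+x. ennreal (cutoff h k (x, T x) * \<theta> x) \<partial>?R)"
        using cb by (intro nn_integral_cong) (simp add: ennreal_mult'' mult.commute)
      finally show "(\<integral>\<^sup>+x. ennreal (cutoff h k (x, T x) * \<theta> x) \<partial>?R) = (\<integral>\<^sup>+x. ennreal (cutoff h k (x, T x)) \<partial>N)" ..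
    qed
    also have "\<dots> = (\<integral>\<^sup>+x. (SUP k. ennreal (cutoff h k (x, T x))) \<partial>N)"
    proof (rule nn_integral_monotone_convergence_SUP[symmetric])
      show "incseq (\<lambda>k x. ennreal (cutoff h k (x, T x)))" using inc by (auto simp: incseq_def le_fun_def)
      show "(\<lambda>x. ennreal (cutoff h k (x, T x))) \<in> borel_measurable N" for k
        using measurable_compose[OF gNb cm[of k]] by simp
    qed
    also have "\<dots> = (\<integral>\<^sup>+x. indicator U (x, T x) \<partial>N)"
      by (simp add: cutoff_SUP[OF h(2,3)])
    also have "\<dots> = (\<integral>\<^sup>+p. indicator U p \<partial>distr N borel (\<lambda>x. (x, T x)))"
      using U gNb by (subst nn_integral_distr) auto
    also have "\<dots> = emeasure (distr N borel (\<lambda>x. (x, T x))) U" using U by simp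
    finally show "emeasure (distr V borel (\<lambda>p. p)) U = emeasure (distr N borel (\<lambda>x. (x, T x))) U" .
  qed auto
  note ext = this
  have "V = distr N (grassmann_borel d) (\<lambda>x. (x, T x))"
  proof (rule measure_eqI)
    show "sets V = sets (distr N (grassmann_borel d) (\<lambda>x. (x, T x)))"
      using varifold_sets[OF vf] by simp
    fix A assume A: "A \<in> sets V"
    then obtain B where B: "B \<in> sets borel" "A = B \<inter> UNIV \<times> grassmannian d"
      unfolding varifold_sets[OF vf] grassmann_borel_def sets_restrict_space by auto
    have "emeasure V A = emeasure (distr V borel (\<lambda>p. p)) B"
      using B idV by (simp add: emeasure_distr varifold_space[OF vf])
    also have "\<dots> = emeasure N ((\<lambda>x. (x, T x)) -` B \<inter> space N)"
      unfolding ext using B gNb by (simp add: emeasure_distr)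
    also have "(\<lambda>x. (x, T x)) -` B \<inter> space N = (\<lambda>x. (x, T x)) -` A \<inter> space N"
      using B TG by (auto simp: N_def spR)
    also have "emeasure N \<dots> = emeasure (distr N (grassmann_borel d) (\<lambda>x. (x, T x))) A"
      using gN A by (simp add: emeasure_distr varifold_sets[OF vf])
    finally show "emeasure V A = emeasure (distr N (grassmann_borel d) (\<lambda>x. (x, T x))) A" .
  qed
  then have "tangent_graph d M \<theta> V M' T N"
    unfolding tangent_graph_def using M's M'M null good th' N_def gN by blast
  then show ?thesis by blast
qed

text \<open>Measurability of the identity says that traces on \<open>M'\<close> of Borel sets are
  Caratheodory measurable. It is a by-product of the measurability of the graph map, so the
  criterion for metric outer measures is bypassed.\<close>

lemma tangent_graph_measurable:
  assumes "tangent_graph d M \<theta> V M' T N"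
  shows "space N = M'" "(\<lambda>x. (x, T x)) \<in> borel_measurable N"
    "(\<lambda>x. x) \<in> borel_measurable N" "T \<in> borel_measurable N"
proof -
  have g: "(\<lambda>x. (x, T x)) \<in> measurable N (grassmann_borel d)"
    using assms unfolding tangent_graph_def by blast
  show "space N = M'" using assms by (simp add: tangent_graph_def space_restrict_space)
  have bor: "(\<lambda>p. p) \<in> measurable (grassmann_borel d) (borel :: ('a \<times> ('a \<Rightarrow>\<^sub>L 'a)) measure)"
    unfolding grassmann_borel_def by (rule measurable_restrict_space1) simp
  show gb: "(\<lambda>x. (x, T x)) \<in> borel_measurable N"
    using measurable_compose[OF g bor] .
  have cf: "(fst :: 'a \<times> ('a \<Rightarrow>\<^sub>L 'a) \<Rightarrow> 'a) \<in> borel_measurable borel"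
    "(snd :: 'a \<times> ('a \<Rightarrow>\<^sub>L 'a) \<Rightarrow> ('a \<Rightarrow>\<^sub>L 'a)) \<in> borel_measurable borel"
    by (intro borel_measurable_continuous_onI continuous_intros)+
  show "(\<lambda>x. x) \<in> borel_measurable N" "T \<in> borel_measurable N"
    using measurable_compose[OF gb cf(1)] measurable_compose[OF gb cf(2)] by simp_all
qed

lemma tangent_graph_emeasure:
  assumes g: "tangent_graph d M \<theta> V M' T N" and A: "A \<in> sets borel"
  shows "emeasure V (A \<inter> space V) = emeasure N {x \<in> M'. (x, T x) \<in> A}"
proof -
  have m: "(\<lambda>x. (x, T x)) \<in> measurable N (grassmann_borel d)"
    and V: "V = distr N (grassmann_borel d) (\<lambda>x. (x, T x))"
    using g unfolding tangent_graph_def by blast+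
  have "A \<inter> space (grassmann_borel d) \<in> sets (grassmann_borel d)"
    unfolding space_grassmann_borel unfolding grassmann_borel_def sets_restrict_space using A by blast
  then have "emeasure V (A \<inter> space V) = emeasure N ((\<lambda>x. (x, T x)) -` (A \<inter> space (grassmann_borel d)) \<inter> space N)"
    using m by (simp add: V emeasure_distr)
  also have "(\<lambda>x. (x, T x)) -` (A \<inter> space (grassmann_borel d)) \<inter> space N = {x \<in> M'. (x, T x) \<in> A}"
    using measurable_space[OF m] tangent_graph_measurable(1)[OF g] by auto
  finally show ?thesis .
qed

lemma tangent_graph_finite:
  assumes "tangent_graph d M \<theta> V M' T N" "finite_measure V" shows "finite_measure N"
proof
  have "emeasure N (space N) = emeasure V (space V)"
    using tangent_graph_emeasure[OF assms(1), of UNIV] tangent_graph_measurable(1)[OF assms(1)] by simp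
  then show "emeasure N (space N) \<noteq> \<infinity>" using finite_measure.emeasure_finite[OF assms(2)] by simp
qed

section \<open>Compact graphs of almost full measure\<close>

text \<open>Pairs in Q whose second components are at least e apart form a compact set. On it the
  distance of the first components attains a minimum, positive because distinct points of Q have
  distinct first components; this minimum is \<delta>.\<close>

lemma compact_graph_uniformly_continuous:
  fixes Q :: "('a::metric_space \<times> 'b::metric_space) set"
  assumes Q: "compact Q" and graph: "inj_on fst Q" and e: "e > 0"
  obtains \<delta> where "\<delta> > 0" "\<And>p q. p \<in> Q \<Longrightarrow> q \<in> Q \<Longrightarrow> dist (fst p) (fst q) < \<delta> \<Longrightarrow> dist (snd p) (snd q) < e"
proof -
  define D where "D = (Q \<times> Q) \<inter> {z. e \<le> dist (snd (fst z)) (snd (snd z))}"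
  have "compact D" unfolding D_def
    by (intro compact_Int_closed compact_Times Q closed_Collect_le continuous_intros)
  show thesis
  proof (cases "D = {}")
    case True
    then show ?thesis using that[of 1] by (force simp: D_def not_le)
  next
    case False
    have "continuous_on D (\<lambda>z. dist (fst (fst z)) (fst (snd z)))" by (intro continuous_intros)
    then obtain z where z: "z \<in> D" "\<And>w. w \<in> D \<Longrightarrow> dist (fst (fst z)) (fst (snd z)) \<le> dist (fst (fst w)) (fst (snd w))"
      using continuous_attains_inf[OF \<open>compact D\<close> False] by blast
    have "fst (fst z) \<noteq> fst (snd z)"
    proof
      assume "fst (fst z) = fst (snd z)"
      moreover have "fst z \<in> Q" "snd z \<in> Q" using z(1) by (auto simp: D_def)
      ultimately have "snd (fst z) = snd (snd z)" using graph by (metis inj_onD)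
      then show False using z(1) e by (simp add: D_def)
    qed
    then have "0 < dist (fst (fst z)) (fst (snd z))" by simp
    then show ?thesis
    proof (rule that)
      fix p q assume pq: "p \<in> Q" "q \<in> Q" "dist (fst p) (fst q) < dist (fst (fst z)) (fst (snd z))"
      show "dist (snd p) (snd q) < e"
      proof (rule ccontr)
        assume "\<not> dist (snd p) (snd q) < e"
        then have "(p, q) \<in> D" using pq by (simp add: D_def)
        with z(2)[of "(p, q)"] pq(3) show False by simp
      qed
    qed
  qed
qed

text \<open>Comparing matrix entries with rationals determines an operator by countably many open
  conditions. Countability lets the exceptional null sets be collected over all conditions at
  once.\<close>

lemma blinfun_rational_separation:
  fixes S T :: "'a::euclidean_space \<Rightarrow>\<^sub>L 'a"
  assumes "\<And>b c q. b \<in> Basis \<Longrightarrow> c \<in> Basis \<Longrightarrow> q \<in> \<rat> \<Longrightarrow> S b \<bullet> c < q \<longleftrightarrow> T b \<bullet> c < q"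
  shows "S = T"
proof (rule blinfun_euclidean_eqI)
  fix b :: 'a assume b: "b \<in> Basis"
  show "S b = T b"
  proof (rule euclidean_eqI)
    fix c :: 'a assume c: "c \<in> Basis"
    show "S b \<bullet> c = T b \<bullet> c"
    proof (rule ccontr)
      assume "S b \<bullet> c \<noteq> T b \<bullet> c"
      then consider "S b \<bullet> c < T b \<bullet> c" | "T b \<bullet> c < S b \<bullet> c" by linarith
      then show False
      proof cases
        case 1
        then obtain q where "q \<in> \<rat>" "S b \<bullet> c < q" "q < T b \<bullet> c" using Rats_dense_in_real by blast
        then show False using assms[OF b c, of q] by simp
      next
        case 2
        then obtain q where "q \<in> \<rat>" "T b \<bullet> c < q" "q < S b \<bullet> c" using Rats_dense_in_real by blast
        then show False using assms[OF b c, of q] by simp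
      qed
    qed
  qed
qed

text \<open>The Hausdorff measure of E may be infinite, but N is finite and \<theta> exceeds 1/(k+1)
  on \<open>E' k\<close>, so each level has finite measure and a hull with null excess; these hulls
  are united. The hypothesis on the identity makes the traces of the hulls measurable, so that the
  excess is a null set of N and not merely of outer measure 0.\<close>

lemma density_Borel_hull:
  fixes M :: "'a::metric_space set"
  assumes M: "M \<in> sets (hausdorff_measure d)"
    and th: "\<theta> \<in> borel_measurable (restrict_space (hausdorff_measure d) M)" "\<And>x. x \<in> M \<Longrightarrow> 0 < \<theta> x"
    and N: "N = density (restrict_space (hausdorff_measure d) M) (\<lambda>x. ennreal (\<theta> x))" "finite_measure N"
    and id: "(\<lambda>x. x) \<in> measurable N borel" and E: "E \<in> sets N"
  obtains B where "B \<in> sets borel" "E \<subseteq> B" "B \<inter> M - E \<in> null_sets N"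
proof -
  let ?H = "hausdorff_measure d :: 'a measure" and ?R = "restrict_space (hausdorff_measure d) M"
  have sR: "A \<in> sets ?R \<longleftrightarrow> A \<in> sets ?H \<and> A \<subseteq> M" for A
    using M by (subst sets_restrict_space_iff) auto
  have sN: "sets N = sets ?R" by (simp add: N)
  have spN: "space N = M" by (simp add: N space_restrict_space)
  have EM: "E \<subseteq> M" "E \<in> sets ?H" using E sN sR by auto
  have bor: "B \<inter> M \<in> sets ?H" if "B \<in> sets borel" for B
    using measurable_sets[OF id that] sN sR spN by (auto simp: vimage_def Int_def)
  define E' where "E' k = {x \<in> E. inverse (real (Suc k)) < \<theta> x}" for k
  have E': "E' k \<in> sets ?R" for k
  proof -
    have "{x \<in> space ?R. inverse (real (Suc k)) < \<theta> x} \<in> sets ?R"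
      by (rule borel_measurable_less[OF borel_measurable_const th(1)])
    then have "E \<inter> {x \<in> space ?R. inverse (real (Suc k)) < \<theta> x} \<in> sets ?R"
      using E sN by (intro sets.Int) auto
    also have "E \<inter> {x \<in> space ?R. inverse (real (Suc k)) < \<theta> x} = E' k"
      using EM by (auto simp: E'_def space_restrict_space)
    finally show ?thesis .
  qed
  have fin: "hausdorff_outer d (E' k) < \<infinity>" for k
  proof -
    let ?c = "ennreal (inverse (real (Suc k)))"
    have "?c * emeasure ?R (E' k) = (\<integral>\<^sup>+x. ?c * indicator (E' k) x \<partial>?R)"
      using nn_integral_cmult_indicator[OF E', of ?c] by (rule sym)
    also have "\<dots> \<le> (\<integral>\<^sup>+x. ennreal (\<theta> x) * indicator (E' k) x \<partial>?R)"
      by (intro nn_integral_mono) (auto simp: E'_def indicator_def intro!: ennreal_leI)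
    also have "\<dots> = emeasure N (E' k)"
      unfolding N(1) using th(1) E' by (intro emeasure_density[symmetric]) auto
    also have "\<dots> < \<infinity>" using finite_measure.emeasure_finite[OF N(2)] by (simp add: less_top)
    finally have "emeasure ?R (E' k) < \<infinity>"
      by (auto simp: ennreal_mult_less_top)
    moreover have "emeasure ?R (E' k) = hausdorff_outer d (E' k)"
      using E'[of k] sR M by (simp add: emeasure_restrict_space emeasure_hausdorff_measure)
    ultimately show ?thesis by simp
  qed
  have "\<exists>B. B \<in> sets borel \<and> E' k \<subseteq> B \<and> hausdorff_outer d (B - E' k) = 0" for k
    using hausdorff_Borel_hull_diff[OF _ fin[of k]] E'[of k] sR by metis
  then obtain B where B: "\<And>k. B k \<in> sets borel" "\<And>k. E' k \<subseteq> B k" "\<And>k. hausdorff_outer d (B k - E' k) = 0"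
    by metis
  have "E \<subseteq> (\<Union>k. B k)"
  proof
    fix x assume x: "x \<in> E"
    then have "0 < \<theta> x" using th(2) EM by auto
    then obtain k where "inverse (real (Suc k)) < \<theta> x" using reals_Archimedean by blast
    then have "x \<in> E' k" using x by (simp add: E'_def)
    with B(2) show "x \<in> (\<Union>k. B k)" by blast
  qed
  moreover have "B k \<inter> M - E \<in> null_sets ?R" for k
  proof -
    have s: "B k \<inter> M - E \<in> sets ?H" using bor[OF B(1)] EM by auto
    then have "emeasure ?H (B k \<inter> M - E) = hausdorff_outer d (B k \<inter> M - E)"
      by (rule emeasure_hausdorff_measure)
    also have "\<dots> \<le> hausdorff_outer d (B k - E' k)"
      by (rule hausdorff_outer_mono) (auto simp: E'_def)
    finally have "emeasure ?H (B k \<inter> M - E) = 0" using B(3) by simp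
    then show ?thesis using s sR M by (subst null_sets_restrict_space) (auto simp: null_sets_def)
  qed
  then have "(\<Union>k. B k \<inter> M - E) \<in> null_sets ?R" by (rule null_sets_UN)
  then have "(\<Union>k. B k \<inter> M - E) \<in> null_sets N"
    using absolutely_continuousI_density[of "\<lambda>x. ennreal (\<theta> x)" ?R] th(1)
    unfolding N(1) absolutely_continuous_def by auto
  then have "(\<Union>k. B k) \<inter> M - E \<in> null_sets N" 
    by (rule back_subst[of "\<lambda>A. A \<in> null_sets N"]) auto
  moreover have "(\<Union>k. B k) \<in> sets borel" using B(1) by auto
  ultimately show thesis using that by blast
qed

text \<open>T is measurable only in the Caratheodory sense, whereas compact approximation from
  inside needs a Borel set. For each of countably many open conditions \<open>Op j\<close>, the set
  of x with T x in \<open>Op j\<close> is replaced by a Borel hull \<open>B j\<close>. Membership of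
  x in the sets \<open>B j\<close> decides all conditions and so determines at most one operator:
  \<open>G\<close> is a Borel graph, and its complement is null.\<close>

lemma rectifiable_varifold_compact_graph:
  fixes M :: "'a::euclidean_space set" and V :: "('a \<times> ('a \<Rightarrow>\<^sub>L 'a)) measure"
  assumes rect: "rectifiable_varifold d M \<theta> V" and fin: "emeasure (mass_measure V) UNIV < \<infinity>"
    and e: "e > 0"
  obtains Q where "compact Q" "inj_on fst Q"
    "emeasure V (space V - Q) \<le> ennreal e"
proof -
  have vf: "varifold d V" using rect by (simp add: rectifiable_varifold_def)
  interpret fV: finite_measure V by (rule varifold_mass_finite[OF vf fin])
  obtain M' T N where tg: "tangent_graph d M \<theta> V M' T N"
    using rectifiable_varifold_graph[OF rect fin] by blast
  then have M': "M' \<in> sets (hausdorff_measure d)"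
    and good: "\<And>x. x \<in> M' \<Longrightarrow> 0 < \<theta> x"
    and th: "\<theta> \<in> borel_measurable (restrict_space (hausdorff_measure d) M')"
    and N: "N = density (restrict_space (hausdorff_measure d) M') (\<lambda>x. ennreal (\<theta> x))"
    by (auto simp: tangent_graph_def)
  note spN = tangent_graph_measurable(1)[OF tg] and idN = tangent_graph_measurable(3)[OF tg]
    and TN = tangent_graph_measurable(4)[OF tg]
  have idV: "(\<lambda>p. p) \<in> borel_measurable V"
    by (rule varifold_measurable[OF vf]) simp
  have cf: "(fst :: 'a \<times> ('a \<Rightarrow>\<^sub>L 'a) \<Rightarrow> 'a) \<in> borel_measurable borel"
    "(snd :: 'a \<times> ('a \<Rightarrow>\<^sub>L 'a) \<Rightarrow> ('a \<Rightarrow>\<^sub>L 'a)) \<in> borel_measurable borel"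
    by (intro borel_measurable_continuous_onI continuous_intros)+
  have fN: "finite_measure N" by (rule tangent_graph_finite[OF tg fV.finite_measure_axioms])
  define J where "J = (Basis :: 'a set) \<times> (Basis :: 'a set) \<times> (\<rat> :: real set)"
  have cJ: "countable J" unfolding J_def by (intro countable_SIGMA countable_rat) (auto simp: countable_finite)
  define Op where "Op = (\<lambda>(b, c, q). {S :: 'a \<Rightarrow>\<^sub>L 'a. S b \<bullet> c < q})"
  have op: "open (Op j)" for j
    unfolding Op_def by (cases j) (auto intro!: open_Collect_less continuous_intros)
  define E where "E j = {x \<in> M'. T x \<in> Op j}" for j
  have Es: "E j \<in> sets N" for j
    using measurable_sets[OF TN borel_open[OF op[of j]]] by (simp add: E_def spN vimage_def Int_def conj_commute)
  have "\<exists>B. B \<in> sets borel \<and> E j \<subseteq> B \<and> B \<inter> M' - E j \<in> null_sets N" for j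
    using density_Borel_hull[OF M' th good N fN idN Es[of j]] by metis
  then obtain B where B: "\<And>j. B j \<in> sets borel" "\<And>j. E j \<subseteq> B j" "\<And>j. B j \<inter> M' - E j \<in> null_sets N"
    by metis
  define G where "G = (\<Inter>j\<in>J. {p. fst p \<in> B j \<longleftrightarrow> snd p \<in> Op j})"
  have J0: "J \<noteq> {}" by (auto simp: J_def)
  have Gs: "G \<in> sets borel"
  proof -
    have "{p \<in> space borel. fst p \<in> B j \<longleftrightarrow> snd p \<in> Op j} \<in> sets borel" for j
      using cf B(1)[of j] borel_open[OF op[of j]] by measurable
    then show ?thesis unfolding G_def using cJ J0 by (intro sets.countable_INT') auto
  qed
  have graph: "S = T" if "(x, S) \<in> G" "(x, T) \<in> G" for x S T
  proof (rule blinfun_rational_separation)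
    fix b c :: 'a and q :: real assume "b \<in> Basis" "c \<in> Basis" "q \<in> \<rat>"
    then have "(b, c, q) \<in> J" by (simp add: J_def)
    then have "S \<in> Op (b, c, q) \<longleftrightarrow> T \<in> Op (b, c, q)" using that unfolding G_def by fastforce
    then show "S b \<bullet> c < q \<longleftrightarrow> T b \<bullet> c < q" by (simp add: Op_def)
  qed
  let ?V = "distr V borel (\<lambda>p. p)"
  interpret W: finite_measure ?V by (rule fV.finite_measure_distr[OF idV])
  have "emeasure ?V (- G) = 0"
  proof -
    have "emeasure ?V (- G) = emeasure V (- G \<inter> space V)"
      using Gs idV by (simp add: emeasure_distr borel_comp)
    also have "\<dots> = emeasure N {x \<in> M'. (x, T x) \<in> - G}"
      by (rule tangent_graph_emeasure[OF tg]) (use Gs in \<open>simp add: borel_comp\<close>)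
    \<comment> \<open>A point of the graph of T can violate a condition only when x is in
      \<open>B j\<close> although T x is outside \<open>Op j\<close>, because \<open>E j\<close> is
      contained in \<open>B j\<close>.\<close>
    also have "\<dots> \<le> emeasure N (\<Union>j\<in>J. B j \<inter> M' - E j)"
    proof (rule emeasure_mono)
      show "{x \<in> M'. (x, T x) \<in> - G} \<subseteq> (\<Union>j\<in>J. B j \<inter> M' - E j)"
        using B(2) by (fastforce simp: G_def E_def)
      show "(\<Union>j\<in>J. B j \<inter> M' - E j) \<in> sets N" using cJ B(3) by (intro sets.countable_UN') auto
    qed
    also have "\<dots> = 0" using null_sets_UN'[OF cJ, of "\<lambda>j. B j \<inter> M' - E j" N] B(3) by auto
    finally show ?thesis by simp
  qed
  then have full: "emeasure ?V G = emeasure ?V UNIV"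
    using emeasure_Un_null_set[of G ?V "- G"] Gs by (auto simp: null_sets_def borel_comp Compl_partition)
  have "\<exists>Q. Q \<subseteq> G \<and> compact Q \<and> emeasure ?V UNIV \<le> emeasure ?V Q + ennreal e"
  \<comment> \<open>If the whole mass is at most e, the empty set qualifies; otherwise subtracting e
    gives a number strictly below the supremum in inner regularity.\<close>
  proof (cases "emeasure ?V G \<le> ennreal e")
    case True
    then show ?thesis using full by (intro exI[of _ "{}"]) auto
  next
    case False
    then have "emeasure ?V G - ennreal e < emeasure ?V G"
      using e W.emeasure_finite[of G]
      by (intro ennreal_between) (auto simp: less_top[symmetric] not_le intro: le_less_trans)
    also have "emeasure ?V G = (SUP K \<in> {K. K \<subseteq> G \<and> compact K}. emeasure ?V K)"
      by (rule inner_regular) (use W.emeasure_finite Gs in auto)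
    finally obtain Q where "Q \<subseteq> G" "compact Q" "emeasure ?V G - ennreal e < emeasure ?V Q"
      unfolding less_SUP_iff by auto
    then show ?thesis unfolding full
      by (intro exI[of _ Q]) (auto simp: ennreal_minus_le_iff add.commute dest!: less_imp_le)
  qed
  then obtain Q where Q: "Q \<subseteq> G" "compact Q" "emeasure ?V UNIV \<le> emeasure ?V Q + ennreal e" by blast
  have Qs: "Q \<in> sets borel" using Q(2) by (simp add: borel_compact)
  have "emeasure V (space V - Q) = emeasure ?V (- Q)"
    using Qs idV by (simp add: emeasure_distr borel_comp Diff_eq Int_commute)
  also have "\<dots> = emeasure ?V UNIV - emeasure ?V Q"
    using emeasure_compl[of Q ?V] Qs W.emeasure_finite[of Q] by (simp add: Compl_eq_Diff_UNIV)
  also have "\<dots> \<le> ennreal e" using Q(3) by (simp add: ennreal_minus_le_iff)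
  finally have small: "emeasure V (space V - Q) \<le> ennreal e" .
  have "inj_on fst Q"
  proof (rule inj_onI)
    fix p q assume "p \<in> Q" "q \<in> Q" "fst p = fst q"
    then have "snd p = snd q" using graph Q(1) by (metis prod.collapse subsetD)
    with \<open>fst p = fst q\<close> show "p = q" by (rule prod_eqI)
  qed
  from that[OF Q(2) this small] show thesis .
qed

section \<open>Discretisation along a countable partition\<close>

text \<open>Discrete varifolds are defined by unordered sums, while sums over cells are exchanged
  with integrals over V in the form of counting-measure integrals.\<close>

lemma infsum_ennreal_eq_nn_integral:
  fixes f :: "'i \<Rightarrow> ennreal"
  assumes "countable A" shows "(\<Sum>\<^sub>\<infinity>x\<in>A. f x) = (\<integral>\<^sup>+x. f x \<partial>count_space A)"
proof (cases "finite A")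
  case True
  then show ?thesis by (simp add: nn_integral_count_space_finite)
next
  case False
  have b: "bij_betw (from_nat_into A) UNIV A"
    using bij_betw_from_nat_into[OF assms False] .
  define g where "g n = f (from_nat_into A n)" for n
  have "(g has_sum infsum g UNIV) UNIV"
    by (intro has_sum_infsum nonneg_summable_on_complete) simp
  then have "infsum g UNIV = (\<Sum>n. g n)"
    using has_sum_imp_sums sums_unique by blast
  then have "(\<Sum>\<^sub>\<infinity>n. f (from_nat_into A n)) = (\<Sum>n. f (from_nat_into A n))"
    by (simp add: g_def[abs_def])
  then show ?thesis
    using infsum_reindex_bij_betw[OF b, of f] nn_integral_bij_count_space[OF b, of f]
    by (simp add: nn_integral_count_space_nat)
qed

lemma nn_integral_cells:
  fixes f :: "'a \<Rightarrow> ennreal"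
  assumes L: "countable L" and s: "s \<in> measurable M (count_space L)" and f: "f \<in> borel_measurable M"
  shows "(\<integral>\<^sup>+x. f x \<partial>M) = (\<integral>\<^sup>+K. (\<integral>\<^sup>+x. f x * indicator {K} (s x) \<partial>M) \<partial>count_space L)"
proof -
  have "(\<integral>\<^sup>+x. f x \<partial>M) = (\<integral>\<^sup>+x. (\<integral>\<^sup>+K. f x * indicator {K} (s x) \<partial>count_space L) \<partial>M)"
  proof (rule nn_integral_cong)
    fix x assume "x \<in> space M"
    then have sx: "s x \<in> L" using measurable_space[OF s] by simp
    have "(\<integral>\<^sup>+K. f x * indicator {K} (s x) \<partial>count_space L)
        = (\<integral>\<^sup>+K. f x * indicator {s x} K \<partial>count_space L)"
      by (intro nn_integral_cong) (auto simp: indicator_def)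
    also have "\<dots> = f x" using sx by (subst nn_integral_indicator_singleton) auto
    finally show "f x = (\<integral>\<^sup>+K. f x * indicator {K} (s x) \<partial>count_space L)" ..
  qed
  also have "\<dots> = (\<integral>\<^sup>+K. (\<integral>\<^sup>+x. f x * indicator {K} (s x) \<partial>M) \<partial>count_space L)"
  proof (rule nn_integral_count_space_nn_integral[OF L])
    fix K assume "K \<in> L"
    then have "(\<lambda>x. indicator {K} (s x) :: ennreal) \<in> borel_measurable M"
      by (intro measurable_compose[OF s]) auto
    then show "(\<lambda>x. f x * indicator {K} (s x)) \<in> borel_measurable M" using f by measurable
  qed
  finally show ?thesis .
qed

lemma test_function_measurable:
  fixes \<phi> :: "'a::euclidean_space \<times> ('a \<Rightarrow>\<^sub>L 'a) \<Rightarrow> real"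
  assumes "\<phi> \<in> test_functions_Lip d U" shows "\<phi> \<in> borel_measurable (grassmann_borel d)"
  unfolding grassmann_borel_def
proof (rule borel_measurable_continuous_on_restrict)
  have lip: "\<bar>\<phi> (x, S) - \<phi> (y, T)\<bar> \<le> dist x y + norm (S - T)"
    if "S \<in> grassmannian d" "T \<in> grassmannian d" for x y S T
    using assms that by (auto simp: test_functions_Lip_def)
  \<comment> \<open>The sum metric is at most twice the product metric; only continuity is drawn
    from this, so the factor is harmless.\<close>
  have "2-lipschitz_on (UNIV \<times> grassmannian d) \<phi>"
  proof (rule lipschitz_onI)
    fix z w :: "'a \<times> ('a \<Rightarrow>\<^sub>L 'a)"
    assume zw: "z \<in> UNIV \<times> grassmannian d" "w \<in> UNIV \<times> grassmannian d"
    have "dist (\<phi> z) (\<phi> w) \<le> dist (fst z) (fst w) + dist (snd z) (snd w)"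
      using lip[of "snd z" "snd w" "fst z" "fst w"] zw by (auto simp: dist_norm dist_real_def)
    also have "\<dots> \<le> 2 * dist z w" using dist_fst_le[of z w] dist_snd_le[of z w] by simp
    finally show "dist (\<phi> z) (\<phi> w) \<le> 2 * dist z w" .
  qed simp
  then show "continuous_on (UNIV \<times> grassmannian d) \<phi>" by (rule lipschitz_on_continuous_on)
qed

lemma open_nbhd: "open (nbhd (A :: 'a::metric_space set) r)"
proof -
  have "{y. ennreal (dist x y) < r} = (if r = \<infinity> then UNIV else ball x (enn2real r))" for x :: 'a
    by (cases r) (auto simp: ennreal_less_iff)
  then show ?thesis unfolding nbhd_def by (intro open_UN) auto
qed

text \<open>Each point x is sent to the cell s x, where its mass is spread according to the probability
  measure pr (s x); the tangent plane is replaced by P (s x).\<close>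

locale discretization =
  fixes d :: nat and V :: "('a::euclidean_space \<times> ('a \<Rightarrow>\<^sub>L 'a)) measure"
    and L :: "'a set set" and s :: "'a \<Rightarrow> 'a set" and pr :: "'a set \<Rightarrow> 'a measure"
    and P :: "'a set \<Rightarrow> 'a \<Rightarrow>\<^sub>L 'a" and \<delta> :: real
  assumes vf: "varifold d V" and fin: "finite_measure V" and dim: "d \<le> DIM('a)"
    and countable_L: "countable L" and s: "s \<in> measurable borel (count_space L)"
    and pr: "\<And>K. K \<in> L \<Longrightarrow> prob_space (pr K)" "\<And>K. K \<in> L \<Longrightarrow> sets (pr K) = sets borel"
    and P: "\<And>K. K \<in> L \<Longrightarrow> P K \<in> grassmannian d"
    and delta_pos: "0 < \<delta>"
    and close: "\<And>x. AE y in pr (s x). dist x y \<le> 3 * \<delta>"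
    and diam: "\<And>x y. s x = s y \<Longrightarrow> dist x y \<le> 6 * \<delta>"
    and near_min: "\<And>K Q. K \<in> L \<Longrightarrow> Q \<in> grassmannian d \<Longrightarrow>
      (\<integral>\<^sup>+z. ennreal (min 2 (3 * \<delta> + norm (snd z - P K))) * indicator {K} (s (fst z)) \<partial>V) \<le>
      (\<integral>\<^sup>+z. ennreal (min 2 (3 * \<delta> + norm (snd z - Q))) * indicator {K} (s (fst z)) \<partial>V) +
      (\<integral>\<^sup>+z. ennreal (min 1 \<delta>) * indicator {K} (s (fst z)) \<partial>V)"
begin

definition kernel :: "'a set \<Rightarrow> ('a \<times> ('a \<Rightarrow>\<^sub>L 'a)) measure" where
  "kernel K = distr (pr K) (grassmann_borel d) (\<lambda>y. (y, P K))"

text \<open>As a monadic bind, integrals against it are iterated integrals over V: a test function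
  is compared with its kernel average at each single point. The kernel depends on the point through
  its cell only, so its measurability is that of \<open>s\<close>.\<close>

definition discretized :: "('a \<times> ('a \<Rightarrow>\<^sub>L 'a)) measure" where
  "discretized = V \<bind> (\<lambda>z. kernel (s (fst z)))"

lemma s_in: "s x \<in> L"
  using measurable_space[OF s, of x] by simp

lemma s_fst: "(\<lambda>z. s (fst z)) \<in> measurable V (count_space L)"
proof -
  have "(fst :: 'a \<times> ('a \<Rightarrow>\<^sub>L 'a) \<Rightarrow> 'a) \<in> borel_measurable borel"
    by (intro borel_measurable_continuous_onI continuous_intros)
  then have "(fst :: 'a \<times> ('a \<Rightarrow>\<^sub>L 'a) \<Rightarrow> 'a) \<in> borel_measurable V"
    by (rule varifold_measurable[OF vf])
  then show ?thesis by (rule measurable_compose) (rule s)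
qed

lemma atom_measurable:
  assumes K: "K \<in> L" shows "(\<lambda>y. (y, P K)) \<in> measurable (pr K) (grassmann_borel d)"
proof -
  have "(\<lambda>y. (y, P K)) \<in> borel_measurable borel"
    by (intro borel_measurable_continuous_onI continuous_intros)
  then show ?thesis
    unfolding grassmann_borel_def measurable_cong_sets[OF pr(2)[OF K] refl]
    using P[OF K] by (intro measurable_restrict_space2) auto
qed

lemma kernel_prob: "K \<in> L \<Longrightarrow> prob_space (kernel K)"
  unfolding kernel_def by (rule prob_space.prob_space_distr[OF pr(1) atom_measurable])

lemma sets_kernel_eq: "sets (kernel K) = sets (grassmann_borel d)"
  by (simp add: kernel_def)

lemma kernel_subprob: "(\<lambda>z. kernel (s (fst z))) \<in> measurable V (subprob_algebra (grassmann_borel d))"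
proof (rule measurable_compose[OF s_fst])
  show "kernel \<in> measurable (count_space L) (subprob_algebra (grassmann_borel d))"
    using kernel_prob sets_kernel_eq
    by (auto simp: space_subprob_algebra prob_space_imp_subprob_space)
qed

lemma space_nonempty: "space V \<noteq> {}"
  using grassmannian_nonempty[OF dim] by (simp add: varifold_space[OF vf])

lemma sets_discretized: "sets discretized = sets (grassmann_borel d)"
  unfolding discretized_def by (rule sets_bind_measurable[OF kernel_subprob space_nonempty])

lemma space_kernel: "space (kernel K) = UNIV \<times> grassmannian d"
  by (simp add: kernel_def space_grassmann_borel)

text \<open>Sorting V by cells gives the shape of the sums that define point clouds and volumetric
  varifolds, the weight of K being the mass assigned to K.\<close>

lemma emeasure_discretized:
  assumes A: "A \<in> sets (grassmann_borel d)"
  shows "emeasure discretized A =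
    (\<Sum>\<^sub>\<infinity>K\<in>L. emeasure V {z \<in> space V. s (fst z) = K} * emeasure (pr K) {y. (y, P K) \<in> A})"
proof -
  have "emeasure discretized A = (\<integral>\<^sup>+z. emeasure (kernel (s (fst z))) A \<partial>V)"
    unfolding discretized_def by (rule emeasure_bind[OF space_nonempty kernel_subprob A])
  also have "\<dots> = (\<integral>\<^sup>+K. (\<integral>\<^sup>+z. emeasure (kernel (s (fst z))) A * indicator {K} (s (fst z)) \<partial>V) \<partial>count_space L)"
    by (intro nn_integral_cells[OF countable_L s_fst] measurable_compose[OF s_fst]) auto
  also have "\<dots> = (\<integral>\<^sup>+K. emeasure V {z \<in> space V. s (fst z) = K} * emeasure (pr K) {y. (y, P K) \<in> A} \<partial>count_space L)"
  proof (rule nn_integral_cong)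
    fix K assume "K \<in> space (count_space L)"
    then have K: "K \<in> L" by simp
    have "{z \<in> space V. s (fst z) = K} \<in> sets V"
      using measurable_sets[OF s_fst, of "{K}"] K by (auto simp: vimage_def Int_def conj_commute)
    then have "(\<integral>\<^sup>+z. emeasure (kernel K) A * indicator {z \<in> space V. s (fst z) = K} z \<partial>V)
       = emeasure (kernel K) A * emeasure V {z \<in> space V. s (fst z) = K}"
      by (rule nn_integral_cmult_indicator)
    moreover have "(\<integral>\<^sup>+z. emeasure (kernel (s (fst z))) A * indicator {K} (s (fst z)) \<partial>V) =
        (\<integral>\<^sup>+z. emeasure (kernel K) A * indicator {z \<in> space V. s (fst z) = K} z \<partial>V)"
      by (intro nn_integral_cong) (auto simp: indicator_def)
    moreover have "space (pr K) = UNIV" using sets_eq_imp_space_eq[OF pr(2)[OF K]] by simp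
    then have "emeasure (kernel K) A = emeasure (pr K) {y. (y, P K) \<in> A}"
      unfolding kernel_def using A atom_measurable[OF K] by (simp add: emeasure_distr vimage_def)
    ultimately show "(\<integral>\<^sup>+z. emeasure (kernel (s (fst z))) A * indicator {K} (s (fst z)) \<partial>V) =
      emeasure V {z \<in> space V. s (fst z) = K} * emeasure (pr K) {y. (y, P K) \<in> A}"
      by (simp add: mult.commute)
  qed
  also have "\<dots> = (\<Sum>\<^sub>\<infinity>K\<in>L. emeasure V {z \<in> space V. s (fst z) = K} * emeasure (pr K) {y. (y, P K) \<in> A})"
    by (rule infsum_ennreal_eq_nn_integral[OF countable_L, symmetric])
  finally show ?thesis .
qed

text \<open>The difference is an average over y of \<phi> (x, S) - \<phi> (y, P), bounded by 2 from
  the sup norm and by 3\<delta> plus the distance of the planes from the Lipschitz condition. It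
  vanishes when x and all admissible y lie outside U; the neighbourhood is defined by a strict
  inequality, so 4\<delta> replaces 3\<delta>.\<close>

lemma test_function_defect:
  assumes phi: "\<phi> \<in> test_functions_Lip d U" and z: "z \<in> UNIV \<times> grassmannian d"
  shows "ennreal \<bar>\<phi> z - (\<integral>w. \<phi> w \<partial>kernel (s (fst z)))\<bar> \<le>
    ennreal (min 2 (3 * \<delta> + norm (snd z - P (s (fst z))))) * indicator (nbhd U (ennreal (4 * \<delta>))) (fst z)"
proof -
  obtain x S where zx: "z = (x, S)" and S: "S \<in> grassmannian d" using z by auto
  let ?K = "s x"
  have K: "?K \<in> L" by (rule s_in)
  interpret p: prob_space "pr ?K" by (rule pr(1)[OF K])
  have lip: "\<bar>\<phi> (x, S) - \<phi> (y, T)\<bar> \<le> dist x y + norm (S - T)"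
    if "S \<in> grassmannian d" "T \<in> grassmannian d" for x y S T
    using phi that by (auto simp: test_functions_Lip_def)
  have b: "\<bar>\<phi> (x, S)\<bar> \<le> 1" if "S \<in> grassmannian d" for x S
    using phi that by (auto simp: test_functions_Lip_def)
  have supp: "\<phi> (x, S) = 0" if "x \<notin> U" "S \<in> grassmannian d" for x S
  proof (rule ccontr)
    assume "\<phi> (x, S) \<noteq> 0"
    then have "(x, S) \<in> closure {p \<in> UNIV \<times> grassmannian d. \<phi> p \<noteq> 0}"
      using that(2) by (intro subsetD[OF closure_subset]) auto
    then show False using phi that by (auto simp: test_functions_Lip_def)
  qed
  have m: "(\<lambda>y. \<phi> (y, P ?K)) \<in> borel_measurable (pr ?K)"
    by (rule measurable_compose[OF atom_measurable[OF K] test_function_measurable[OF phi]])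
  have "(\<integral>w. \<phi> w \<partial>kernel ?K) = (\<integral>y. \<phi> (y, P ?K) \<partial>pr ?K)"
    unfolding kernel_def by (rule integral_distr[OF atom_measurable[OF K] test_function_measurable[OF phi]])
  moreover have i: "integrable (pr ?K) (\<lambda>y. \<phi> (y, P ?K))"
    using b[OF P[OF K]] m by (intro p.integrable_const_bound[of _ 1]) auto
  then have "\<phi> (x, S) - (\<integral>y. \<phi> (y, P ?K) \<partial>pr ?K) = (\<integral>y. \<phi> (x, S) - \<phi> (y, P ?K) \<partial>pr ?K)"
    by (subst Bochner_Integration.integral_diff) (auto simp: p.prob_space)
  ultimately have eq: "\<phi> z - (\<integral>w. \<phi> w \<partial>kernel (s (fst z))) = (\<integral>y. \<phi> (x, S) - \<phi> (y, P ?K) \<partial>pr ?K)"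
    by (simp add: zx)
  have bound: "\<bar>\<integral>y. \<phi> (x, S) - \<phi> (y, P ?K) \<partial>pr ?K\<bar> \<le> c"
    if "AE y in pr ?K. \<bar>\<phi> (x, S) - \<phi> (y, P ?K)\<bar> \<le> c" for c
  proof -
    have i': "integrable (pr ?K) (\<lambda>y. \<phi> (x, S) - \<phi> (y, P ?K))" using i by simp
    have "\<bar>\<integral>y. \<phi> (x, S) - \<phi> (y, P ?K) \<partial>pr ?K\<bar> \<le> (\<integral>y. \<bar>\<phi> (x, S) - \<phi> (y, P ?K)\<bar> \<partial>pr ?K)"
      by (rule integral_abs_bound)
    also have "\<dots> \<le> (\<integral>y. c \<partial>pr ?K)"
      using i' that by (intro integral_mono_AE) auto
    finally show ?thesis by (simp add: p.prob_space)
  qed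
  show ?thesis
  proof (cases "x \<in> nbhd U (ennreal (4 * \<delta>))")
    case True
    have "\<bar>\<integral>y. \<phi> (x, S) - \<phi> (y, P ?K) \<partial>pr ?K\<bar> \<le> min 2 (3 * \<delta> + norm (S - P ?K))"
    proof (rule bound, use close[of x] in eventually_elim)
      fix y assume "dist x y \<le> 3 * \<delta>"
      then show "\<bar>\<phi> (x, S) - \<phi> (y, P ?K)\<bar> \<le> min 2 (3 * \<delta> + norm (S - P ?K))"
        using lip[OF S P[OF K], of x y] b[OF S, of x] b[OF P[OF K], of y] by linarith
    qed
    then show ?thesis unfolding eq using True by (auto simp: zx intro!: ennreal_leI)
  next
    case False
    have far: "y \<notin> U" if "dist x y \<le> 3 * \<delta>" for y
    proof
      assume "y \<in> U"
      moreover have "ennreal (dist y x) < ennreal (4 * \<delta>)"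
        using that delta_pos by (simp add: dist_commute ennreal_less_iff)
      ultimately show False using False by (auto simp: nbhd_def)
    qed
    have x: "x \<notin> U" using far[of x] delta_pos by simp
    have "\<bar>\<integral>y. \<phi> (x, S) - \<phi> (y, P ?K) \<partial>pr ?K\<bar> \<le> 0"
    proof (rule bound, use close[of x] in eventually_elim)
      fix y assume "dist x y \<le> 3 * \<delta>"
      then show "\<bar>\<phi> (x, S) - \<phi> (y, P ?K)\<bar> \<le> 0"
        using supp[OF x S] supp[OF far P[OF K]] by simp
    qed
    then show ?thesis unfolding eq by simp
  qed
qed

lemma discretized_estimate:
  "bounded_lipschitz_dist d U discretized V \<le>
    (\<integral>\<^sup>+z. ennreal (min 2 (3 * \<delta> + norm (snd z - P (s (fst z))))) *
      indicator (nbhd U (ennreal (4 * \<delta>))) (fst z) \<partial>V)"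
  unfolding bounded_lipschitz_dist_def
proof (rule SUP_least)
  fix \<phi> assume phi: "\<phi> \<in> test_functions_Lip d U"
  interpret fV: finite_measure V by (rule fin)
  have m: "\<phi> \<in> borel_measurable (grassmann_borel d)" by (rule test_function_measurable[OF phi])
  then have mV: "\<phi> \<in> borel_measurable V"
    using measurable_cong_sets[OF varifold_sets[OF vf] refl] by blast
  have b: "\<bar>\<phi> z\<bar> \<le> 1" if "z \<in> space (grassmann_borel d)" for z
    using phi that by (auto simp: test_functions_Lip_def space_grassmann_borel)
  have iV: "integrable V \<phi>"
    using b by (intro fV.integrable_const_bound[of _ 1] mV AE_I2)
      (simp add: varifold_space[OF vf] space_grassmann_borel)
  have one: "AE z in V. emeasure (kernel (s (fst z))) (space (kernel (s (fst z)))) \<le> ennreal 1"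
    using prob_space.emeasure_space_1[OF kernel_prob[OF s_in]] by simp
  have iW: "integrable discretized \<phi>"
    unfolding discretized_def by (rule integrable_bind[OF m b kernel_subprob fin one])
  have eqW: "(\<integral>z. \<phi> z \<partial>discretized) = (\<integral>z. (\<integral>w. \<phi> w \<partial>kernel (s (fst z))) \<partial>V)"
    unfolding discretized_def by (rule integral_bind[OF m b kernel_subprob fin one])
  have mk: "(\<lambda>z. \<integral>w. \<phi> w \<partial>kernel (s (fst z))) \<in> borel_measurable V"
    by (rule measurable_compose[OF s_fst]) simp
  have bk: "\<bar>\<integral>w. \<phi> w \<partial>kernel (s (fst z))\<bar> \<le> 1" for z
  proof -
    interpret k: prob_space "kernel (s (fst z))" by (rule kernel_prob[OF s_in])
    have mk: "\<phi> \<in> borel_measurable (kernel (s (fst z)))"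
      using m measurable_cong_sets[OF sets_kernel_eq refl] by blast
    have ik: "integrable (kernel (s (fst z))) \<phi>"
      using b by (intro k.integrable_const_bound[of _ 1] mk AE_I2) (simp add: space_kernel space_grassmann_borel)
    have "\<bar>\<integral>w. \<phi> w \<partial>kernel (s (fst z))\<bar> \<le> (\<integral>w. \<bar>\<phi> w\<bar> \<partial>kernel (s (fst z)))"
      by (rule integral_abs_bound)
    also have "\<dots> \<le> (\<integral>w. 1 \<partial>kernel (s (fst z)))"
      using ik b by (intro integral_mono) (auto simp: space_kernel space_grassmann_borel)
    finally show ?thesis by (simp add: k.prob_space)
  qed
  have ik: "integrable V (\<lambda>z. \<integral>w. \<phi> w \<partial>kernel (s (fst z)))"
    using bk by (intro fV.integrable_const_bound[of _ 1] mk AE_I2) simp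
  have "ennreal \<bar>(\<integral>p. \<phi> p \<partial>discretized) - (\<integral>p. \<phi> p \<partial>V)\<bar>
      = ennreal \<bar>\<integral>z. \<phi> z - (\<integral>w. \<phi> w \<partial>kernel (s (fst z))) \<partial>V\<bar>"
    unfolding eqW using iV ik by (simp add: abs_minus_commute)
  also have "\<dots> \<le> ennreal (\<integral>z. \<bar>\<phi> z - (\<integral>w. \<phi> w \<partial>kernel (s (fst z)))\<bar> \<partial>V)"
    by (intro ennreal_leI integral_abs_bound)
  also have "\<dots> = (\<integral>\<^sup>+z. ennreal \<bar>\<phi> z - (\<integral>w. \<phi> w \<partial>kernel (s (fst z)))\<bar> \<partial>V)"
    using iV ik by (intro nn_integral_eq_integral[symmetric]) auto
  also have "\<dots> \<le> (\<integral>\<^sup>+z. ennreal (min 2 (3 * \<delta> + norm (snd z - P (s (fst z))))) *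
      indicator (nbhd U (ennreal (4 * \<delta>))) (fst z) \<partial>V)"
    by (intro nn_integral_mono test_function_defect[OF phi]) (simp add: varifold_space[OF vf])
  finally show "(if integrable discretized \<phi> \<and> integrable V \<phi>
      then ennreal \<bar>(\<integral>p. \<phi> p \<partial>discretized) - (\<integral>p. \<phi> p \<partial>V)\<bar> else \<infinity>)
    \<le> (\<integral>\<^sup>+z. ennreal (min 2 (3 * \<delta> + norm (snd z - P (s (fst z))))) *
      indicator (nbhd U (ennreal (4 * \<delta>))) (fst z) \<partial>V)"
    using iV iW by simp
qed

text \<open>Test functions disappear: what remains is one competitor plane Q for each fibre A of
  \<open>s\<close>, and fibres away from U contribute nothing. The function E records the error that
  the competitors achieve. The slack of the near-minimiser is absorbed by min 2 (3\<delta> + t) +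
  min 1 \<delta> \<le> min 3 (4\<delta> + t), the origin of the constants 3 and 4.\<close>

lemma discretized_comparison:
  assumes E: "E \<in> borel_measurable V"
    and cells: "\<And>A. A \<in> sets borel \<Longrightarrow> (\<And>x y. x \<in> A \<Longrightarrow> y \<in> A \<Longrightarrow> dist x y \<le> 6 * \<delta>) \<Longrightarrow>
      A \<inter> nbhd U (ennreal (4 * \<delta>)) \<noteq> {} \<Longrightarrow> \<exists>Q\<in>grassmannian d.
        (\<integral>\<^sup>+z. ennreal (min 3 (4 * \<delta> + norm (snd z - Q))) * indicator A (fst z) \<partial>V)
          \<le> (\<integral>\<^sup>+z. E z * indicator A (fst z) \<partial>V)"
  shows "bounded_lipschitz_dist d U discretized V \<le> (\<integral>\<^sup>+z. E z \<partial>V)"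
proof -
  let ?X = "nbhd U (ennreal (4 * \<delta>))"
  define c where "c z Q = ennreal (min 2 (3 * \<delta> + norm (snd z - Q)))" for z :: "'a \<times> ('a \<Rightarrow>\<^sub>L 'a)" and Q
  have cf: "(fst :: 'a \<times> ('a \<Rightarrow>\<^sub>L 'a) \<Rightarrow> 'a) \<in> borel_measurable borel"
    "(snd :: 'a \<times> ('a \<Rightarrow>\<^sub>L 'a) \<Rightarrow> ('a \<Rightarrow>\<^sub>L 'a)) \<in> borel_measurable borel"
    by (intro borel_measurable_continuous_onI continuous_intros)+
  note cfV = cf[THEN varifold_measurable[OF vf]]
  have "(\<lambda>z. P (s (fst z))) \<in> borel_measurable V"
    by (rule measurable_compose[OF s_fst]) simp
  then have cm: "(\<lambda>z. c z (P (s (fst z)))) \<in> borel_measurable V"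
    unfolding c_def using cfV by measurable
  have indX: "(\<lambda>z. indicator ?X (fst z) :: ennreal) \<in> borel_measurable V"
    by (rule measurable_compose[OF cfV(1)]) (simp add: open_nbhd)
  have "(\<integral>\<^sup>+z. c z (P (s (fst z))) * indicator ?X (fst z) \<partial>V)
     = (\<integral>\<^sup>+K. (\<integral>\<^sup>+z. (c z (P (s (fst z))) * indicator ?X (fst z)) * indicator {K} (s (fst z)) \<partial>V) \<partial>count_space L)"
    using cm indX by (intro nn_integral_cells[OF countable_L s_fst]) measurable
  also have "\<dots> \<le> (\<integral>\<^sup>+K. (\<integral>\<^sup>+z. E z * indicator {K} (s (fst z)) \<partial>V) \<partial>count_space L)"
  proof (rule nn_integral_mono)
    fix K assume "K \<in> space (count_space L)"
    then have K: "K \<in> L" by simp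
    define A where "A = {x. s x = K}"
    have A: "A \<in> sets borel"
      using measurable_sets[OF s, of "{K}"] K by (auto simp: A_def vimage_def)
    have ind: "indicator {K} (s x) = (indicator A x :: ennreal)" for x by (simp add: A_def indicator_def)
    have indA: "(\<lambda>z. indicator A (fst z) :: ennreal) \<in> borel_measurable V"
      by (rule measurable_compose[OF cfV(1) borel_measurable_indicator[OF A]])
    show "(\<integral>\<^sup>+z. (c z (P (s (fst z))) * indicator ?X (fst z)) * indicator {K} (s (fst z)) \<partial>V)
        \<le> (\<integral>\<^sup>+z. E z * indicator {K} (s (fst z)) \<partial>V)"
    proof (cases "A \<inter> ?X = {}")
      case True
      then have "(c z (P (s (fst z))) * indicator ?X (fst z)) * indicator {K} (s (fst z)) = 0" for z
        unfolding ind by (auto simp: indicator_def)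
      then have "(\<integral>\<^sup>+z. (c z (P (s (fst z))) * indicator ?X (fst z)) * indicator {K} (s (fst z)) \<partial>V)
          = (\<integral>\<^sup>+z. 0 \<partial>V)"
        by (rule nn_integral_cong)
      then show ?thesis by simp
    next
      case False
      have "dist x y \<le> 6 * \<delta>" if "x \<in> A" "y \<in> A" for x y
        using that by (intro diam) (simp add: A_def)
      from cells[OF A this False] obtain Q where Q: "Q \<in> grassmannian d"
        "(\<integral>\<^sup>+z. ennreal (min 3 (4 * \<delta> + norm (snd z - Q))) * indicator A (fst z) \<partial>V)
          \<le> (\<integral>\<^sup>+z. E z * indicator A (fst z) \<partial>V)" by blast
      have mQ: "(\<lambda>z. c z Q * indicator A (fst z)) \<in> borel_measurable V"
        unfolding c_def using cfV indA by measurable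
      have "(\<integral>\<^sup>+z. (c z (P (s (fst z))) * indicator ?X (fst z)) * indicator {K} (s (fst z)) \<partial>V)
        \<le> (\<integral>\<^sup>+z. c z (P K) * indicator {K} (s (fst z)) \<partial>V)"
        by (intro nn_integral_mono) (auto simp: indicator_def)
      also have "\<dots> \<le> (\<integral>\<^sup>+z. c z Q * indicator A (fst z) \<partial>V) + (\<integral>\<^sup>+z. ennreal (min 1 \<delta>) * indicator A (fst z) \<partial>V)"
        using near_min[OF K Q(1)] unfolding c_def ind .
      also have "\<dots> = (\<integral>\<^sup>+z. c z Q * indicator A (fst z) + ennreal (min 1 \<delta>) * indicator A (fst z) \<partial>V)"
        by (intro nn_integral_add[symmetric] mQ borel_measurable_times_ennreal borel_measurable_const indA)
      also have "\<dots> \<le> (\<integral>\<^sup>+z. ennreal (min 3 (4 * \<delta> + norm (snd z - Q))) * indicator A (fst z) \<partial>V)"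
      proof (rule nn_integral_mono)
        fix z
        have "c z Q + ennreal (min 1 \<delta>) = ennreal (min 2 (3 * \<delta> + norm (snd z - Q)) + min 1 \<delta>)"
          unfolding c_def using delta_pos by (intro ennreal_plus[symmetric]) auto
        also have "\<dots> \<le> ennreal (min 3 (4 * \<delta> + norm (snd z - Q)))"
          by (intro ennreal_leI) linarith
        finally show "c z Q * indicator A (fst z) + ennreal (min 1 \<delta>) * indicator A (fst z)
            \<le> ennreal (min 3 (4 * \<delta> + norm (snd z - Q))) * indicator A (fst z)"
          by (auto simp: indicator_def)
      qed
      also note Q(2)
      finally show ?thesis unfolding ind .
    qed
  qed
  also have "\<dots> = (\<integral>\<^sup>+z. E z \<partial>V)"
    by (rule nn_integral_cells[OF countable_L s_fst E, symmetric])
  finally show ?thesis using discretized_estimate[of U] unfolding c_def by (rule order_trans[rotated])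
qed

end

section \<open>Meshes\<close>

definition cell :: "'a set set \<Rightarrow> 'a \<Rightarrow> 'a set" where
  "cell \<K> x = (THE K. K \<in> \<K> \<and> x \<in> K)"

lemma cell_eqI:
  assumes "mesh \<K>" "K \<in> \<K>" "x \<in> K" shows "cell \<K> x = K"
  unfolding cell_def
proof (rule the_equality)
  show "K' = K" if "K' \<in> \<K> \<and> x \<in> K'" for K'
    using assms that by (auto simp: mesh_def partition_on_def disjoint_def)
qed (use assms in simp)

lemma cell_mem:
  assumes "mesh \<K>" shows "cell \<K> x \<in> \<K>" "x \<in> cell \<K> x"
proof -
  have "x \<in> \<Union>\<K>" using assms by (simp add: mesh_def partition_on_def)
  then obtain K where "K \<in> \<K>" "x \<in> K" by blast
  then show "cell \<K> x \<in> \<K>" "x \<in> cell \<K> x" using cell_eqI[OF assms] by auto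
qed

lemma mesh_nonempty: "mesh \<K> \<Longrightarrow> K \<in> \<K> \<Longrightarrow> K \<noteq> {}"
  by (auto simp: mesh_def partition_on_def)

lemma mesh_borel: "mesh \<K> \<Longrightarrow> K \<in> \<K> \<Longrightarrow> K \<in> sets borel"
  by (auto simp: mesh_def)

lemma cell_measurable:
  assumes "mesh \<K>" shows "cell \<K> \<in> measurable borel (count_space \<K>)"
proof (subst measurable_count_space_eq_countable)
  show "countable \<K>" using assms by (simp add: mesh_def)
  have "cell \<K> -` {K} \<inter> space borel = K" if "K \<in> \<K>" for K
    using cell_eqI[OF assms that] cell_mem(2)[OF assms] by auto
  then show "cell \<K> \<in> space borel \<rightarrow> \<K> \<and> (\<forall>a\<in>\<K>. cell \<K> -` {a} \<inter> space borel \<in> sets borel)"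
    using cell_mem(1)[OF assms] mesh_borel[OF assms] by auto
qed

lemma dist_le_mesh_size: "K \<in> \<K> \<Longrightarrow> x \<in> K \<Longrightarrow> y \<in> K \<Longrightarrow> ennreal (dist x y) \<le> mesh_size \<K>"
  unfolding mesh_size_def using ediam_le_iff[of K "ediam K"] by (intro SUP_upper2[of K]) auto

text \<open>A mesh of size 0 would consist of single points and exhibit the whole space as
  countable.\<close>

lemma mesh_size_pos:
  fixes \<K> :: "'a::euclidean_space set set"
  assumes m: "mesh \<K>" shows "0 < mesh_size \<K>"
proof (rule ccontr)
  assume "\<not> 0 < mesh_size \<K>"
  then have 0: "mesh_size \<K> = 0" by (simp add: not_less)
  have "x = y" if "cell \<K> x = cell \<K> y" for x y
  proof -
    have "ennreal (dist x y) \<le> 0"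
      using dist_le_mesh_size[OF cell_mem(1)[OF m, of x], of x y] cell_mem(2)[OF m, of x] cell_mem(2)[OF m, of y] that 0
      by simp
    then show ?thesis by simp
  qed
  then have "inj (cell \<K>)" by (rule injI)
  moreover have "range (cell \<K>) \<subseteq> \<K>" using cell_mem(1)[OF m] by auto
  then have "countable (range (cell \<K>))" using m countable_subset unfolding mesh_def by blast
  ultimately have "countable (UNIV :: 'a set)" by (metis countable_image_inj_on)
  then show False
    using uncountable_convex[of "UNIV :: 'a set" 0 "SOME b. b \<in> Basis"] nonzero_Basis[OF SOME_Basis] by auto
qed

text \<open>Half-open cubes of side e/n, obtained as level sets of the coordinatewise floor. The l1
  norm bounds the diameter by n times the side.\<close>

lemma fine_mesh_exists:
  assumes e: "0 < (e::real)"
  shows "\<exists>\<L> :: (real ^ 'n) set set. mesh \<L> \<and> mesh_size \<L> \<le> ennreal e"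
proof -
  define h where "h = e / real CARD('n)"
  have h: "h > 0" using e by (simp add: h_def)
  define q :: "real ^ 'n \<Rightarrow> real ^ 'n" where "q x = (\<chi> i. real_of_int \<lfloor>x $ i / h\<rfloor>)" for x
  define \<L> where "\<L> = (\<lambda>v. q -` {v}) ` range q"
  have qs: "q -` {q x} = (\<Inter>i. {y. real_of_int \<lfloor>x $ i / h\<rfloor> \<le> y $ i / h \<and> y $ i / h < real_of_int \<lfloor>x $ i / h\<rfloor> + 1})" for x
    by (auto simp: q_def vec_eq_iff floor_eq_iff)
  have borel: "q -` {q x} \<in> sets borel" for x
  proof -
    have "(\<lambda>y :: real ^ 'n. y $ i / h) \<in> borel_measurable borel" for i
      using h by (intro borel_measurable_continuous_onI continuous_intros) auto
    then have "{y \<in> space borel. real_of_int \<lfloor>x $ i / h\<rfloor> \<le> y $ i / h \<and> y $ i / h < real_of_int \<lfloor>x $ i / h\<rfloor> + 1}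
        \<in> sets borel" for i :: 'n
      by measurable
    then show ?thesis unfolding qs by (intro sets.countable_INT'') auto
  qed
  have int: "range q \<subseteq> {v. \<forall>i. v $ i \<in> \<int>}" by (auto simp: q_def)
  have finB: "finite (q ` B)" if "bounded B" for B
  proof -
    obtain c where c: "\<And>x. x \<in> B \<Longrightarrow> norm x \<le> c" using \<open>bounded B\<close> by (auto simp: bounded_iff)
    \<comment> \<open>One more than the ceiling, since the floor of a number that is at least -c/h
      can fall below -c/h by almost 1.\<close>
    define m where "m = \<lceil>c / h\<rceil> + 1"
    have "q x \<in> (\<lambda>f. \<chi> i. real_of_int (f i)) ` (UNIV \<rightarrow>\<^sub>E {-m..m})" if "x \<in> B" for x
    proof (rule image_eqI)
      show "q x = (\<chi> i. real_of_int \<lfloor>x $ i / h\<rfloor>)" by (simp add: q_def)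
      have "\<bar>x $ i\<bar> \<le> c" for i using component_le_norm_cart[of x i] c[OF that] by linarith
      then have bnd: "\<bar>x $ i / h\<bar> \<le> c / h" for i using h by (simp add: divide_right_mono)
      have "\<lfloor>x $ i / h\<rfloor> \<in> {-m..m}" for i
      proof -
        have "real_of_int \<lfloor>x $ i / h\<rfloor> \<le> real_of_int m" "real_of_int (- m) \<le> real_of_int \<lfloor>x $ i / h\<rfloor>"
          using bnd[of i] floor_correct[of "x $ i / h"] le_of_int_ceiling[of "c / h"]
          unfolding m_def abs_le_iff of_int_minus of_int_add of_int_1 by linarith+
        then show ?thesis by simp
      qed
      then show "(\<lambda>i. \<lfloor>x $ i / h\<rfloor>) \<in> UNIV \<rightarrow>\<^sub>E {-m..m}" by auto
    qed
    then have "q ` B \<subseteq> (\<lambda>f. \<chi> i. real_of_int (f i)) ` (UNIV \<rightarrow>\<^sub>E {-m..m})" by blast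
    moreover have "finite ((\<lambda>f. \<chi> i. real_of_int (f i)) ` ((UNIV :: 'n set) \<rightarrow>\<^sub>E {-m..m}))"
      by (intro finite_imageI finite_PiE) auto
    ultimately show ?thesis by (rule finite_subset)
  qed
  have "countable (range q)"
  proof -
    have "range q = (\<Union>n. q ` ball 0 (real n))"
    proof (safe, goal_cases)
      case (1 _ x)
      obtain n where "norm x < real n" using reals_Archimedean2 by blast
      then show ?case by (intro UN_I[of n]) auto
    qed auto
    then show ?thesis using finB[OF bounded_ball] by (simp add: countable_finite)
  qed
  then have "countable \<L>" by (simp add: \<L>_def)
  moreover have "partition_on UNIV \<L>"
    unfolding \<L>_def by (intro partition_onI) (auto simp: disjnt_def)
  moreover have "\<L> \<subseteq> sets borel" using borel by (auto simp: \<L>_def)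
  moreover have "finite {K \<in> \<L>. K \<inter> B \<noteq> {}}" if "bounded B" for B
  proof (rule finite_subset)
    show "{K \<in> \<L>. K \<inter> B \<noteq> {}} \<subseteq> (\<lambda>v. q -` {v}) ` (q ` B)"
    proof
      fix K assume "K \<in> {K \<in> \<L>. K \<inter> B \<noteq> {}}"
      then obtain y where "K \<in> \<L>" "y \<in> K" "y \<in> B" by blast
      then have "K = q -` {q y}" by (auto simp: \<L>_def)
      with \<open>y \<in> B\<close> show "K \<in> (\<lambda>v. q -` {v}) ` (q ` B)" by blast
    qed
  qed (intro finite_imageI finB that)
  ultimately have "mesh \<L>" by (simp add: mesh_def)
  moreover have "mesh_size \<L> \<le> ennreal e"
    unfolding mesh_size_def
  proof (rule SUP_least)
    fix K assume "K \<in> \<L>"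
    have "dist x y \<le> e" if "x \<in> K" "y \<in> K" for x y
    proof -
      have qxy: "q x = q y" using \<open>K \<in> \<L>\<close> that by (auto simp: \<L>_def)
      have "\<bar>(x - y) $ i\<bar> \<le> h" for i
      proof -
        have "\<lfloor>x $ i / h\<rfloor> = \<lfloor>y $ i / h\<rfloor>" using qxy by (simp add: q_def vec_eq_iff)
        then have "\<bar>x $ i / h - y $ i / h\<bar> \<le> 1" by linarith
        then have "\<bar>(x $ i - y $ i) / h\<bar> \<le> 1" by (simp add: diff_divide_distrib)
        then show ?thesis using h by (simp add: field_simps)
      qed
      then have "(\<Sum>i\<in>UNIV. \<bar>(x - y) $ i\<bar>) \<le> (\<Sum>i\<in>(UNIV :: 'n set). h)" by (intro sum_mono) simp
      also have "\<dots> = e" by (simp add: h_def)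
      finally show ?thesis using norm_le_l1_cart[of "x - y"] by (simp add: dist_norm)
    qed
    then show "ediam K \<le> ennreal e" by (auto simp: ediam_le_iff intro: ennreal_leI)
  qed
  ultimately show ?thesis by blast
qed

text \<open>Only finitely many cells meet the ball; were they all Lebesgue null, so would be the
  ball.\<close>

lemma mesh_positive_cell:
  fixes \<K> :: "'a::euclidean_space set set"
  assumes m: "mesh \<K>" and e: "0 < e"
  shows "\<exists>K\<in>\<K>. 0 < emeasure lborel K \<and> K \<inter> ball x e \<noteq> {}"
proof (rule ccontr)
  assume "\<not> ?thesis"
  then have null: "emeasure lborel K = 0" if "K \<in> \<K>" "K \<inter> ball x e \<noteq> {}" for K
    using that by (meson not_gr_zero)
  define F where "F = {K \<in> \<K>. K \<inter> ball x e \<noteq> {}}"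
  have "finite F" using m by (simp add: F_def mesh_def)
  have "F \<subseteq> null_sets lborel" using null mesh_borel[OF m] by (auto simp: F_def null_sets_def)
  then have "\<Union>F \<in> null_sets lborel" 
    using null_sets_UN'[OF countable_finite[OF \<open>finite F\<close>], of "\<lambda>K. K" lborel] by auto
  moreover have "ball x e \<subseteq> \<Union>F"
  proof
    fix y assume "y \<in> ball x e"
    then have "cell \<K> y \<in> F" using cell_mem[OF m, of y] by (auto simp: F_def)
    then show "y \<in> \<Union>F" using cell_mem(2)[OF m] by blast
  qed
  ultimately have "emeasure lborel (ball x e) \<le> 0"
    using emeasure_mono[of "ball x e" "\<Union>F" lborel] by (auto simp: null_sets_def)
  moreover have "0 < unit_ball_vol (real DIM('a)) * e ^ DIM('a)" using e by simp
  ultimately show False using e by (simp add: emeasure_ball ennreal_eq_0_iff)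
qed

text \<open>A positive slack makes attainment of the infimum irrelevant. It may be 0 only where f
  vanishes identically, as happens for cells that receive no mass.\<close>

lemma near_minimizer:
  fixes f :: "'b \<Rightarrow> ennreal"
  assumes "G \<noteq> {}" "\<And>Q. Q \<in> G \<Longrightarrow> f Q < \<infinity>" and "e > 0 \<or> (\<forall>Q\<in>G. f Q = 0)"
  shows "\<exists>P\<in>G. \<forall>Q\<in>G. f P \<le> f Q + e"
proof (cases "\<forall>Q\<in>G. f Q = 0")
  case True
  then show ?thesis using assms(1) by auto
next
  case False
  then have e: "e > 0" using assms(3) by blast
  define i where "i = (INF Q\<in>G. f Q)"
  have "i < \<infinity>" using assms(1,2) by (auto simp: i_def INF_less_iff)
  then have "i < i + e" using e by (auto simp: less_top)
  then have "(INF Q\<in>G. f Q) < (INF Q\<in>G. f Q) + e" by (simp only: i_def)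
  then obtain P where P: "P \<in> G" "f P < (INF Q\<in>G. f Q) + e" by (auto simp: INF_less_iff)
  have "f P \<le> f Q + e" if "Q \<in> G" for Q
    using P(2) INF_lower[OF that, of f] by (meson add_right_mono less_imp_le order_trans)
  then show ?thesis using P(1) by blast
qed

section \<open>Existence of discretisations\<close>

text \<open>The slack allowed in cell K is min 1 \<delta> times the mass assigned to K: summed over
  cells it costs at most \<delta> times the total mass, and it vanishes only where that mass, and
  with it the functional, vanishes. Truncation at 2 keeps the functional finite.\<close>

lemma discretization_intro:
  fixes V :: "('a::euclidean_space \<times> ('a \<Rightarrow>\<^sub>L 'a)) measure"
  assumes vf: "varifold d V" and fin: "finite_measure V" and dim: "d \<le> DIM('a)"
    and m: "mesh L" and delta: "0 < \<delta>"
    and s: "s \<in> measurable borel (count_space L)"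
    and close: "\<And>x y. y \<in> s x \<Longrightarrow> dist x y \<le> 3 * \<delta>"
    and pr: "\<And>K. K \<in> L \<Longrightarrow> prob_space (pr K)" "\<And>K. K \<in> L \<Longrightarrow> sets (pr K) = sets borel"
      "\<And>x. AE y in pr (s x). y \<in> s x"
  shows "\<exists>P. discretization d V L s pr P \<delta>"
proof -
  interpret fV: finite_measure V by (rule fin)
  define f where "f K Q = (\<integral>\<^sup>+z. ennreal (min 2 (3 * \<delta> + norm (snd z - Q))) * indicator {K} (s (fst z)) \<partial>V)"
    for K and Q :: "'a \<Rightarrow>\<^sub>L 'a"
  define e where "e K = (\<integral>\<^sup>+z. ennreal (min 1 \<delta>) * indicator {K} (s (fst z)) \<partial>V)" for K
  have s_in: "s x \<in> L" for x using measurable_space[OF s, of x] by simp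
  have "(fst :: 'a \<times> ('a \<Rightarrow>\<^sub>L 'a) \<Rightarrow> 'a) \<in> borel_measurable borel"
    by (intro borel_measurable_continuous_onI continuous_intros)
  then have "(fst :: 'a \<times> ('a \<Rightarrow>\<^sub>L 'a) \<Rightarrow> 'a) \<in> borel_measurable V"
    by (rule varifold_measurable[OF vf])
  then have sV: "(\<lambda>z. s (fst z)) \<in> measurable V (count_space L)"
    by (rule measurable_compose) (rule s)
  have "\<exists>P\<in>grassmannian d. \<forall>Q\<in>grassmannian d. f K P \<le> f K Q + e K" if K: "K \<in> L" for K
  proof (rule near_minimizer)
    define C where "C = {z \<in> space V. s (fst z) = K}"
    have C: "C \<in> sets V"
      using measurable_sets[OF sV, of "{K}"] K by (auto simp: C_def vimage_def Int_def conj_commute)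
    have ind: "(\<integral>\<^sup>+z. c * indicator {K} (s (fst z)) \<partial>V) = c * emeasure V C" for c
    proof -
      have "(\<integral>\<^sup>+z. c * indicator {K} (s (fst z)) \<partial>V) = (\<integral>\<^sup>+z. c * indicator C z \<partial>V)"
        by (intro nn_integral_cong) (auto simp: indicator_def C_def)
      then show ?thesis using nn_integral_cmult_indicator[OF C] by simp
    qed
    have le: "f K Q \<le> ennreal 2 * emeasure V C" for Q
      unfolding f_def ind[symmetric] by (intro nn_integral_mono mult_right_mono ennreal_leI) auto
    show "f K Q < \<infinity>" for Q
    proof (rule le_less_trans[OF le])
      show "ennreal 2 * emeasure V C < \<infinity>"
        using fV.emeasure_finite[of C] by (simp add: ennreal_mult_eq_top_iff less_top[symmetric])
    qed
    show "e K > 0 \<or> (\<forall>Q\<in>grassmannian d. f K Q = 0)"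
    proof (cases "emeasure V C = 0")
      case True
      then show ?thesis using le by simp
    next
      case False
      then show ?thesis using delta unfolding e_def ind 
        by (auto simp: ennreal_zero_less_mult_iff zero_less_iff_neq_zero min_def)
    qed
  qed (rule grassmannian_nonempty[OF dim])
  then obtain P where P: "\<And>K. K \<in> L \<Longrightarrow> P K \<in> grassmannian d"
    "\<And>K Q. K \<in> L \<Longrightarrow> Q \<in> grassmannian d \<Longrightarrow> f K (P K) \<le> f K Q + e K"
    by metis
  have "discretization d V L s pr P \<delta>"
  proof (rule discretization.intro)
    show "countable L" using m by (simp add: mesh_def)
    show "AE y in pr (s x). dist x y \<le> 3 * \<delta>" for x
      using pr(3)[of x] by eventually_elim (rule close)
    fix x y assume xy: "s x = s y"
    \<comment> \<open>Two points with the same target cell are compared through any point of that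
      cell, which gives 3 + 3.\<close>
    obtain z where "z \<in> s x" using mesh_nonempty[OF m s_in] by blast
    then have "dist x z \<le> 3 * \<delta>" "dist y z \<le> 3 * \<delta>" using close xy by auto
    then show "dist x y \<le> 6 * \<delta>" using dist_triangle2[of x y z] by simp
  qed (use vf fin dim s pr P delta in \<open>simp_all only: f_def e_def\<close>)
  then show ?thesis by blast
qed

text \<open>Mass stays in its own cell and is concentrated at an arbitrarily chosen point of
  it.\<close>

lemma point_cloud_discretization:
  fixes V :: "('a::euclidean_space \<times> ('a \<Rightarrow>\<^sub>L 'a)) measure"
  assumes vf: "varifold d V" and fin: "finite_measure V" and dim: "d \<le> DIM('a)"
    and m: "mesh L" and size: "mesh_size L = ennreal \<delta>" and delta: "0 < \<delta>"
  shows "\<exists>s pr P. discretization d V L s pr P \<delta> \<and>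
    point_cloud_varifold d L (discretization.discretized d V s pr P)"
proof -
  define c where "c K = (SOME x. x \<in> K)" for K :: "'a set"
  have c: "c K \<in> K" if "K \<in> L" for K
    using mesh_nonempty[OF m that] unfolding c_def by (simp add: some_in_eq)
  define pr where "pr K = return borel (c K)" for K :: "'a set"
  have "\<exists>P. discretization d V L (cell L) pr P \<delta>"
  proof (rule discretization_intro[OF vf fin dim m delta cell_measurable[OF m]])
    show "dist x y \<le> 3 * \<delta>" if "y \<in> cell L x" for x y
      using dist_le_mesh_size[OF cell_mem(1)[OF m] cell_mem(2)[OF m] that] delta size by simp
    show "prob_space (pr K)" for K unfolding pr_def by (rule prob_space_return) simp
    show "AE y in pr (cell L x). y \<in> cell L x" for x
      unfolding pr_def using c[OF cell_mem(1)[OF m, of x]] mesh_borel[OF m cell_mem(1)[OF m, of x]]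
      by (subst AE_return) auto
  qed (simp add: pr_def)
  then obtain P where "discretization d V L (cell L) pr P \<delta>" by blast
  then interpret discretization d V L "cell L" pr P \<delta> .
  interpret fV: finite_measure V by (rule fin)
  have "point_cloud_varifold d L discretized"
    unfolding point_cloud_varifold_def
  proof (intro conjI exI[of _ "\<lambda>K. measure V {z \<in> space V. cell L (fst z) = K}"] exI[of _ c] exI[of _ P] ballI)
    fix A assume "A \<in> sets discretized"
    then have A: "A \<in> sets (grassmann_borel d)" by (simp add: sets_discretized)
    show "emeasure discretized A = (\<Sum>\<^sub>\<infinity>K\<in>L. ennreal (measure V {z \<in> space V. cell L (fst z) = K}) * indicator A (c K, P K))"
      unfolding emeasure_discretized[OF A]
    proof (rule infsum_cong)
      fix K assume K: "K \<in> L"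
      have "{y. (y, P K) \<in> A} \<in> sets borel"
        using measurable_sets[OF atom_measurable[OF K] A] by (simp add: pr_def vimage_def)
      then show "emeasure V {z \<in> space V. cell L (fst z) = K} * emeasure (pr K) {y. (y, P K) \<in> A} =
         ennreal (measure V {z \<in> space V. cell L (fst z) = K}) * indicator A (c K, P K)"
        by (simp add: pr_def fV.emeasure_eq_measure indicator_def)
    qed
  qed (use P c in \<open>auto simp: sets_discretized\<close>)
  then show ?thesis using discretization_axioms by blast
qed

text \<open>Every cell, null or not, is sent to a cell \<open>\<sigma> K\<close> of positive volume
  meeting the \<delta>-ball around its chosen point \<open>c K\<close>; this detour is the origin of
  3\<delta>. The mass is spread there by normalised Lebesgue measure, which needs finite volume, and
  finite diameter provides it.\<close>

lemma volumetric_discretization: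
  fixes V :: "('a::euclidean_space \<times> ('a \<Rightarrow>\<^sub>L 'a)) measure"
  assumes vf: "varifold d V" and fin: "finite_measure V" and dim: "d \<le> DIM('a)"
    and m: "mesh L" and size: "mesh_size L = ennreal \<delta>" and delta: "0 < \<delta>"
  shows "\<exists>s pr P. discretization d V L s pr P \<delta> \<and>
    volumetric_varifold d L (discretization.discretized d V s pr P)"
proof -
  define c where "c K = (SOME x. x \<in> K)" for K :: "'a set"
  have c: "c K \<in> K" if "K \<in> L" for K
    using mesh_nonempty[OF m that] unfolding c_def by (simp add: some_in_eq)
  have dist_cell: "dist x y \<le> \<delta>" if "K \<in> L" "x \<in> K" "y \<in> K" for K x y
    using dist_le_mesh_size[OF that] delta size by simp
  have "\<exists>K'. K' \<in> L \<and> 0 < emeasure lborel K' \<and> K' \<inter> ball (c K) \<delta> \<noteq> {}" for K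
    using mesh_positive_cell[OF m delta, of "c K"] by blast
  then obtain \<sigma> where sigma: "\<And>K. \<sigma> K \<in> L" "\<And>K. 0 < emeasure lborel (\<sigma> K)" "\<And>K. \<sigma> K \<inter> ball (c K) \<delta> \<noteq> {}"
    by metis
  define s where "s x = \<sigma> (cell L x)" for x
  \<comment> \<open>On null cells the Dirac mass is a placeholder: \<open>s\<close> never takes such
    a value, but a probability measure is demanded for every cell.\<close>
  define pr where "pr K = (if emeasure lborel K = 0 then return borel (c K) else uniform_measure lborel K)"
    for K :: "'a set"
  have finite_cell: "emeasure lborel K \<noteq> \<infinity>" if "K \<in> L" for K
  proof -
    have "K \<subseteq> cball (c K) \<delta>" using dist_cell[OF that c[OF that]] by auto
    then have "emeasure lborel K \<le> emeasure lborel (cball (c K) \<delta>)" by (intro emeasure_mono) auto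
    then show ?thesis using emeasure_lborel_cball_finite[of "c K" \<delta>] by (auto simp: top_unique)
  qed
  have "\<exists>P. discretization d V L s pr P \<delta>"
  proof (rule discretization_intro[OF vf fin dim m delta])
    show "s \<in> measurable borel (count_space L)"
      unfolding s_def by (rule measurable_compose[OF cell_measurable[OF m]]) (use sigma(1) in auto)
    show "dist x y \<le> 3 * \<delta>" if y: "y \<in> s x" for x y
    proof -
      let ?K = "cell L x"
      obtain w where w: "w \<in> \<sigma> ?K" "dist (c ?K) w < \<delta>" using sigma(3)[of ?K] by auto
      have "dist x (c ?K) \<le> \<delta>" using dist_cell[OF cell_mem(1)[OF m] cell_mem(2)[OF m] c[OF cell_mem(1)[OF m]]] .
      moreover have "dist w y \<le> \<delta>" using dist_cell[OF sigma(1) w(1)] y by (simp add: s_def)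
      ultimately show ?thesis
        using w(2) dist_triangle[of x y "c ?K"] dist_triangle[of "c ?K" y w] by linarith
    qed
    show "prob_space (pr K)" if "K \<in> L" for K
      unfolding pr_def using finite_cell[OF that]
      by (auto intro!: prob_space_return prob_space_uniform_measure)
    show "AE y in pr (s x). y \<in> s x" for x
    proof -
      have "s x \<in> sets lborel" using mesh_borel[OF m sigma(1)] by (simp add: s_def)
      moreover have eq: "pr (s x) = uniform_measure lborel (s x)"
        unfolding pr_def using sigma(2)[of "cell L x"] by (auto simp: s_def)
      ultimately show ?thesis unfolding eq by (intro AE_uniform_measureI) simp_all
    qed
  qed (simp add: pr_def)
  then obtain P where "discretization d V L s pr P \<delta>" by blast
  then interpret discretization d V L s pr P \<delta> .
  interpret fV: finite_measure V by (rule fin)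
  have "volumetric_varifold d L discretized"
    unfolding volumetric_varifold_def
  proof (intro conjI exI[of _ "\<lambda>K. measure V {z \<in> space V. s (fst z) = K}"] exI[of _ P] ballI)
    fix A assume "A \<in> sets discretized"
    then have A: "A \<in> sets (grassmann_borel d)" by (simp add: sets_discretized)
    show "emeasure discretized A = (\<Sum>\<^sub>\<infinity>K\<in>L. ennreal (measure V {z \<in> space V. s (fst z) = K}) /
        emeasure lborel K * emeasure lborel {x \<in> K. (x, P K) \<in> A})"
      unfolding emeasure_discretized[OF A]
    proof (rule infsum_cong)
      fix K assume K: "K \<in> L"
      have spK: "space (pr K) = UNIV" using sets_eq_imp_space_eq[OF pr(2)[OF K]] by simp
      have B: "{y. (y, P K) \<in> A} \<in> sets borel"
        using measurable_sets[OF atom_measurable[OF K] A] pr(2)[OF K] by (simp add: spK vimage_def)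
      show "emeasure V {z \<in> space V. s (fst z) = K} * emeasure (pr K) {y. (y, P K) \<in> A} =
         ennreal (measure V {z \<in> space V. s (fst z) = K}) /
          emeasure lborel K * emeasure lborel {x \<in> K. (x, P K) \<in> A}"
      proof (cases "emeasure lborel K = 0")
        case True
        then have "s x \<noteq> K" for x using sigma(2)[of "cell L x"] by (auto simp: s_def)
        then show ?thesis by simp
      next
        case False
        have "K \<inter> {y. (y, P K) \<in> A} = {x \<in> K. (x, P K) \<in> A}" by auto
        then have "emeasure (pr K) {y. (y, P K) \<in> A} = emeasure lborel {x \<in> K. (x, P K) \<in> A} / emeasure lborel K"
          using False B mesh_borel[OF m K] by (simp add: pr_def)
        then show ?thesis by (simp add: fV.emeasure_eq_measure divide_ennreal_def mult_ac)
      qed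
    qed
  qed (use P in \<open>auto simp: sets_discretized\<close>)
  then show ?thesis using discretization_axioms by blast
qed

lemma zero_discretization:
  fixes L :: "'a::euclidean_space set set"
  assumes m: "mesh L" and dim: "d \<le> DIM('a)"
    and kind: "is_discrete \<in> {volumetric_varifold d, point_cloud_varifold d}"
  shows "is_discrete L (null_measure (grassmann_borel d))"
proof -
  obtain Q :: "'a \<Rightarrow>\<^sub>L 'a" where Q: "Q \<in> grassmannian d" using grassmannian_nonempty[OF dim] by blast
  have c: "(SOME x. x \<in> K) \<in> K" if "K \<in> L" for K
    using mesh_nonempty[OF m that] by (simp add: some_in_eq)
  have "volumetric_varifold d L (null_measure (grassmann_borel d))"
    unfolding volumetric_varifold_def
    by (intro conjI exI[of _ "\<lambda>_. 0"] exI[of _ "\<lambda>_. Q"] ballI) (simp_all add: Q)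
  moreover have "point_cloud_varifold d L (null_measure (grassmann_borel d))"
    unfolding point_cloud_varifold_def
    by (intro conjI exI[of _ "\<lambda>_. 0"] exI[of _ "\<lambda>K. SOME x. x \<in> K"] exI[of _ "\<lambda>_. Q"] ballI)
      (simp_all add: Q c)
  ultimately show ?thesis using kind by auto
qed

section \<open>Error bounds for a single discretisation\<close>

lemma nn_integral_indicator_mass:
  assumes vf: "varifold d V" and X: "X \<in> sets borel"
  shows "(\<integral>\<^sup>+z. c * indicator X (fst z) \<partial>V) = c * emeasure (mass_measure V) X"
    "(\<lambda>z. c * indicator X (fst z)) \<in> borel_measurable V"
proof -
  have "fst \<in> borel_measurable (borel :: ('a::euclidean_space \<times> ('a \<Rightarrow>\<^sub>L 'a)) measure)"
    by (intro borel_measurable_continuous_onI continuous_intros)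
  then have f: "fst \<in> borel_measurable V" by (rule varifold_measurable[OF vf])
  have i: "(\<lambda>x. c * indicator X x) \<in> borel_measurable borel"
    using X by measurable
  have "(\<integral>\<^sup>+z. c * indicator X (fst z) \<partial>V) = (\<integral>\<^sup>+x. c * indicator X x \<partial>mass_measure V)"
    unfolding mass_measure_def by (rule nn_integral_distr[OF f, symmetric]) (use i in simp)
  also have "\<dots> = c * emeasure (mass_measure V) X"
    by (rule nn_integral_cmult_indicator) (simp add: mass_measure_def X)
  finally show "(\<integral>\<^sup>+z. c * indicator X (fst z) \<partial>V) = c * emeasure (mass_measure V) X" .
  show "(\<lambda>z. c * indicator X (fst z)) \<in> borel_measurable V"
    by (rule measurable_compose[OF f i])
qed

lemma nbhd_borel: "nbhd A r \<in> sets borel"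
  by (intro borel_open open_nbhd)

lemma nbhd_UNIV:
  assumes "0 < r" shows "nbhd UNIV r = UNIV"
proof -
  have "y \<in> nbhd UNIV r" for y
    using assms unfolding nbhd_def by (intro UN_I[of y]) simp_all
  then show ?thesis by blast
qed

lemma mem_nbhd_iff: "0 \<le> r \<Longrightarrow> y \<in> nbhd A (ennreal r) \<longleftrightarrow> (\<exists>x\<in>A. dist x y < r)"
  by (auto simp: nbhd_def ennreal_less_iff)

text \<open>V is carried by the graph of T, so integrands have to be compared at the tangent planes
  only and not at every plane over x.\<close>

lemma tangent_graph_nn_integral_mono:
  assumes tg: "tangent_graph d M \<theta> V M' T N"
    and f: "f \<in> borel_measurable V" and g: "g \<in> borel_measurable V"
    and le: "\<And>x. x \<in> M' \<Longrightarrow> f (x, T x) \<le> g (x, T x)"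
  shows "(\<integral>\<^sup>+z. f z \<partial>V) \<le> (\<integral>\<^sup>+z. g z \<partial>V)"
proof -
  have m: "(\<lambda>x. (x, T x)) \<in> measurable N (grassmann_borel d)"
    and V: "V = distr N (grassmann_borel d) (\<lambda>x. (x, T x))"
    using tg unfolding tangent_graph_def by blast+
  have eq: "(\<integral>\<^sup>+z. h z \<partial>V) = (\<integral>\<^sup>+x. h (x, T x) \<partial>N)" if "h \<in> borel_measurable V" for h
    using that m unfolding V by (subst nn_integral_distr) auto
  show ?thesis unfolding eq[OF f] eq[OF g]
    using le tangent_graph_measurable(1)[OF tg] by (intro nn_integral_mono) simp
qed

section \<open>Competitor planes: arbitrary, from a compact graph, from small oscillation\<close>

context discretization
begin

text \<open>The distances 4\<delta> and 6\<delta> add up to 10\<delta>, rounded up to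
  11\<delta>.\<close>

lemma cell_subset_nbhd:
  assumes "\<And>x y. x \<in> A \<Longrightarrow> y \<in> A \<Longrightarrow> dist x y \<le> 6 * \<delta>" "A \<inter> nbhd U (ennreal (4 * \<delta>)) \<noteq> {}"
  shows "A \<subseteq> nbhd U (ennreal (11 * \<delta>))"
proof
  fix y assume y: "y \<in> A"
  obtain x u where x: "x \<in> A" "u \<in> U" "dist u x < 4 * \<delta>"
    using assms(2) delta_pos by (auto simp: mem_nbhd_iff)
  have "dist u y < 11 * \<delta>"
    using assms(1)[OF x(1) y] x(3) dist_triangle[of u y x] delta_pos by linarith
  then show "y \<in> nbhd U (ennreal (11 * \<delta>))" using x(2) delta_pos by (auto simp: mem_nbhd_iff)
qed

lemma plane_exists: "\<exists>Q :: 'a \<Rightarrow>\<^sub>L 'a. Q \<in> grassmannian d"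
  using grassmannian_nonempty[OF dim] by blast

text \<open>Any plane is a competitor, the integrand being truncated at 3. This serves coarse meshes
  and varifolds of zero mass.\<close>

lemma trivial_bound:
  "bounded_lipschitz_dist d U discretized V \<le> 3 * emeasure (mass_measure V) (nbhd U (ennreal (11 * \<delta>)))"
proof -
  let ?X = "nbhd U (ennreal (11 * \<delta>))"
  have "bounded_lipschitz_dist d U discretized V \<le> (\<integral>\<^sup>+z. 3 * indicator ?X (fst z) \<partial>V)"
  proof (rule discretized_comparison)
    show "(\<lambda>z. 3 * indicator ?X (fst z) :: ennreal) \<in> borel_measurable V"
      by (rule nn_integral_indicator_mass(2)[OF vf nbhd_borel])
    fix A :: "'a set" assume d: "\<And>x y. x \<in> A \<Longrightarrow> y \<in> A \<Longrightarrow> dist x y \<le> 6 * \<delta>"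
      and "A \<inter> nbhd U (ennreal (4 * \<delta>)) \<noteq> {}"
    then have AX: "A \<subseteq> ?X" by (rule cell_subset_nbhd)
    obtain Q :: "'a \<Rightarrow>\<^sub>L 'a" where Q: "Q \<in> grassmannian d" using plane_exists by blast
    have "ennreal (min 3 t) \<le> 3" for t
      using ennreal_leI[of "min 3 t" 3] by simp
    then have "(\<integral>\<^sup>+z. ennreal (min 3 (4 * \<delta> + norm (snd z - Q))) * indicator A (fst z) \<partial>V)
          \<le> (\<integral>\<^sup>+z. 3 * indicator ?X (fst z) * indicator A (fst z) \<partial>V)"
      using AX by (intro nn_integral_mono) (auto simp: indicator_def)
    with Q show "\<exists>Q\<in>grassmannian d.
        (\<integral>\<^sup>+z. ennreal (min 3 (4 * \<delta> + norm (snd z - Q))) * indicator A (fst z) \<partial>V)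
          \<le> (\<integral>\<^sup>+z. 3 * indicator ?X (fst z) * indicator A (fst z) \<partial>V)" by blast
  qed
  then show ?thesis by (simp add: nn_integral_indicator_mass(1)[OF vf nbhd_borel])
qed

text \<open>The competitor is the plane of any one point of Q over A. The other points of Q over A
  lie within 6\<delta> < \<eta> of it, so their planes differ by less than e and the error on Q is
  at most 4\<delta> + e \<le> 2e; off Q the truncation value 3 meets the small mass.\<close>

lemma compact_graph_bound:
  assumes Q: "closed Q" and e: "0 < e" "4 * \<delta> \<le> e" "6 * \<delta> < \<eta>"
    and unif: "\<And>p q. p \<in> Q \<Longrightarrow> q \<in> Q \<Longrightarrow> dist (fst p) (fst q) < \<eta> \<Longrightarrow> dist (snd p) (snd q) < e"
    and small: "emeasure V (space V - Q) \<le> ennreal e"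
  shows "bounded_lipschitz_dist d UNIV discretized V \<le> ennreal (2 * e) * emeasure V (space V) + 3 * ennreal e"
proof -
  have "(\<lambda>p. p) \<in> borel_measurable V" by (rule varifold_measurable[OF vf]) simp
  then have Qs: "space V - Q \<in> sets V"
    using measurable_sets[of "\<lambda>p. p" V borel "- Q"] Q by (simp add: borel_open open_Compl Diff_eq Int_commute)
  have "bounded_lipschitz_dist d UNIV discretized V
      \<le> (\<integral>\<^sup>+z. ennreal (2 * e) + 3 * indicator (space V - Q) z \<partial>V)"
  proof (rule discretized_comparison)
    show "(\<lambda>z. ennreal (2 * e) + 3 * indicator (space V - Q) z :: ennreal) \<in> borel_measurable V"
      using Qs by measurable
    fix A :: "'a set" assume dA: "\<And>x y. x \<in> A \<Longrightarrow> y \<in> A \<Longrightarrow> dist x y \<le> 6 * \<delta>"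
    have le3: "ennreal (min 3 t) \<le> 3" for t
      using ennreal_leI[of "min 3 t" 3] by simp
    \<comment> \<open>Q is a set of pairs with arbitrary operators; a point of it yields an
      admissible plane only if it belongs to \<open>space V\<close>.\<close>
    have "\<exists>P\<in>grassmannian d. \<forall>z\<in>Q \<inter> space V. fst z \<in> A \<longrightarrow> norm (snd z - P) \<le> e"
    proof (cases "\<exists>q\<in>Q \<inter> space V. fst q \<in> A")
      case True
      then obtain q where q: "q \<in> Q" "q \<in> space V" "fst q \<in> A" by blast
      have "norm (snd z - snd q) \<le> e" if "z \<in> Q" "fst z \<in> A" for z
        using unif[OF that(1) q(1)] dA[OF that(2) q(3)] e by (simp add: dist_norm)
      moreover have "snd q \<in> grassmannian d" using q(2) by (auto simp: varifold_space[OF vf])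
      ultimately show ?thesis by blast
    next
      case False
      then show ?thesis using plane_exists by blast
    qed
    then obtain P where P: "P \<in> grassmannian d"
      "\<And>z. z \<in> Q \<Longrightarrow> z \<in> space V \<Longrightarrow> fst z \<in> A \<Longrightarrow> norm (snd z - P) \<le> e" by blast
    have "(\<integral>\<^sup>+z. ennreal (min 3 (4 * \<delta> + norm (snd z - P))) * indicator A (fst z) \<partial>V)
          \<le> (\<integral>\<^sup>+z. (ennreal (2 * e) + 3 * indicator (space V - Q) z) * indicator A (fst z) \<partial>V)"
    proof (rule nn_integral_mono)
      fix z assume z: "z \<in> space V"
      have "ennreal (min 3 (4 * \<delta> + norm (snd z - P))) \<le> ennreal (2 * e) + 3 * indicator (space V - Q) z"
        if "fst z \<in> A"
      proof (cases "z \<in> Q")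
        case True
        have "ennreal (min 3 (4 * \<delta> + norm (snd z - P))) \<le> ennreal (2 * e)"
          using P(2)[OF True z that] e(2) by (intro ennreal_leI) linarith
        then show ?thesis by (rule order_trans) simp
      next
        case False
        then show ?thesis using le3 z by (intro order_trans[OF le3]) simp
      qed
      then show "ennreal (min 3 (4 * \<delta> + norm (snd z - P))) * indicator A (fst z)
          \<le> (ennreal (2 * e) + 3 * indicator (space V - Q) z) * indicator A (fst z)"
        by (auto simp: indicator_def)
    qed
    with P(1) show "\<exists>Qa\<in>grassmannian d.
        (\<integral>\<^sup>+z. ennreal (min 3 (4 * \<delta> + norm (snd z - Qa))) * indicator A (fst z) \<partial>V)
          \<le> (\<integral>\<^sup>+z. (ennreal (2 * e) + 3 * indicator (space V - Q) z) * indicator A (fst z) \<partial>V)" by blast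
  qed
  also have "\<dots> = ennreal (2 * e) * emeasure V (space V) + 3 * emeasure V (space V - Q)"
    using Qs by (subst nn_integral_add) (auto simp: nn_integral_cmult_indicator)
  also have "\<dots> \<le> ennreal (2 * e) * emeasure V (space V) + 3 * ennreal e"
    by (intro add_left_mono mult_left_mono small) simp
  finally show ?thesis .
qed

text \<open>If one carrier point y of the fibre is farther than 7C\<delta> from \<Sigma>, all others
  lie in the ball of radius 7\<delta> around y, and T y is a competitor with error \<omega>.
  Otherwise all carrier points of the fibre lie in the tube around \<Sigma>, where the truncation
  value 3 is used; doubling 7C to 14C makes the open tube contain them. An empty \<Sigma> is at
  infinite \<open>einfdist\<close> and never leads to the second case with a carrier point
  present.\<close>

lemma oscillation_bound:
  assumes tg: "tangent_graph d S \<theta> V S' T N" and C: "1 \<le> C" and w: "0 \<le> \<omega>"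
    and osc: "tangent_oscillation d S \<theta> \<Sigma> C (7 * \<delta>) \<le> ennreal \<omega>"
  shows "bounded_lipschitz_dist d U discretized V \<le>
    ennreal (4 * \<delta> + \<omega>) * emeasure (mass_measure V) (nbhd U (ennreal (11 * \<delta>))) +
    3 * emeasure (mass_measure V) (nbhd \<Sigma> (ennreal (14 * C * \<delta>)) \<inter> nbhd U (ennreal (11 * \<delta>)))"
proof -
  let ?X = "nbhd U (ennreal (11 * \<delta>))" and ?Y = "nbhd \<Sigma> (ennreal (14 * C * \<delta>))"
  have YX: "?Y \<inter> ?X \<in> sets borel" by (intro sets.Int nbhd_borel)
  note mX = nn_integral_indicator_mass[OF vf nbhd_borel[of U "ennreal (11 * \<delta>)"]]
    and mY = nn_integral_indicator_mass[OF vf YX]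
  have SS: "S' \<subseteq> S" and approx: "\<And>x. x \<in> S' \<Longrightarrow> approx_tangent_space d S \<theta> x (T x)"
    using tg by (auto simp: tangent_graph_def)
  have cf: "(fst :: 'a \<times> ('a \<Rightarrow>\<^sub>L 'a) \<Rightarrow> 'a) \<in> borel_measurable borel"
    "(snd :: 'a \<times> ('a \<Rightarrow>\<^sub>L 'a) \<Rightarrow> ('a \<Rightarrow>\<^sub>L 'a)) \<in> borel_measurable borel"
    by (intro borel_measurable_continuous_onI continuous_intros)+
  note cfV = cf[THEN varifold_measurable[OF vf]]
  let ?E = "\<lambda>z. ennreal (4 * \<delta> + \<omega>) * indicator ?X (fst z) + 3 * indicator (?Y \<inter> ?X) (fst z)"
  have mE: "?E \<in> borel_measurable V" by (intro borel_measurable_add mX(2) mY(2))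
  have "bounded_lipschitz_dist d U discretized V \<le> (\<integral>\<^sup>+z. ?E z \<partial>V)"
  proof (rule discretized_comparison[OF mE])
    fix A :: "'a set" assume A: "A \<in> sets borel"
      and dA: "\<And>x y. x \<in> A \<Longrightarrow> y \<in> A \<Longrightarrow> dist x y \<le> 6 * \<delta>"
      and "A \<inter> nbhd U (ennreal (4 * \<delta>)) \<noteq> {}"
    from dA this(3) have AX: "A \<subseteq> ?X" by (rule cell_subset_nbhd)
    have indA: "(\<lambda>z. indicator A (fst z) :: ennreal) \<in> borel_measurable V"
      by (rule measurable_compose[OF cfV(1) borel_measurable_indicator[OF A]])
    have le3: "ennreal (min 3 t) \<le> 3" for t
      using ennreal_leI[of "min 3 t" 3] by simp
    have "\<exists>Q\<in>grassmannian d. \<forall>x\<in>S' \<inter> A. ennreal (min 3 (4 * \<delta> + norm (T x - Q))) \<le> ?E (x, T x)"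
    proof (cases "\<exists>y\<in>S' \<inter> A. ennreal (C * (7 * \<delta>)) < einfdist y \<Sigma>")
      case True
      then obtain y where y: "y \<in> S'" "y \<in> A" "ennreal (C * (7 * \<delta>)) < einfdist y \<Sigma>" by blast
      have "norm (T x - T y) \<le> \<omega>" if x: "x \<in> S'" "x \<in> A" for x
      proof -
        have "dist y x < 7 * \<delta>" using dA[OF y(2) x(2)] delta_pos by simp
        then have "ennreal (norm (T x - T y)) \<le> tangent_oscillation d S \<theta> \<Sigma> C (7 * \<delta>)"
          unfolding tangent_oscillation_def using x y SS approx[OF x(1)] approx[OF y(1)] delta_pos
          by (intro Sup_upper CollectI exI[of _ "T x"] exI[of _ "T y"] exI[of _ y] exI[of _ x]) auto
        also note osc
        finally show ?thesis using w by simp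
      qed
      then have "\<forall>x\<in>S' \<inter> A. ennreal (min 3 (4 * \<delta> + norm (T x - T y))) \<le> ennreal (4 * \<delta> + \<omega>)"
        by (intro ballI ennreal_leI) (auto simp: min_le_iff_disj)
      moreover have "ennreal (4 * \<delta> + \<omega>) \<le> ?E (x, T x)" if "x \<in> S' \<inter> A" for x
        using that AX by (auto simp: indicator_def)
      moreover have "T y \<in> grassmannian d" using approx[OF y(1)] by (simp add: approx_tangent_space_def)
      ultimately show ?thesis by (meson order_trans)
    next
      case False
      obtain Q :: "'a \<Rightarrow>\<^sub>L 'a" where Q: "Q \<in> grassmannian d" using plane_exists by blast
      have "3 \<le> ?E (x, T x)" if x: "x \<in> S' \<inter> A" for x
      proof -
        have "einfdist x \<Sigma> \<le> ennreal (C * (7 * \<delta>))" using False x by (simp add: not_less)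
        also have "\<dots> < ennreal (14 * C * \<delta>)" using C delta_pos by (intro ennreal_lessI) auto
        finally obtain z where "z \<in> \<Sigma>" "ennreal (dist x z) < ennreal (14 * C * \<delta>)"
          unfolding einfdist_def INF_less_iff by blast
        then have "x \<in> ?Y" by (auto simp: nbhd_def dist_commute)
        then show ?thesis using x AX by (auto simp: indicator_def)
      qed
      then show ?thesis using Q le3 by (meson order_trans)
    qed
    then obtain Q where Q: "Q \<in> grassmannian d"
      "\<And>x. x \<in> S' \<Longrightarrow> x \<in> A \<Longrightarrow> ennreal (min 3 (4 * \<delta> + norm (T x - Q))) \<le> ?E (x, T x)" by blast
    have "(\<integral>\<^sup>+z. ennreal (min 3 (4 * \<delta> + norm (snd z - Q))) * indicator A (fst z) \<partial>V)
          \<le> (\<integral>\<^sup>+z. ?E z * indicator A (fst z) \<partial>V)"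
    proof (rule tangent_graph_nn_integral_mono[OF tg])
      show "(\<lambda>z. ennreal (min 3 (4 * \<delta> + norm (snd z - Q))) * indicator A (fst z)) \<in> borel_measurable V"
        using cfV indA by measurable
      show "(\<lambda>z. ?E z * indicator A (fst z)) \<in> borel_measurable V"
        by (intro borel_measurable_times_ennreal mE indA)
      show "ennreal (min 3 (4 * \<delta> + norm (snd (x, T x) - Q))) * indicator A (fst (x, T x))
          \<le> ?E (x, T x) * indicator A (fst (x, T x))" if "x \<in> S'" for x
        using Q(2)[OF that] by (cases "x \<in> A") simp_all
    qed
    with Q(1) show "\<exists>Q\<in>grassmannian d.
        (\<integral>\<^sup>+z. ennreal (min 3 (4 * \<delta> + norm (snd z - Q))) * indicator A (fst z) \<partial>V)
          \<le> (\<integral>\<^sup>+z. ?E z * indicator A (fst z) \<partial>V)" by blast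
  qed
  also have "\<dots> = (\<integral>\<^sup>+z. ennreal (4 * \<delta> + \<omega>) * indicator ?X (fst z) \<partial>V) + (\<integral>\<^sup>+z. 3 * indicator (?Y \<inter> ?X) (fst z) \<partial>V)"
    by (intro nn_integral_add mX(2) mY(2))
  also have "\<dots> = ennreal (4 * \<delta> + \<omega>) * emeasure (mass_measure V) ?X + 3 * emeasure (mass_measure V) (?Y \<inter> ?X)"
    by (simp only: mX(1) mY(1))
  finally show ?thesis .
qed

end

section \<open>Mass near the singular set of a piecewise regular varifold\<close>

text \<open>The witnesses of the definition are fixed together with a graph representation of V over
  the same S and \<theta>: the conditions speak of S, which may differ from the set M by which the
  varifold was first given.\<close>

locale piecewise_regular =
  fixes d :: nat and V :: "('a::euclidean_space \<times> ('a \<Rightarrow>\<^sub>L 'a)) measure"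
    and S :: "'a set" and \<theta> :: "'a \<Rightarrow> real" and R C \<beta> :: real and \<Sigma> :: "'a set"
    and S' :: "'a set" and T :: "'a \<Rightarrow> 'a \<Rightarrow>\<^sub>L 'a" and N :: "'a measure"
  assumes d_pos: "1 \<le> d" and vf: "varifold d V" and fin: "finite_measure V"
    and tg: "tangent_graph d S \<theta> V S' T N" and S_meas: "S \<in> sets (hausdorff_measure d)"
    and R: "0 < R" and C: "1 \<le> C" and beta: "0 < \<beta>" "\<beta> \<le> 1" and closed_Sigma: "closed \<Sigma>" and Sigma_S: "\<Sigma> \<subseteq> S"
    and lower_regular: "\<And>x r. x \<in> S \<Longrightarrow> 0 < r \<Longrightarrow> r < R \<Longrightarrow>
      ennreal (r ^ d / C) \<le> hausdorff_outer d (S \<inter> ball x r)"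
    and Sigma_upper: "\<And>z r. z \<in> \<Sigma> \<Longrightarrow> 0 < r \<Longrightarrow> r < R \<Longrightarrow>
      hausdorff_outer (d - 1) (\<Sigma> \<inter> ball z r) \<le> ennreal (C * r ^ (d - 1))"
    and oscillation: "\<And>r. 0 < r \<Longrightarrow> r < R \<Longrightarrow> tangent_oscillation d S \<theta> \<Sigma> C r \<le> ennreal (C * r powr \<beta>)"
    and tube: "\<And>z r e. z \<in> \<Sigma> \<Longrightarrow> 0 < r \<Longrightarrow> r < e \<Longrightarrow> e < R \<Longrightarrow>
      hausdorff_outer d (S \<inter> nbhd \<Sigma> (ennreal r) \<inter> ball z e)
        \<le> ennreal (C * r) * hausdorff_outer (d - 1) (\<Sigma> \<inter> ball z e)"
    and density: "AE x in restrict_space (hausdorff_measure d) S. 1 / C \<le> \<theta> x \<and> \<theta> x \<le> C"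
begin

abbreviation "\<mu> \<equiv> mass_measure V"

lemma S'_facts: "S' \<in> sets (hausdorff_measure d)" "S' \<subseteq> S" "hausdorff_outer d (S - S') = 0"
  "\<theta> \<in> borel_measurable (restrict_space (hausdorff_measure d) S')"
  "N = density (restrict_space (hausdorff_measure d) S') (\<lambda>x. ennreal (\<theta> x))"
  using tg by (auto simp: tangent_graph_def)

lemma mass_eq:
  assumes A: "A \<in> sets borel"
  shows "emeasure \<mu> A = (\<integral>\<^sup>+x. ennreal (\<theta> x) * indicator (A \<inter> S') x \<partial>restrict_space (hausdorff_measure d) S')"
    "A \<inter> S' \<in> sets (restrict_space (hausdorff_measure d) S')"
proof -
  note sp = tangent_graph_measurable(1)[OF tg]
  have s: "A \<inter> S' \<in> sets N"
    using measurable_sets[OF tangent_graph_measurable(3)[OF tg] A] sp by (simp add: vimage_def Int_def)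
  then show s': "A \<inter> S' \<in> sets (restrict_space (hausdorff_measure d) S')"
    unfolding S'_facts(5) by simp
  have "emeasure \<mu> A = emeasure V ((A \<times> UNIV) \<inter> space V)"
    using emeasure_mass_measure[OF vf A] by (simp add: varifold_space[OF vf] Times_Int_Times)
  also have "\<dots> = emeasure N {x \<in> S'. (x, T x) \<in> A \<times> UNIV}"
    by (rule tangent_graph_emeasure[OF tg]) (use A in \<open>simp flip: borel_prod\<close>)
  also have "{x \<in> S'. (x, T x) \<in> A \<times> UNIV} = A \<inter> S'" by auto
  also have "emeasure N (A \<inter> S') = (\<integral>\<^sup>+x. ennreal (\<theta> x) * indicator (A \<inter> S') x \<partial>restrict_space (hausdorff_measure d) S')"
    unfolding S'_facts(5) using S'_facts(4) by (intro emeasure_density s') simp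
  finally show "emeasure \<mu> A = (\<integral>\<^sup>+x. ennreal (\<theta> x) * indicator (A \<inter> S') x \<partial>restrict_space (hausdorff_measure d) S')" .
qed

lemma density_S': "AE x in restrict_space (hausdorff_measure d) S'. 1 / C \<le> \<theta> x \<and> \<theta> x \<le> C"
proof -
  have "AE x in hausdorff_measure d. x \<in> S \<longrightarrow> 1 / C \<le> \<theta> x \<and> \<theta> x \<le> C"
    using density S_meas by (subst (asm) AE_restrict_space_iff) auto
  then have "AE x in hausdorff_measure d. x \<in> S' \<longrightarrow> 1 / C \<le> \<theta> x \<and> \<theta> x \<le> C"
    by eventually_elim (use S'_facts(2) in auto)
  then show ?thesis using S'_facts(1) by (subst AE_restrict_space_iff) auto
qed

lemma restrict_emeasure:
  assumes A: "A \<in> sets borel"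
  shows "emeasure (restrict_space (hausdorff_measure d) S') (A \<inter> S') = hausdorff_outer d (A \<inter> S')"
proof -
  have "A \<inter> S' \<in> sets (hausdorff_measure d)"
    using mass_eq(2)[OF A] S'_facts(1) by (subst (asm) sets_restrict_space_iff) auto
  then show ?thesis using S'_facts(1) by (simp add: emeasure_restrict_space emeasure_hausdorff_measure)
qed

lemma mass_upper:
  assumes A: "A \<in> sets borel"
  shows "emeasure \<mu> A \<le> ennreal C * hausdorff_outer d (S \<inter> A)"
proof -
  have "emeasure \<mu> A \<le> (\<integral>\<^sup>+x. ennreal C * indicator (A \<inter> S') x \<partial>restrict_space (hausdorff_measure d) S')"
    unfolding mass_eq(1)[OF A]
  proof (rule nn_integral_mono_AE, use density_S' in eventually_elim)
    fix x assume "1 / C \<le> \<theta> x \<and> \<theta> x \<le> C"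
    then show "ennreal (\<theta> x) * indicator (A \<inter> S') x \<le> ennreal C * indicator (A \<inter> S') x"
      by (intro mult_right_mono ennreal_leI) auto
  qed
  also have "\<dots> = ennreal C * hausdorff_outer d (A \<inter> S')"
    using mass_eq(2)[OF A] by (simp add: nn_integral_cmult_indicator restrict_emeasure[OF A])
  also have "\<dots> \<le> ennreal C * hausdorff_outer d (S \<inter> A)"
    using S'_facts(2) by (intro mult_left_mono hausdorff_outer_mono) auto
  finally show ?thesis .
qed

text \<open>The carrier \<open>S'\<close> misses only a null part of S, which subadditivity of the
  outer measure absorbs.\<close>

lemma mass_lower:
  assumes A: "A \<in> sets borel"
  shows "ennreal (1 / C) * hausdorff_outer d (S \<inter> A) \<le> emeasure \<mu> A"
proof -
  have "hausdorff_outer d (S \<inter> A) \<le> hausdorff_outer d (A \<inter> S') + hausdorff_outer d (S - S')"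
    by (rule order_trans[OF hausdorff_outer_mono hausdorff_outer_Un]) auto
  then have "ennreal (1 / C) * hausdorff_outer d (S \<inter> A) \<le> ennreal (1 / C) * hausdorff_outer d (A \<inter> S')"
    by (intro mult_left_mono) (simp_all add: S'_facts(3))
  also have "\<dots> = (\<integral>\<^sup>+x. ennreal (1 / C) * indicator (A \<inter> S') x \<partial>restrict_space (hausdorff_measure d) S')"
    using nn_integral_cmult_indicator[OF mass_eq(2)[OF A]] by (simp add: restrict_emeasure[OF A])
  also have "\<dots> \<le> emeasure \<mu> A"
    unfolding mass_eq(1)[OF A]
  proof (rule nn_integral_mono_AE, use density_S' in eventually_elim)
    fix x assume "1 / C \<le> \<theta> x \<and> \<theta> x \<le> C"
    then show "ennreal (1 / C) * indicator (A \<inter> S') x \<le> ennreal (\<theta> x) * indicator (A \<inter> S') x"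
      by (intro mult_right_mono ennreal_leI) auto
  qed
  finally show ?thesis .
qed

text \<open>One factor C comes from the regularity of S, the other from the lower bound on the
  density.\<close>

lemma mass_ball_lower:
  assumes "x \<in> S" "0 < r" "r < R"
  shows "ennreal (r ^ d / C\<^sup>2) \<le> emeasure \<mu> (ball x r)"
proof -
  have "ennreal (r ^ d / C\<^sup>2) = ennreal (1 / C) * ennreal (r ^ d / C)"
    using C assms(2) by (simp add: ennreal_mult[symmetric] power2_eq_square)
  also have "\<dots> \<le> ennreal (1 / C) * hausdorff_outer d (S \<inter> ball x r)"
    by (intro mult_left_mono lower_regular assms) simp
  also have "\<dots> \<le> emeasure \<mu> (ball x r)" by (rule mass_lower) simp
  finally show ?thesis .
qed

text \<open>The three factors C are the upper bound on the density, the comparison of the tube with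
  \<Sigma>, and the upper regularity of \<Sigma>.\<close>

lemma mass_tube:
  assumes z: "z \<in> \<Sigma>" and r: "0 < r" "r < e" "e < R"
  shows "emeasure \<mu> (nbhd \<Sigma> (ennreal r) \<inter> ball z e) \<le> ennreal (C ^ 3 * r * e ^ (d - 1))"
proof -
  have "emeasure \<mu> (nbhd \<Sigma> (ennreal r) \<inter> ball z e)
      \<le> ennreal C * hausdorff_outer d (S \<inter> (nbhd \<Sigma> (ennreal r) \<inter> ball z e))"
    by (intro mass_upper sets.Int nbhd_borel) auto
  also have "\<dots> \<le> ennreal C * (ennreal (C * r) * ennreal (C * e ^ (d - 1)))"
    using tube[OF z r] Sigma_upper[OF z _ r(3)] r
    by (intro mult_left_mono order_trans[OF tube[OF z r, folded Int_assoc, simplified Int_assoc]]) auto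
  also have "\<dots> = ennreal (C ^ 3 * r * e ^ (d - 1))"
    using C r by (simp add: ennreal_mult[symmetric] power3_eq_cube mult_ac)
  finally show ?thesis .
qed

text \<open>Regularity is available at points of S, whereas the balls of the theorem are centred on
  the support, which may contain limit points of S outside S.\<close>

lemma support_near_S:
  assumes x: "x \<in> measure_support \<mu>" and e: "0 < e"
  shows "\<exists>y\<in>S. dist x y < e"
proof (rule ccontr)
  assume "\<not> ?thesis"
  then have "S \<inter> ball x e = {}" by auto
  then have "emeasure \<mu> (ball x e) \<le> 0" using mass_upper[of "ball x e"] by simp
  moreover have "emeasure \<mu> (ball x e) > 0" using x e by (auto simp: measure_support_def)
  ultimately show False by simp
qed

text \<open>With u = r + \<delta>, the tube within reach has mass at most of order \<delta> u^(d-1),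
  while the neighbourhood of the ball, centred on the support, has mass at least of order u^d. The
  quotient is the factor \<delta>/(r + \<delta>).\<close>

lemma mass_near_Sigma_local:
  assumes a: "1 \<le> a"
  shows "\<exists>K>0. \<exists>t>0. \<forall>x\<in>measure_support \<mu>. \<forall>r \<delta>. 0 < r \<and> r < t \<and> 0 < \<delta> \<and> \<delta> < t \<longrightarrow>
    emeasure \<mu> (nbhd \<Sigma> (ennreal (a * \<delta>)) \<inter> nbhd (ball x r) (ennreal (11 * \<delta>)))
      \<le> ennreal (K * (\<delta> / (r + \<delta>))) * emeasure \<mu> (nbhd (ball x r) (ennreal (11 * \<delta>)))"
proof -
  \<comment> \<open>\<open>b\<close> bounds a path from a point z of \<Sigma> to any point of the
    set: a\<delta> and 11\<delta> into the ball, at most 2r across it and 11\<delta> out again,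
    altogether at most b(r + \<delta>). \<open>K\<close> is the quotient of the constants in
    \<open>mass_tube\<close> and \<open>mass_ball_lower\<close>, and \<open>t\<close> keeps b(r +
    \<delta>) below R.\<close>
  define b where "b = 22 + a"
  define K where "K = C ^ 5 * a * b ^ (d - 1) * 4 ^ d"
  define t where "t = R / (2 * b)"
  have b: "1 \<le> b" "a < b" "0 < b" using a by (auto simp: b_def)
  have K: "0 < K" using C a b by (simp add: K_def)
  have t: "0 < t" using R b by (simp add: t_def)
  have "emeasure \<mu> (nbhd \<Sigma> (ennreal (a * \<delta>)) \<inter> nbhd (ball x r) (ennreal (11 * \<delta>)))
      \<le> ennreal (K * (\<delta> / (r + \<delta>))) * emeasure \<mu> (nbhd (ball x r) (ennreal (11 * \<delta>)))"
    (is "emeasure \<mu> ?Y \<le> _ * emeasure \<mu> ?X")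
    if x: "x \<in> measure_support \<mu>" and r: "0 < r" "r < t" and dl: "0 < \<delta>" "\<delta> < t" for x r \<delta>
  proof (cases "?Y = {}")
    case True
    then show ?thesis by simp
  next
    case False
    define u where "u = r + \<delta>"
    have u: "0 < u" "\<delta> < u" "r < u" using r dl by (auto simp: u_def)
    have bu: "b * u < R"
    proof -
      have "u < 2 * t" using r dl by (simp add: u_def)
      then have "b * u < b * (2 * t)" using b by simp
      then show ?thesis using b by (simp add: t_def)
    qed
    have u_R: "u < R" using bu b u by (smt (verit) mult_le_cancel_right1)
    obtain q z w where q: "z \<in> \<Sigma>" "dist z q < a * \<delta>" "w \<in> ball x r" "dist w q < 11 * \<delta>"
      using False a dl by (auto simp: mem_nbhd_iff)
    have sub: "?Y \<subseteq> nbhd \<Sigma> (ennreal (a * \<delta>)) \<inter> ball z (b * u)"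
    proof
      fix y assume y: "y \<in> ?Y"
      then obtain v where v: "v \<in> ball x r" "dist v y < 11 * \<delta>" using dl by (auto simp: mem_nbhd_iff)
      have "dist z y \<le> dist z q + dist w q + dist x w + dist x v + dist v y"
        using dist_triangle[of z y q] dist_triangle3[of q y w] dist_triangle3[of w y x] dist_triangle[of x y v]
        by (simp add: dist_commute)
      also have "\<dots> < a * \<delta> + 11 * \<delta> + r + r + 11 * \<delta>" using q v by simp
      also have "\<dots> \<le> b * u" using r dl a by (simp add: b_def u_def algebra_simps)
      finally show "y \<in> nbhd \<Sigma> (ennreal (a * \<delta>)) \<inter> ball z (b * u)" using y by simp
    qed
    have adbu: "a * \<delta> < b * u" using a b u dl by (intro mult_strict_mono) auto
    have "emeasure \<mu> ?Y \<le> emeasure \<mu> (nbhd \<Sigma> (ennreal (a * \<delta>)) \<inter> ball z (b * u))"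
      by (rule emeasure_mono[OF sub]) (simp add: mass_measure_def nbhd_borel sets.Int)
    also have "\<dots> \<le> ennreal (C ^ 3 * (a * \<delta>) * (b * u) ^ (d - 1))"
      using a dl by (intro mass_tube q(1) adbu bu) simp
    also have "C ^ 3 * (a * \<delta>) * (b * u) ^ (d - 1) = K * (\<delta> / u) * ((u / 4) ^ d / C\<^sup>2)"
    proof -
      have "u ^ d = u * u ^ (d - 1)" using d_pos by (cases d) auto
      moreover have "C ^ 5 = C ^ 3 * C\<^sup>2" by (simp flip: power_add)
      ultimately show ?thesis using C u by (simp add: K_def power_divide power_mult_distrib field_simps)
    qed
    also have "ennreal \<dots> = ennreal (K * (\<delta> / u)) * ennreal ((u / 4) ^ d / C\<^sup>2)"
      using K dl u C by (intro ennreal_mult) auto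
    also have "\<dots> \<le> ennreal (K * (\<delta> / u)) * emeasure \<mu> ?X"
    proof (rule mult_left_mono)
      \<comment> \<open>A ball of radius u/4 around a point of S within u/4 of x stays within u/2 of
        x. Since u/2 is at most the larger of r and \<delta>, it lies in the ball itself or in its
        11\<delta>-neighbourhood.\<close>
      obtain y where y: "y \<in> S" "dist x y < u / 4" using support_near_S[OF x, of "u / 4"] u by auto
      have "ball y (u / 4) \<subseteq> ?X"
      proof
        fix v assume "v \<in> ball y (u / 4)"
        then have xv: "dist x v < u / 2" using y dist_triangle[of x v y] by simp
        show "v \<in> ?X"
        proof (cases "\<delta> \<le> r")
          case True
          then have "v \<in> ball x r" using xv by (simp add: u_def)
          then show ?thesis using dl by (auto simp: mem_nbhd_iff intro!: bexI[of _ v])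
        next
          case False
          then have "dist x v < 11 * \<delta>" using xv dl by (simp add: u_def)
          then show ?thesis using dl r by (auto simp: mem_nbhd_iff intro!: bexI[of _ x])
        qed
      qed
      then have "emeasure \<mu> (ball y (u / 4)) \<le> emeasure \<mu> ?X"
        by (rule emeasure_mono) (simp add: mass_measure_def nbhd_borel)
      moreover have "ennreal ((u / 4) ^ d / C\<^sup>2) \<le> emeasure \<mu> (ball y (u / 4))"
        using u u_R by (intro mass_ball_lower y) auto
      ultimately show "ennreal ((u / 4) ^ d / C\<^sup>2) \<le> emeasure \<mu> ?X" by (rule order_trans[rotated])
    qed simp
    finally show ?thesis by (simp add: u_def)
  qed
  then show ?thesis using K t by blast
qed

text \<open>Balls of radius R/2 around points of \<Sigma> have mass bounded below, whereas the mass
  outside large balls tends to 0 because V is finite; so \<Sigma> is bounded.\<close>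

lemma compact_Sigma: "compact \<Sigma>"
proof -
  interpret fV: finite_measure V by (rule fin)
  have f: "fst \<in> borel_measurable V"
    by (rule varifold_measurable[OF vf]) (intro borel_measurable_continuous_onI continuous_intros)
  interpret fm: finite_measure \<mu> unfolding mass_measure_def by (rule fV.finite_measure_distr[OF f])
  have "bounded \<Sigma>"
  proof -
    let ?c = "(R / 2) ^ d / C\<^sup>2"
    have c: "0 < ?c" using R C by simp
    have "(\<lambda>n. emeasure \<mu> (- ball 0 (real n))) \<longlonglongrightarrow> emeasure \<mu> (\<Inter>n. - ball 0 (real n))"
    proof (rule Lim_emeasure_decseq)
      show "emeasure \<mu> (- ball 0 (real n)) \<noteq> \<infinity>" for n using fm.emeasure_finite by simp
    qed (auto simp: mass_measure_def decseq_def borel_closed)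
    moreover have "(\<Inter>n. - ball 0 (real n)) = ({} :: 'a set)"
    proof -
      have "x \<notin> (\<Inter>n. - ball 0 (real n))" for x :: 'a using reals_Archimedean2[of "norm x"] by auto
      then show ?thesis by blast
    qed
    ultimately have "(\<lambda>n. emeasure \<mu> (- ball 0 (real n))) \<longlonglongrightarrow> 0" by simp
    then have "\<forall>\<^sub>F n in sequentially. emeasure \<mu> (- ball 0 (real n)) < ennreal ?c"
      using c by (intro order_tendstoD) auto
    then obtain n where n: "emeasure \<mu> (- ball 0 (real n)) < ennreal ?c"
      unfolding eventually_sequentially by blast
    have "norm z \<le> real n + R / 2" if z: "z \<in> \<Sigma>" for z
    proof (rule ccontr)
      assume "\<not> norm z \<le> real n + R / 2"
      have "ball z (R / 2) \<subseteq> - ball 0 (real n)"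
      proof
        fix y assume "y \<in> ball z (R / 2)"
        then show "y \<in> - ball 0 (real n)"
          using \<open>\<not> norm z \<le> real n + R / 2\<close> norm_triangle_sub[of z y] by (simp add: dist_norm)
      qed
      then have "emeasure \<mu> (ball z (R / 2)) \<le> emeasure \<mu> (- ball 0 (real n))"
        by (rule emeasure_mono) (simp add: mass_measure_def borel_closed)
      moreover have "ennreal ?c \<le> emeasure \<mu> (ball z (R / 2))"
        using z Sigma_S R by (intro mass_ball_lower) auto
      ultimately show False using n by (meson leD order_trans)
    qed
    then show ?thesis by (auto simp: bounded_iff)
  qed
  then show ?thesis using closed_Sigma by (simp add: compact_eq_bounded_closed)
qed

text \<open>Finitely many balls of radius R/4 cover the compact \<Sigma>. Once a\<delta> < R/4, the
  tube is covered by the doubled balls, in each of which its mass is at most of order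
  \<delta>.\<close>

lemma mass_near_Sigma_global:
  assumes a: "1 \<le> a"
  shows "\<exists>K>0. \<exists>t>0. \<forall>\<delta>. 0 < \<delta> \<and> \<delta> < t \<longrightarrow> emeasure \<mu> (nbhd \<Sigma> (ennreal (a * \<delta>))) \<le> ennreal (K * \<delta>)"
proof -
  have "\<Sigma> \<subseteq> (\<Union>z\<in>\<Sigma>. ball z (R / 4))" using R by auto
  then obtain F where F: "F \<subseteq> \<Sigma>" "finite F" "\<Sigma> \<subseteq> (\<Union>z\<in>F. ball z (R / 4))"
    using compactE_image[OF compact_Sigma, of \<Sigma> "\<lambda>z. ball z (R / 4)"] by auto
  define c where "c = C ^ 3 * a * (R / 2) ^ (d - 1)"
  have c: "0 < c" using C a R by (simp add: c_def)
  define t where "t = R / (4 * a)"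
  have t: "0 < t" using R a by (simp add: t_def)
  \<comment> \<open>Adding 1 to the number of balls keeps the constant positive when \<Sigma> is
    empty.\<close>
  have "emeasure \<mu> (nbhd \<Sigma> (ennreal (a * \<delta>))) \<le> ennreal ((real (card F) + 1) * c * \<delta>)"
    if dl: "0 < \<delta>" "\<delta> < t" for \<delta>
  proof -
    have ad: "a * \<delta> < R / 4" using dl a by (simp add: t_def field_simps)
    have adp: "0 < a * \<delta>" using dl a by simp
    have "nbhd \<Sigma> (ennreal (a * \<delta>)) \<subseteq> (\<Union>z\<in>F. nbhd \<Sigma> (ennreal (a * \<delta>)) \<inter> ball z (R / 2))"
    proof
      fix y assume y: "y \<in> nbhd \<Sigma> (ennreal (a * \<delta>))"
      then obtain w where w: "w \<in> \<Sigma>" "dist w y < a * \<delta>" using adp by (auto simp: mem_nbhd_iff)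
      then obtain z where z: "z \<in> F" "dist z w < R / 4" using F(3) by auto
      have "y \<in> ball z (R / 2)" using w z ad dist_triangle[of z y w] by simp
      then show "y \<in> (\<Union>z\<in>F. nbhd \<Sigma> (ennreal (a * \<delta>)) \<inter> ball z (R / 2))" using y z by blast
    qed
    then have "emeasure \<mu> (nbhd \<Sigma> (ennreal (a * \<delta>))) \<le> emeasure \<mu> (\<Union>z\<in>F. nbhd \<Sigma> (ennreal (a * \<delta>)) \<inter> ball z (R / 2))"
      by (rule emeasure_mono) (use F(2) in \<open>auto simp: mass_measure_def nbhd_borel intro!: sets.finite_UN sets.Int\<close>)
    also have "\<dots> \<le> (\<Sum>z\<in>F. emeasure \<mu> (nbhd \<Sigma> (ennreal (a * \<delta>)) \<inter> ball z (R / 2)))"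
      by (rule emeasure_subadditive_finite[OF F(2)]) (auto simp: mass_measure_def nbhd_borel)
    also have "\<dots> \<le> (\<Sum>z\<in>F. ennreal (c * \<delta>))"
    proof (rule sum_mono)
      fix z assume "z \<in> F"
      then have "emeasure \<mu> (nbhd \<Sigma> (ennreal (a * \<delta>)) \<inter> ball z (R / 2)) \<le> ennreal (C ^ 3 * (a * \<delta>) * (R / 2) ^ (d - 1))"
        using F(1) ad adp R by (intro mass_tube) auto
      then show "emeasure \<mu> (nbhd \<Sigma> (ennreal (a * \<delta>)) \<inter> ball z (R / 2)) \<le> ennreal (c * \<delta>)"
        by (simp add: c_def mult_ac)
    qed
    also have "\<dots> = ennreal (real (card F) * (c * \<delta>))"
      using c dl by (simp add: ennreal_mult' ennreal_of_nat_eq_real_of_nat)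
    also have "\<dots> \<le> ennreal ((real (card F) + 1) * c * \<delta>)"
      using c dl by (intro ennreal_leI) (simp add: algebra_simps)
    finally show ?thesis .
  qed
  moreover have "0 < (real (card F) + 1) * c" using c by simp
  ultimately show ?thesis using t by blast
qed

text \<open>For \<delta> \<le> 1 and \<beta> \<le> 1 the linear term is dominated by \<delta> powr
  \<beta>, and 7 powr \<beta> by 7.\<close>

lemma oscillation_powr:
  assumes "0 < \<delta>" "7 * \<delta> < R" "\<delta> \<le> 1"
  shows "4 * \<delta> + C * (7 * \<delta>) powr \<beta> \<le> (4 + 7 * C) * \<delta> powr \<beta>"
proof -
  have "\<delta> powr 1 \<le> \<delta> powr \<beta>" using assms beta by (intro powr_mono') auto
  moreover have "7 powr \<beta> \<le> 7 powr (1::real)" using beta by (intro powr_mono) auto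
  then have "C * (7 * \<delta>) powr \<beta> \<le> C * (7 * \<delta> powr \<beta>)"
    using C assms by (intro mult_left_mono) (auto simp: powr_mult intro!: mult_right_mono)
  ultimately show ?thesis using assms by (simp add: algebra_simps)
qed

end

section \<open>Regular part, singular tube and coarse meshes combined\<close>

context piecewise_regular
begin

text \<open>\<open>K\<close> and \<open>t\<close> are quantified before the discretisation, so they
  are uniform in the mesh and in the kind of discrete varifold. For \<delta> < t the oscillation
  bound is used, its tube term being turned into \<delta>/(r + \<delta>) or \<delta>/t; for \<delta>
  \<ge> t the trivial bound suffices.\<close>

lemma discretization_bounds:
  "\<exists>K>0. \<exists>t>0. \<forall>L s pr P \<delta>. discretization d V L s pr P \<delta> \<longrightarrow>
    (\<forall>x\<in>measure_support \<mu>. \<forall>r. 0 < r \<and> r < t \<longrightarrow>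
      bounded_lipschitz_dist d (ball x r) (discretization.discretized d V s pr P) V \<le>
        ennreal (K * (\<delta> powr \<beta> + \<delta> / (r + \<delta>))) * emeasure \<mu> (nbhd (ball x r) (ennreal (11 * \<delta>)))) \<and>
    bounded_lipschitz_dist d UNIV (discretization.discretized d V s pr P) V \<le>
      ennreal (K * (\<delta> powr \<beta> + \<delta> / t)) * emeasure \<mu> UNIV"
proof -
  define a where "a = 14 * C"
  have a: "1 \<le> a" using C by (simp add: a_def)
  obtain K1 t1 where K1: "0 < K1" "0 < t1" and loc:
    "\<And>x r \<delta>. x \<in> measure_support \<mu> \<Longrightarrow> 0 < r \<Longrightarrow> r < t1 \<Longrightarrow> 0 < \<delta> \<Longrightarrow> \<delta> < t1 \<Longrightarrow>
      emeasure \<mu> (nbhd \<Sigma> (ennreal (a * \<delta>)) \<inter> nbhd (ball x r) (ennreal (11 * \<delta>)))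
      \<le> ennreal (K1 * (\<delta> / (r + \<delta>))) * emeasure \<mu> (nbhd (ball x r) (ennreal (11 * \<delta>)))"
    using mass_near_Sigma_local[OF a] by blast
  obtain K2 t2 where K2: "0 < K2" "0 < t2" and glob:
    "\<And>\<delta>. 0 < \<delta> \<Longrightarrow> \<delta> < t2 \<Longrightarrow> emeasure \<mu> (nbhd \<Sigma> (ennreal (a * \<delta>))) \<le> ennreal (K2 * \<delta>)"
    using mass_near_Sigma_global[OF a] by blast
  interpret fV: finite_measure V by (rule fin)
  have f: "fst \<in> borel_measurable V"
    by (rule varifold_measurable[OF vf]) (intro borel_measurable_continuous_onI continuous_intros)
  interpret fm: finite_measure \<mu> unfolding mass_measure_def by (rule fV.finite_measure_distr[OF f])
  define m where "m = measure \<mu> UNIV"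
  have m: "emeasure \<mu> UNIV = ennreal m" "0 \<le> m" by (simp_all add: m_def fm.emeasure_eq_measure)
  \<comment> \<open>Below \<open>t\<close> both estimates near \<Sigma> apply, 7\<delta> is an
    admissible radius for the oscillation, and \<delta> \<le> 1.\<close>
  define t where "t = min (min t1 t2) (min 1 (R / 7))"
  have t: "0 < t" "t \<le> t1" "t \<le> t2" "t \<le> 1" "7 * t \<le> R" using K1 K2 R by (auto simp: t_def)
  \<comment> \<open>The summands pay for the regular part, for the local tube, for K \<delta> powr
    \<beta> \<ge> 3 when \<delta> \<ge> t, and for rewriting 3 K2 \<delta> as a multiple of
    (\<delta>/t) m. For m = 0 the last one is 0 by the convention on division, and that case is
    settled by the trivial bound.\<close>
  define K where "K = 4 + 7 * C + 3 * K1 + 3 * t powr (- \<beta>) + 3 * K2 * t / m"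
  have Kparts: "0 \<le> 3 * K1" "0 \<le> 3 * t powr (- \<beta>)" "0 \<le> 3 * K2 * t / m" "0 \<le> 7 * C"
    using K1 K2 t m C by auto
  then have K: "0 < K" "4 + 7 * C \<le> K" "3 * K1 \<le> K" "3 * t powr (- \<beta>) \<le> K" "3 * K2 * t / m \<le> K"
    unfolding K_def by linarith+
  have "(\<forall>x\<in>measure_support \<mu>. \<forall>r. 0 < r \<and> r < t \<longrightarrow>
      bounded_lipschitz_dist d (ball x r) (discretization.discretized d V s pr P) V \<le>
        ennreal (K * (\<delta> powr \<beta> + \<delta> / (r + \<delta>))) * emeasure \<mu> (nbhd (ball x r) (ennreal (11 * \<delta>)))) \<and>
    bounded_lipschitz_dist d UNIV (discretization.discretized d V s pr P) V \<le>
      ennreal (K * (\<delta> powr \<beta> + \<delta> / t)) * emeasure \<mu> UNIV"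
    if "discretization d V L s pr P \<delta>" for L s pr P \<delta>
  proof -
    interpret D: discretization d V L s pr P \<delta> by (rule that)
    note dl = D.delta_pos
    have UN: "nbhd UNIV (ennreal (11 * \<delta>)) = (UNIV :: 'a set)" using dl by (intro nbhd_UNIV) simp
    show ?thesis
    proof (cases "\<delta> < t")
      case False
      have "t powr \<beta> \<le> \<delta> powr \<beta>" using False t beta by (intro powr_mono2) auto
      then have "3 * t powr (- \<beta>) * t powr \<beta> \<le> K * \<delta> powr \<beta>"
        using K by (intro mult_mono) auto
      moreover have "t powr (- \<beta>) * t powr \<beta> = 1" using t by (simp flip: powr_add)
      ultimately have "3 \<le> K * \<delta> powr \<beta>" by (simp add: mult.assoc)
      also have "\<dots> \<le> K * (\<delta> powr \<beta> + q)" if "0 \<le> q" for q using that K by (intro mult_left_mono) auto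
      finally have three: "3 \<le> ennreal (K * (\<delta> powr \<beta> + q))" if "0 \<le> q" for q
        using that ennreal_leI by fastforce
      show ?thesis
      proof (intro conjI ballI allI impI)
        fix x r assume "x \<in> measure_support \<mu>" "0 < r \<and> r < t"
        then show "bounded_lipschitz_dist d (ball x r) D.discretized V \<le>
          ennreal (K * (\<delta> powr \<beta> + \<delta> / (r + \<delta>))) * emeasure \<mu> (nbhd (ball x r) (ennreal (11 * \<delta>)))"
          using dl by (intro order_trans[OF D.trivial_bound] mult_right_mono three) auto
      next
        show "bounded_lipschitz_dist d UNIV D.discretized V \<le> ennreal (K * (\<delta> powr \<beta> + \<delta> / t)) * emeasure \<mu> UNIV"
          using dl t order_trans[OF D.trivial_bound[of UNIV, unfolded UN] mult_right_mono[OF three]] by simp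
      qed
    next
      case True
      have R7: "7 * \<delta> < R" and d1: "\<delta> \<le> 1" using True t by linarith+
      let ?w = "C * (7 * \<delta>) powr \<beta>"
      have w: "0 \<le> ?w" using C by simp
      have osc: "tangent_oscillation d S \<theta> \<Sigma> C (7 * \<delta>) \<le> ennreal ?w"
        using dl R7 by (intro oscillation) auto
      note est = D.oscillation_bound[OF tg C w osc, folded a_def]
      have pw: "4 * \<delta> + ?w \<le> K * \<delta> powr \<beta>"
        using oscillation_powr[OF dl R7 d1] mult_right_mono[OF K(2), of "\<delta> powr \<beta>"] by simp
      have three: "(3 :: ennreal) = ennreal 3" by simp
      show ?thesis
      proof (intro conjI ballI allI impI)
        fix x r assume x: "x \<in> measure_support \<mu>" and r: "0 < r \<and> r < t"
        let ?X = "emeasure \<mu> (nbhd (ball x r) (ennreal (11 * \<delta>)))"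
        have q: "0 \<le> \<delta> / (r + \<delta>)" using r dl by simp
        have "bounded_lipschitz_dist d (ball x r) D.discretized V
            \<le> ennreal (4 * \<delta> + ?w) * ?X + ennreal 3 * (ennreal (K1 * (\<delta> / (r + \<delta>))) * ?X)"
          using loc[OF x, of r \<delta>] r dl True t
          by (intro order_trans[OF est] add_left_mono) (auto intro!: mult_left_mono simp: a_def)
        also have "\<dots> = ennreal (4 * \<delta> + ?w + 3 * (K1 * (\<delta> / (r + \<delta>)))) * ?X"
          using dl w q K1 by (simp add: ennreal_plus ennreal_mult distrib_right mult.assoc del: times_divide_eq_right)
        also have "\<dots> \<le> ennreal (K * (\<delta> powr \<beta> + \<delta> / (r + \<delta>))) * ?X"
          using pw mult_right_mono[OF K(3) q]
          by (intro mult_right_mono ennreal_leI) (simp_all add: distrib_left mult.assoc)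
        finally show "bounded_lipschitz_dist d (ball x r) D.discretized V
          \<le> ennreal (K * (\<delta> powr \<beta> + \<delta> / (r + \<delta>))) * ?X" .
      next
        show "bounded_lipschitz_dist d UNIV D.discretized V \<le> ennreal (K * (\<delta> powr \<beta> + \<delta> / t)) * emeasure \<mu> UNIV"
        proof (cases "m = 0")
          case True
          then show ?thesis using D.trivial_bound[of UNIV] by (simp add: UN m)
        next
          case False
          then have mp: "0 < m" using m by simp
          have "bounded_lipschitz_dist d UNIV D.discretized V \<le> ennreal (4 * \<delta> + ?w) * ennreal m + ennreal 3 * ennreal (K2 * \<delta>)"
            using glob[of \<delta>] dl \<open>\<delta> < t\<close> t
            by (intro order_trans[OF est[of UNIV, unfolded UN m Int_UNIV_right]] add_left_mono) (auto intro!: mult_left_mono simp: a_def)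
          also have "\<dots> = ennreal ((4 * \<delta> + ?w) * m + 3 * (K2 * \<delta>))"
            using dl w m K2 by (simp add: ennreal_plus ennreal_mult)
          also have "\<dots> \<le> ennreal (K * (\<delta> powr \<beta> + \<delta> / t) * m)"
          proof (rule ennreal_leI)
            have "3 * (K2 * \<delta>) = (3 * K2 * t / m) * (\<delta> / t * m)" using mp t by simp
            also have "\<dots> \<le> K * (\<delta> / t * m)" using K mp t dl by (intro mult_right_mono) auto
            finally show "(4 * \<delta> + ?w) * m + 3 * (K2 * \<delta>) \<le> K * (\<delta> powr \<beta> + \<delta> / t) * m"
              using mult_right_mono[OF pw m(2)] by (simp add: algebra_simps)
          qed
          also have "\<dots> = ennreal (K * (\<delta> powr \<beta> + \<delta> / t)) * emeasure \<mu> UNIV"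
            using K dl t by (simp add: m ennreal_mult)
          finally show ?thesis .
        qed
      qed
    qed
  qed
  then show ?thesis using K(1) t(1) by blast
qed

end

lemma piecewise_C1_regular:
  fixes V :: "('a::euclidean_space \<times> ('a \<Rightarrow>\<^sub>L 'a)) measure"
  assumes "1 \<le> d" and pc: "piecewise_C1 d \<beta> V" and beta: "0 < \<beta>" "\<beta> \<le> 1"
    and fin: "emeasure (mass_measure V) UNIV < \<infinity>"
  shows "\<exists>S \<theta> R C \<Sigma> S' T N. piecewise_regular d V S \<theta> R C \<beta> \<Sigma> S' T N"
proof -
  obtain S \<theta> R C \<Sigma> where rect: "rectifiable_varifold d S \<theta> V"
    and R: "R > 0" "C \<ge> 1" "closed \<Sigma>" "\<Sigma> \<subseteq> S"
    and a: "\<forall>x\<in>S. \<forall>r. 0 < r \<and> r < R \<longrightarrow>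
           ennreal (r ^ d / C) \<le> hausdorff_outer d (S \<inter> ball x r) \<and>
           hausdorff_outer d (S \<inter> ball x r) \<le> ennreal (C * r ^ d)"
    and b: "\<forall>z\<in>\<Sigma>. \<forall>r. 0 < r \<and> r < R \<longrightarrow>
           ennreal (r ^ (d - 1) / C) \<le> hausdorff_outer (d - 1) (\<Sigma> \<inter> ball z r) \<and>
           hausdorff_outer (d - 1) (\<Sigma> \<inter> ball z r) \<le> ennreal (C * r ^ (d - 1))"
    and c: "\<forall>r. 0 < r \<and> r < R \<longrightarrow> tangent_oscillation d S \<theta> \<Sigma> C r \<le> ennreal (C * r powr \<beta>)"
    and tube: "\<forall>r \<epsilon>. 0 < r \<and> r < \<epsilon> \<and> \<epsilon> < R \<longrightarrow> (\<forall>z\<in>\<Sigma>.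
           ennreal (r / C) * hausdorff_outer (d - 1) (\<Sigma> \<inter> ball z \<epsilon>)
             \<le> hausdorff_outer d (S \<inter> nbhd \<Sigma> (ennreal r) \<inter> ball z \<epsilon>) \<and>
           hausdorff_outer d (S \<inter> nbhd \<Sigma> (ennreal r) \<inter> ball z \<epsilon>)
             \<le> ennreal (C * r) * hausdorff_outer (d - 1) (\<Sigma> \<inter> ball z \<epsilon>))"
    and e: "AE x in restrict_space (hausdorff_measure d) S. 1 / C \<le> \<theta> x \<and> \<theta> x \<le> C"
    using pc unfolding piecewise_C1_def by (elim exE conjE) (rule that)
  obtain S' T N where tg: "tangent_graph d S \<theta> V S' T N"
    using rectifiable_varifold_graph[OF rect fin] by blast
  have vf: "varifold d V" and S: "S \<in> sets (hausdorff_measure d)"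
    using rect by (auto simp: rectifiable_varifold_def countably_rectifiable_def)
  have "piecewise_regular d V S \<theta> R C \<beta> \<Sigma> S' T N"
  proof (rule piecewise_regular.intro)
    show "1 \<le> d" by fact
    show "varifold d V" by fact
    show "finite_measure V" by (rule varifold_mass_finite[OF vf fin])
    show "tangent_graph d S \<theta> V S' T N" by fact
    show "S \<in> sets (hausdorff_measure d)" by fact
    show "0 < R" "1 \<le> C" "0 < \<beta>" "\<beta> \<le> 1" "closed \<Sigma>" "\<Sigma> \<subseteq> S" using R beta by auto
    show "AE x in restrict_space (hausdorff_measure d) S. 1 / C \<le> \<theta> x \<and> \<theta> x \<le> C" by fact
  qed (use a b c tube in blast)+
  then show ?thesis by blast
qed

section \<open>Sequences of discretisations\<close>

text \<open>Only sizes matter: a new mesh is a grid of size at most min \<delta>_i (1/(i+1)) and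
  need not refine \<open>\<K> i\<close> as a partition. Positivity of mesh sizes leaves room for
  such a grid.\<close>

lemma mesh_sequence_exists:
  fixes \<K> :: "nat \<Rightarrow> (real ^ 'n) set set"
  assumes m: "\<And>i. mesh (\<K> i)"
  shows "\<exists>\<L>. (\<forall>i. mesh (\<L> i) \<and> mesh_size (\<L> i) \<le> mesh_size (\<K> i)) \<and>
    (\<lambda>i. mesh_size (\<L> i)) \<longlonglongrightarrow> 0 \<and> ((\<lambda>i. mesh_size (\<K> i)) \<longlonglongrightarrow> 0 \<longrightarrow> \<L> = \<K>)"
proof (cases "(\<lambda>i. mesh_size (\<K> i)) \<longlonglongrightarrow> 0")
  case True
  then show ?thesis using m by (intro exI[of _ \<K>]) auto
next
  case False
  have "\<exists>\<L> :: (real ^ 'n) set set. mesh \<L> \<and> mesh_size \<L> \<le> mesh_size (\<K> i) \<and>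
      mesh_size \<L> \<le> ennreal (inverse (real (Suc i)))" for i
  proof -
    define v where "v = min (mesh_size (\<K> i)) (ennreal (inverse (real (Suc i))))"
    have "0 < v" using mesh_size_pos[OF m] by (simp add: v_def)
    moreover have "v < \<infinity>" by (simp add: v_def min_less_iff_disj)
    ultimately obtain e where e: "0 < e" "v = ennreal e" by (cases v) auto
    from fine_mesh_exists[OF e(1)] show ?thesis unfolding e(2)[symmetric] by (simp add: v_def)
  qed
  then obtain \<L> :: "nat \<Rightarrow> (real ^ 'n) set set" where L: "\<And>i. mesh (\<L> i)" "\<And>i. mesh_size (\<L> i) \<le> mesh_size (\<K> i)"
    "\<And>i. mesh_size (\<L> i) \<le> ennreal (inverse (real (Suc i)))"
    by metis
  have "(\<lambda>i. ennreal (inverse (real (Suc i)))) \<longlonglongrightarrow> 0"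
    using LIMSEQ_inverse_real_of_nat by (simp add: tendsto_ennrealI flip: ennreal_0)
  then have "(\<lambda>i. mesh_size (\<L> i)) \<longlonglongrightarrow> 0"
    by (rule tendsto_sandwich[OF _ _ tendsto_const, rotated 2]) (simp_all add: L(3) del: of_nat_Suc)
  then show ?thesis using L False by (intro exI[of _ \<L>]) auto
qed

text \<open>For a mesh of infinite size the error bounds are void, and the zero varifold serves.\<close>

definition approximant ::
  "nat \<Rightarrow> ('a::euclidean_space \<times> ('a \<Rightarrow>\<^sub>L 'a)) measure \<Rightarrow> 'a set set \<Rightarrow>
    ('a \<times> ('a \<Rightarrow>\<^sub>L 'a)) measure \<Rightarrow> bool" where
  "approximant d V L W \<longleftrightarrow>
     (if mesh_size L = \<infinity> then W = null_measure (grassmann_borel d)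
      else \<exists>s pr P. discretization d V L s pr P (enn2real (mesh_size L)) \<and>
        W = discretization.discretized d V s pr P)"

lemma approximant_exists:
  fixes V :: "('a::euclidean_space \<times> ('a \<Rightarrow>\<^sub>L 'a)) measure"
  assumes vf: "varifold d V" and fin: "finite_measure V" and dim: "d \<le> DIM('a)" and m: "mesh L"
    and kind: "is_discrete \<in> {volumetric_varifold d, point_cloud_varifold d}"
  shows "\<exists>W. is_discrete L W \<and> approximant d V L W"
proof (cases "mesh_size L = \<infinity>")
  case True
  then show ?thesis using zero_discretization[OF m dim kind] by (auto simp: approximant_def)
next
  case False
  then have size: "mesh_size L = ennreal (enn2real (mesh_size L))" by (simp add: less_top)
  have pos: "0 < enn2real (mesh_size L)"
    using mesh_size_pos[OF m] False by (simp add: enn2real_positive_iff less_top)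
  show ?thesis
    using volumetric_discretization[OF vf fin dim m size pos] point_cloud_discretization[OF vf fin dim m size pos]
      kind False unfolding approximant_def by auto
qed

text \<open>Serves the bounds whose coefficient is infinite: when V has mass 0 the product is 0, so
  the distance itself has to vanish, also for the zero varifold.\<close>

lemma approximant_mass_bound:
  assumes vf: "varifold d V" and fin: "finite_measure V" and m: "mesh L" and W: "approximant d V L W"
  shows "bounded_lipschitz_dist d UNIV W V \<le> 3 * emeasure (mass_measure V) UNIV"
proof (cases "mesh_size L = \<infinity>")
  case False
  then obtain s pr P where D: "discretization d V L s pr P (enn2real (mesh_size L))"
    "W = discretization.discretized d V s pr P" using W by (auto simp: approximant_def)
  interpret D: discretization d V L s pr P "enn2real (mesh_size L)" by (rule D(1))
  show ?thesis using D.trivial_bound[of UNIV] D.delta_pos by (simp add: D(2) nbhd_UNIV)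
next
  case True
  then have W: "W = null_measure (grassmann_borel d)" using W by (simp add: approximant_def)
  interpret fV: finite_measure V by (rule fin)
  have mass: "emeasure (mass_measure V) UNIV = emeasure V (space V)"
    using emeasure_mass_measure[OF vf, of UNIV] by (simp add: varifold_space[OF vf])
  show ?thesis
    unfolding bounded_lipschitz_dist_def
  proof (rule SUP_least)
    fix \<phi> assume phi: "\<phi> \<in> test_functions_Lip d (UNIV :: 'a set)"
    have mg: "\<phi> \<in> borel_measurable (grassmann_borel d)" by (rule test_function_measurable[OF phi])
    then have mV: "\<phi> \<in> borel_measurable V"
      using measurable_cong_sets[OF varifold_sets[OF vf] refl] by blast
    have b: "\<bar>\<phi> z\<bar> \<le> 1" if "z \<in> space V" for z
      using phi that by (auto simp: test_functions_Lip_def varifold_space[OF vf])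
    have i: "integrable V \<phi>"
      using b by (intro fV.integrable_const_bound[of _ 1] mV AE_I2) simp
    have z: "integrable W \<phi>" "(\<integral>p. \<phi> p \<partial>W) = 0"
      using mg by (auto simp: W integrable_null_measure_iff)
    have "\<bar>\<integral>p. \<phi> p \<partial>V\<bar> \<le> (\<integral>p. \<bar>\<phi> p\<bar> \<partial>V)" by (rule integral_abs_bound)
    also have "\<dots> \<le> (\<integral>p. 1 \<partial>V)" using i b by (intro integral_mono) auto
    finally have "ennreal \<bar>(\<integral>p. \<phi> p \<partial>W) - (\<integral>p. \<phi> p \<partial>V)\<bar> \<le> emeasure V (space V)"
      by (simp add: z fV.emeasure_eq_measure ennreal_leI)
    also have "\<dots> \<le> 3 * emeasure V (space V)"
      using mult_right_mono[of 1 "3 :: ennreal" "emeasure V (space V)"] by simp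
    finally show "(if integrable W \<phi> \<and> integrable V \<phi>
        then ennreal \<bar>(\<integral>p. \<phi> p \<partial>W) - (\<integral>p. \<phi> p \<partial>V)\<bar> else \<infinity>) \<le> 3 * emeasure (mass_measure V) UNIV"
      using i z by (simp add: mass)
  qed
qed

text \<open>Sizes tending to 0 are eventually finite and below the threshold that uniform continuity
  on a single compact graph prescribes.\<close>

lemma approximants_converge:
  fixes V :: "('a::euclidean_space \<times> ('a \<Rightarrow>\<^sub>L 'a)) measure"
  assumes rect: "rectifiable_varifold d M \<theta> V" and fin: "emeasure (mass_measure V) UNIV < \<infinity>"
    and m: "\<And>i. mesh (\<L> i)" and lim: "(\<lambda>i. mesh_size (\<L> i)) \<longlonglongrightarrow> 0"
    and W: "\<And>i. approximant d V (\<L> i) (W i)"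
  shows "(\<lambda>i. bounded_lipschitz_dist d UNIV (W i) V) \<longlonglongrightarrow> 0"
proof (rule order_tendstoI)
  fix a :: ennreal assume "0 < a"
  then obtain b where b: "0 < b" "b < a" using dense by blast
  then obtain c where c: "b = ennreal c" "0 < c" by (cases b) (auto simp: top_unique less_top[symmetric])
  have vf: "varifold d V" using rect by (simp add: rectifiable_varifold_def)
  interpret fV: finite_measure V by (rule varifold_mass_finite[OF vf fin])
  \<comment> \<open>Chosen so that 2e times the mass plus 3e equals c; the 3 also keeps the
    denominator positive when V has no mass.\<close>
  define e where "e = c / (2 * measure V (space V) + 3)"
  have e: "0 < e" using c by (simp add: e_def divide_pos_pos add_nonneg_pos)
  obtain Q where Q: "compact Q" "inj_on fst Q"
    "emeasure V (space V - Q) \<le> ennreal e"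
    using rectifiable_varifold_compact_graph[OF rect fin e] by blast
  obtain \<eta> where eta: "\<eta> > 0"
    "\<And>p q. p \<in> Q \<Longrightarrow> q \<in> Q \<Longrightarrow> dist (fst p) (fst q) < \<eta> \<Longrightarrow> dist (snd p) (snd q) < e"
    using compact_graph_uniformly_continuous[OF Q(1,2) e] by blast
  have "\<forall>\<^sub>F i in sequentially. mesh_size (\<L> i) < ennreal (min (e / 4) (\<eta> / 6))"
    using lim e eta by (intro order_tendstoD) auto
  then show "\<forall>\<^sub>F i in sequentially. bounded_lipschitz_dist d UNIV (W i) V < a"
  proof eventually_elim
    fix i assume small: "mesh_size (\<L> i) < ennreal (min (e / 4) (\<eta> / 6))"
    then have fs: "mesh_size (\<L> i) \<noteq> \<infinity>" by auto
    define \<delta> where "\<delta> = enn2real (mesh_size (\<L> i))"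
    have "mesh_size (\<L> i) = ennreal \<delta>" using fs by (simp add: \<delta>_def less_top)
    then have "ennreal \<delta> < ennreal (min (e / 4) (\<eta> / 6))" using small by simp
    moreover have "0 \<le> \<delta>" by (simp add: \<delta>_def)
    ultimately have "\<delta> < min (e / 4) (\<eta> / 6)" by (simp only: ennreal_less_iff)
    then have dl: "4 * \<delta> \<le> e" "6 * \<delta> < \<eta>" by auto
    obtain s pr P where D: "discretization d V (\<L> i) s pr P \<delta>" "W i = discretization.discretized d V s pr P"
      using W[of i] fs by (auto simp: approximant_def \<delta>_def)
    interpret D: discretization d V "\<L> i" s pr P \<delta> by (rule D(1))
    have "bounded_lipschitz_dist d UNIV (W i) V \<le> ennreal (2 * e) * emeasure V (space V) + 3 * ennreal e"
      unfolding D(2) by (rule D.compact_graph_bound[OF compact_imp_closed[OF Q(1)] e dl eta(2) Q(3)])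
    also have "\<dots> = ennreal (2 * e) * ennreal (measure V (space V)) + ennreal 3 * ennreal e"
      by (simp add: fV.emeasure_eq_measure)
    also have "\<dots> = ennreal (2 * e * measure V (space V) + 3 * e)"
      using e by (simp add: ennreal_plus ennreal_mult del: ennreal_numeral)
    also have "2 * e * measure V (space V) + 3 * e = e * (2 * measure V (space V) + 3)"
      by (simp add: algebra_simps)
    also have "\<dots> = c" unfolding e_def by (simp add: add_nonneg_eq_0_iff)
    finally show "bounded_lipschitz_dist d UNIV (W i) V < a" using b c by simp
  qed
qed simp

section \<open>Bounds in terms of the sizes of the given meshes\<close>

lemma nbhd_mono: "r \<le> t \<Longrightarrow> nbhd A r \<subseteq> nbhd A t"
  by (auto simp: nbhd_def intro: less_le_trans)

text \<open>D stands for the size of the given mesh, L for the possibly finer mesh in use. The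
  right-hand sides increase with D, so bounds at the true size imply those at D, with constants
  uniform in both.\<close>

lemma approximant_regular_bounds:
  fixes V :: "('a::euclidean_space \<times> ('a \<Rightarrow>\<^sub>L 'a)) measure"
  assumes d: "1 \<le> d" and pc: "piecewise_C1 d \<beta> V" and beta: "0 < \<beta>" "\<beta> \<le> 1"
    and vf: "varifold d V" and fin: "emeasure (mass_measure V) UNIV < \<infinity>"
  shows "\<exists>C>0. \<exists>R>0. \<forall>L W D. mesh L \<and> approximant d V L W \<and> mesh_size L \<le> D \<longrightarrow>
    (\<forall>x r. x \<in> measure_support (mass_measure V) \<and> 0 < r \<and> r < R \<longrightarrow>
      bounded_lipschitz_dist d (ball x r) W V
        \<le> ennreal C * (ennreal_powr D \<beta> + D / (ennreal r + D))
          * emeasure (mass_measure V) (nbhd (ball x r) (ennreal C * D))) \<and>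
    bounded_lipschitz_dist d UNIV W V
      \<le> ennreal C * (ennreal_powr D \<beta> + D / ennreal R) * emeasure (mass_measure V) UNIV"
proof -
  let ?\<mu> = "mass_measure V"
  have fV: "finite_measure V" by (rule varifold_mass_finite[OF vf fin])
  obtain S \<theta> R C \<Sigma> S' T N where "piecewise_regular d V S \<theta> R C \<beta> \<Sigma> S' T N"
    using piecewise_C1_regular[OF d pc beta fin] by blast
  then interpret piecewise_regular d V S \<theta> R C \<beta> \<Sigma> S' T N .
  obtain K t where K: "0 < K" and t: "0 < t" and bounds: "\<And>L s pr P \<delta>. discretization d V L s pr P \<delta> \<Longrightarrow>
    (\<forall>x\<in>measure_support ?\<mu>. \<forall>r. 0 < r \<and> r < t \<longrightarrow>
      bounded_lipschitz_dist d (ball x r) (discretization.discretized d V s pr P) V \<le>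
        ennreal (K * (\<delta> powr \<beta> + \<delta> / (r + \<delta>))) * emeasure ?\<mu> (nbhd (ball x r) (ennreal (11 * \<delta>)))) \<and>
    bounded_lipschitz_dist d UNIV (discretization.discretized d V s pr P) V \<le>
      ennreal (K * (\<delta> powr \<beta> + \<delta> / t)) * emeasure ?\<mu> UNIV"
    using discretization_bounds by blast
  \<comment> \<open>11 serves the radius of the neighbourhood, \<open>K\<close> the
    coefficient.\<close>
  define C' where "C' = max K 11"
  have C': "0 < C'" "K \<le> C'" "11 \<le> C'" by (auto simp: C'_def)
  have "(\<forall>x r. x \<in> measure_support ?\<mu> \<and> 0 < r \<and> r < t \<longrightarrow>
      bounded_lipschitz_dist d (ball x r) W V
        \<le> ennreal C' * (ennreal_powr D \<beta> + D / (ennreal r + D))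
          * emeasure ?\<mu> (nbhd (ball x r) (ennreal C' * D))) \<and>
    bounded_lipschitz_dist d UNIV W V
      \<le> ennreal C' * (ennreal_powr D \<beta> + D / ennreal t) * emeasure ?\<mu> UNIV"
    if m: "mesh L" and W: "approximant d V L W" and le: "mesh_size L \<le> D" for L W D
  proof (cases "D = \<infinity>")
    case True
    have top: "ennreal C' * (ennreal_powr D \<beta> + q) = \<infinity>" for q
      using C' True by (simp add: ennreal_powr_def ennreal_mult_eq_top_iff)
    show ?thesis
    proof (intro conjI allI impI)
      fix x r assume x: "x \<in> measure_support ?\<mu> \<and> 0 < r \<and> r < t"
      have "ball x r \<subseteq> nbhd (ball x r) (ennreal C' * D)"
        using C' True by (auto simp: nbhd_def ennreal_mult_eq_top_iff)
      then have "emeasure ?\<mu> (ball x r) \<le> emeasure ?\<mu> (nbhd (ball x r) (ennreal C' * D))"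
        by (rule emeasure_mono) (simp add: mass_measure_def nbhd_borel)
      \<comment> \<open>In \<open>ennreal\<close> 0 times infinity is 0, so an infinite coefficient
        alone gives no bound; the centre lies in the support, which makes the mass positive.\<close>
      moreover have "0 < emeasure ?\<mu> (ball x r)" using x by (simp add: measure_support_def)
      ultimately have "emeasure ?\<mu> (nbhd (ball x r) (ennreal C' * D)) \<noteq> 0" by auto
      then show "bounded_lipschitz_dist d (ball x r) W V
        \<le> ennreal C' * (ennreal_powr D \<beta> + D / (ennreal r + D))
          * emeasure ?\<mu> (nbhd (ball x r) (ennreal C' * D))"
        unfolding top by (simp add: ennreal_top_mult)
    next
      show "bounded_lipschitz_dist d UNIV W V
          \<le> ennreal C' * (ennreal_powr D \<beta> + D / ennreal t) * emeasure ?\<mu> UNIV"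
        using approximant_mass_bound[OF vf fV m W] unfolding top
        by (cases "emeasure ?\<mu> UNIV = 0") (simp_all add: ennreal_top_mult)
    qed
  next
    case False
    then obtain D' where D': "D = ennreal D'" "0 \<le> D'" by (cases D) auto
    have fs: "mesh_size L \<noteq> \<infinity>" using le False by (auto simp: top_unique)
    define \<delta> where "\<delta> = enn2real (mesh_size L)"
    have "mesh_size L = ennreal \<delta>" using fs by (simp add: \<delta>_def less_top)
    then have dD: "\<delta> \<le> D'" using le D' by simp
    obtain s pr P where disc: "discretization d V L s pr P \<delta>" and
      Weq: "W = discretization.discretized d V s pr P"
      using W fs by (auto simp: approximant_def \<delta>_def)
    have dl: "0 < \<delta>" using disc by (rule discretization.delta_pos)
    have pw: "\<delta> powr \<beta> \<le> D' powr \<beta>" using dl dD beta by (intro powr_mono2) auto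
    have coeff: "ennreal (K * (\<delta> powr \<beta> + q)) \<le> ennreal C' * (ennreal_powr D \<beta> + Q)"
      if "0 \<le> q" "q \<le> q'" "ennreal q' = Q" for q q' Q
    proof -
      have "K * (\<delta> powr \<beta> + q) \<le> C' * (D' powr \<beta> + q')"
        using C' K pw that by (intro mult_mono add_mono) auto
      then have "ennreal (K * (\<delta> powr \<beta> + q)) \<le> ennreal (C' * (D' powr \<beta> + q'))" by (rule ennreal_leI)
      also have "\<dots> = ennreal C' * (ennreal_powr D \<beta> + Q)"
        using C' that D' by (auto simp: ennreal_powr_def ennreal_mult ennreal_plus)
      finally show ?thesis .
    qed
    show ?thesis
    proof (intro conjI allI impI)
      fix x r assume x: "x \<in> measure_support ?\<mu> \<and> 0 < r \<and> r < t"
      have "\<delta> / (r + \<delta>) \<le> D' / (r + D')"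
        using dl dD x by (simp add: frac_le_eq divide_simps algebra_simps)
      moreover have "ennreal (D' / (r + D')) = D / (ennreal r + D)"
        using D' x by (simp add: divide_ennreal flip: ennreal_plus)
      ultimately have c: "ennreal (K * (\<delta> powr \<beta> + \<delta> / (r + \<delta>))) \<le> ennreal C' * (ennreal_powr D \<beta> + D / (ennreal r + D))"
        using dl x by (intro coeff) auto
      have "ennreal (11 * \<delta>) \<le> ennreal (C' * D')" using C' dl dD by (intro ennreal_leI mult_mono) auto
      also have "\<dots> = ennreal C' * D" using C' D' by (simp add: ennreal_mult)
      finally have "emeasure ?\<mu> (nbhd (ball x r) (ennreal (11 * \<delta>))) \<le> emeasure ?\<mu> (nbhd (ball x r) (ennreal C' * D))"
        by (intro emeasure_mono nbhd_mono) (simp_all add: mass_measure_def nbhd_borel)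
      with c have "ennreal (K * (\<delta> powr \<beta> + \<delta> / (r + \<delta>))) * emeasure ?\<mu> (nbhd (ball x r) (ennreal (11 * \<delta>)))
        \<le> ennreal C' * (ennreal_powr D \<beta> + D / (ennreal r + D)) * emeasure ?\<mu> (nbhd (ball x r) (ennreal C' * D))"
        by (rule mult_mono) simp_all
      then show "bounded_lipschitz_dist d (ball x r) W V
        \<le> ennreal C' * (ennreal_powr D \<beta> + D / (ennreal r + D))
          * emeasure ?\<mu> (nbhd (ball x r) (ennreal C' * D))"
        using bounds[OF disc] x unfolding Weq by (blast intro: order_trans)
    next
      have "ennreal (K * (\<delta> powr \<beta> + \<delta> / t)) \<le> ennreal C' * (ennreal_powr D \<beta> + D / ennreal t)"
      proof (rule coeff)
        show "0 \<le> \<delta> / t" "\<delta> / t \<le> D' / t" using dl dD t by (auto intro: divide_right_mono)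
        show "ennreal (D' / t) = D / ennreal t" using D' t by (simp add: divide_ennreal)
      qed
      then have "ennreal (K * (\<delta> powr \<beta> + \<delta> / t)) * emeasure ?\<mu> UNIV
          \<le> ennreal C' * (ennreal_powr D \<beta> + D / ennreal t) * emeasure ?\<mu> UNIV"
        by (rule mult_right_mono) simp
      then show "bounded_lipschitz_dist d UNIV W V
          \<le> ennreal C' * (ennreal_powr D \<beta> + D / ennreal t) * emeasure ?\<mu> UNIV"
        using bounds[OF disc] unfolding Weq by (blast intro: order_trans)
    qed
  qed
  then show ?thesis using C'(1) t by blast
qed

text \<open>The alternative between volumetric and point cloud varifolds is read as a claim for each
  kind separately.\<close>

theorem theorem6p4:
  fixes d :: nat
    and \<K> :: "nat \<Rightarrow> (real ^ 'n) set set"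
    and M :: "(real ^ 'n) set" and \<theta> :: "real ^ 'n \<Rightarrow> real"
    and V :: "((real ^ 'n) \<times> ((real ^ 'n) \<Rightarrow>\<^sub>L (real ^ 'n))) measure"
  assumes "1 \<le> d" and "d < CARD('n)"
    and "\<And>i. mesh (\<K> i)"
    and "rectifiable_varifold d M \<theta> V"
    and "emeasure (mass_measure V) UNIV < \<infinity>"
  shows "\<forall>is_discrete \<in> {volumetric_varifold d, point_cloud_varifold d}.
    \<exists>(\<L> :: nat \<Rightarrow> (real ^ 'n) set set) W.
      (\<forall>i. mesh (\<L> i) \<and> is_discrete (\<L> i) (W i)) \<and>
      ((\<lambda>i. mesh_size (\<K> i)) \<longlonglongrightarrow> 0 \<longrightarrow> \<L> = \<K>) \<and>
      (\<lambda>i. bounded_lipschitz_dist d UNIV (W i) V) \<longlonglongrightarrow> 0 \<and>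
      (\<forall>\<beta>. 0 < \<beta> \<and> \<beta> \<le> 1 \<and> piecewise_C1 d \<beta> V \<longrightarrow>
        (\<exists>C>0. \<exists>R>0. \<forall>i.
          (\<forall>x r. x \<in> measure_support (mass_measure V) \<and> 0 < r \<and> r < R \<longrightarrow>
            bounded_lipschitz_dist d (ball x r) (W i) V
              \<le> ennreal C * (ennreal_powr (mesh_size (\<K> i)) \<beta>
                    + mesh_size (\<K> i) / (ennreal r + mesh_size (\<K> i)))
                * emeasure (mass_measure V) (nbhd (ball x r) (ennreal C * mesh_size (\<K> i)))) \<and>
          bounded_lipschitz_dist d UNIV (W i) V
            \<le> ennreal C * (ennreal_powr (mesh_size (\<K> i)) \<beta> + mesh_size (\<K> i) / ennreal R)
              * emeasure (mass_measure V) UNIV))"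
proof
  fix is_discrete :: "(real ^ 'n) set set \<Rightarrow> ((real ^ 'n) \<times> ((real ^ 'n) \<Rightarrow>\<^sub>L (real ^ 'n))) measure \<Rightarrow> bool"
  assume kind: "is_discrete \<in> {volumetric_varifold d, point_cloud_varifold d}"
  have vf: "varifold d V" using assms(4) by (simp add: rectifiable_varifold_def)
  have fV: "finite_measure V" by (rule varifold_mass_finite[OF vf assms(5)])
  have dim: "d \<le> DIM(real ^ 'n)" using assms(2) by simp
  obtain \<L> where L: "\<And>i. mesh (\<L> i)" "\<And>i. mesh_size (\<L> i) \<le> mesh_size (\<K> i)"
    "(\<lambda>i. mesh_size (\<L> i)) \<longlonglongrightarrow> 0" "(\<lambda>i. mesh_size (\<K> i)) \<longlonglongrightarrow> 0 \<longrightarrow> \<L> = \<K>"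
    using mesh_sequence_exists[of \<K>] assms(3) by blast
  have "\<forall>i. \<exists>W. is_discrete (\<L> i) W \<and> approximant d V (\<L> i) W"
    using approximant_exists[OF vf fV dim L(1) kind] by blast
  then obtain W where W: "\<And>i. is_discrete (\<L> i) (W i)" "\<And>i. approximant d V (\<L> i) (W i)"
    by metis
  have lim: "(\<lambda>i. bounded_lipschitz_dist d UNIV (W i) V) \<longlonglongrightarrow> 0"
    by (rule approximants_converge[OF assms(4,5) L(1,3) W(2)])
  show "\<exists>(\<L> :: nat \<Rightarrow> (real ^ 'n) set set) W.
      (\<forall>i. mesh (\<L> i) \<and> is_discrete (\<L> i) (W i)) \<and>
      ((\<lambda>i. mesh_size (\<K> i)) \<longlonglongrightarrow> 0 \<longrightarrow> \<L> = \<K>) \<and>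
      (\<lambda>i. bounded_lipschitz_dist d UNIV (W i) V) \<longlonglongrightarrow> 0 \<and>
      (\<forall>\<beta>. 0 < \<beta> \<and> \<beta> \<le> 1 \<and> piecewise_C1 d \<beta> V \<longrightarrow>
        (\<exists>C>0. \<exists>R>0. \<forall>i.
          (\<forall>x r. x \<in> measure_support (mass_measure V) \<and> 0 < r \<and> r < R \<longrightarrow>
            bounded_lipschitz_dist d (ball x r) (W i) V
              \<le> ennreal C * (ennreal_powr (mesh_size (\<K> i)) \<beta>
                    + mesh_size (\<K> i) / (ennreal r + mesh_size (\<K> i)))
                * emeasure (mass_measure V) (nbhd (ball x r) (ennreal C * mesh_size (\<K> i)))) \<and>
          bounded_lipschitz_dist d UNIV (W i) V
            \<le> ennreal C * (ennreal_powr (mesh_size (\<K> i)) \<beta> + mesh_size (\<K> i) / ennreal R)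
              * emeasure (mass_measure V) UNIV))"
  proof (intro exI[of _ \<L>] exI[of _ W] conjI allI impI)
    fix \<beta> assume "0 < \<beta> \<and> \<beta> \<le> 1 \<and> piecewise_C1 d \<beta> V"
    then have beta: "piecewise_C1 d \<beta> V" "0 < \<beta>" "\<beta> \<le> 1" by auto
    obtain C R where "C > 0" "R > 0" and bound:
      "\<And>L W D. mesh L \<and> approximant d V L W \<and> mesh_size L \<le> D \<Longrightarrow>
        (\<forall>x r. x \<in> measure_support (mass_measure V) \<and> 0 < r \<and> r < R \<longrightarrow>
          bounded_lipschitz_dist d (ball x r) W V
            \<le> ennreal C * (ennreal_powr D \<beta> + D / (ennreal r + D))
              * emeasure (mass_measure V) (nbhd (ball x r) (ennreal C * D))) \<and>
        bounded_lipschitz_dist d UNIV W V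
          \<le> ennreal C * (ennreal_powr D \<beta> + D / ennreal R) * emeasure (mass_measure V) UNIV"
      using approximant_regular_bounds[OF assms(1) beta vf assms(5)] by blast
    show "\<exists>C>0. \<exists>R>0. \<forall>i.
          (\<forall>x r. x \<in> measure_support (mass_measure V) \<and> 0 < r \<and> r < R \<longrightarrow>
            bounded_lipschitz_dist d (ball x r) (W i) V
              \<le> ennreal C * (ennreal_powr (mesh_size (\<K> i)) \<beta>
                    + mesh_size (\<K> i) / (ennreal r + mesh_size (\<K> i)))
                * emeasure (mass_measure V) (nbhd (ball x r) (ennreal C * mesh_size (\<K> i)))) \<and>
          bounded_lipschitz_dist d UNIV (W i) V
            \<le> ennreal C * (ennreal_powr (mesh_size (\<K> i)) \<beta> + mesh_size (\<K> i) / ennreal R)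
              * emeasure (mass_measure V) UNIV"
    proof (rule exI[of _ C], rule conjI[OF \<open>C > 0\<close>], rule exI[of _ R], rule conjI[OF \<open>R > 0\<close>], rule allI)
      fix i
      show "(\<forall>x r. x \<in> measure_support (mass_measure V) \<and> 0 < r \<and> r < R \<longrightarrow>
            bounded_lipschitz_dist d (ball x r) (W i) V
              \<le> ennreal C * (ennreal_powr (mesh_size (\<K> i)) \<beta>
                    + mesh_size (\<K> i) / (ennreal r + mesh_size (\<K> i)))
                * emeasure (mass_measure V) (nbhd (ball x r) (ennreal C * mesh_size (\<K> i)))) \<and>
          bounded_lipschitz_dist d UNIV (W i) V
            \<le> ennreal C * (ennreal_powr (mesh_size (\<K> i)) \<beta> + mesh_size (\<K> i) / ennreal R)
              * emeasure (mass_measure V) UNIV"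
        by (rule bound[of "\<L> i"]) (simp add: L W)
    qed
  qed (use L W lim in auto)
qed

end
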